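(* Let $k$ be a field of characteristic zero, $R = k[x_1,\ldots,x_n]$ with its standard grading, and $\mathscr{D} = \mathscr{D}(R,k)$ the ring of $k$-linear differential operators on $R$. Let $M$ be a graded $\mathscr{D}$-module and let $\mathrm{D}(M) = {}^*\mathrm{Hom}_R(M,E)$ be its graded Matlis dual. Then the formula $$(\partial_i\cdot\varphi)(m) = \partial_i\cdot\varphi(m) - \varphi(\partial_i\cdot m) \qquad (1\le i\le n,\ \varphi\in \mathrm{D}(M),\ m\in M),$$ together with the natural graded $R$-module structure, makes $\mathrm{D}(M)$ a graded (left) $\mathscr{D}$-module. Moreover, for all $i$ such that the de Rham cohomology space $H^i_{dR}(M)$ is finite-dimensional over $k$, there is an isomorphism of $k$-spaces $$H^i_{dR}(M)^{\vee} \cong H^{n-i}_{dR}(\mathrm{D}(M)),$$ where ${}^\vee$ denotes the $k$-space dual $\mathrm{Hom}_k(-,k)$.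
   Context: $\mathscr{D} = R\langle\partial_1,\ldots,\partial_n\rangle$ with $\partial_i = \partial/\partial x_i$; $\mathscr{D}$-modules are left modules unless stated otherwise. All gradings are $\mathbb{Z}$-gradings, with $\deg x_i = 1$ and $\deg c = 0$ for $c \in k$. A graded $\mathscr{D}$-module is a left $\mathscr{D}$-module $M$ whose underlying $R$-module is graded, $M=\bigoplus_{l\in\mathbb{Z}}M_l$, with $\partial_i(M_l)\subseteq M_{l-1}$ for all $l$ and all $1\le i\le n$ (no finite-dimensionality of the $M_l$ is assumed). $E = H^n_{(x_1,\ldots,x_n)}(R)$ is the top local cohomology module. It has $k$-basis the inverse monomials $x_1^{i_1}\cdots x_n^{i_n}$ with all $i_j\le -1$. Multiplication by $x_j$ raises the exponent $i_j$ by one (giving $0$ if the exponent becomes $0$), $\partial_j$ acts by formal differentiation, and $\deg(x_1^{i_1}\cdots x_n^{i_n}) = i_1+\cdots+i_n$. With this structure $E$ is a graded $\mathscr{D}$-module. For graded $R$-modules $M,N$, ${}^*\mathrm{Hom}_R(M,N)=\bigoplus_{d\in\mathbb{Z}}\mathrm{Hom}_R(M,N)_d\subseteq \mathrm{Hom}_R(M,N)$, where $\mathrm{Hom}_R(M,N)_d$ is the group of $R$-linear maps $f$ with $f(M_l)\subseteq N_{l+d}$ for all $l$. It is a graded $R$-module. The de Rham complex $M\otimes\Omega_R^\bullet$ of a $\mathscr{D}$-module $M$ has $M\otimes\Omega_R^i=\bigoplus_{1\le j_1<\cdots<j_i\le n} M\,dx_{j_1}\wedge\cdots\wedge dx_{j_i}$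 for $0\le i\le n$, with $k$-linear differential $d^i(m\,dx_{j_1}\wedge\cdots\wedge dx_{j_i})=\sum_{s=1}^n\partial_s(m)\,dx_s\wedge dx_{j_1}\wedge\cdots\wedge dx_{j_i}$ (usual exterior algebra conventions). $H^i_{dR}(M)$ is its $i$-th cohomology, a $k$-space. *)

theory Defs
  imports "HOL-Library.Cardinality" "HOL-Library.Poly_Mapping"
    "HOL-Algebra.Algebraic_Closure_Type" "HOL-Algebra.Algebra"
begin

section \<open>Modules over records\<close>

text \<open>The library's \<open>module\<close> locale requires a commutative ring of scalars, which excludes rings of
  differential operators.\<close>

locale left_module = R?: ring R + M?: abelian_group M
  for R :: "('a, 'c) ring_scheme" (structure) and M :: "('a, 'm, 'd) module_scheme" (structure) +
  assumes left_smult_closed: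
      "\<lbrakk>a \<in> carrier R; x \<in> carrier M\<rbrakk> \<Longrightarrow> a \<odot>\<^bsub>M\<^esub> x \<in> carrier M"
    and left_smult_l_distr:
      "\<lbrakk>a \<in> carrier R; b \<in> carrier R; x \<in> carrier M\<rbrakk> \<Longrightarrow>
        (a \<oplus> b) \<odot>\<^bsub>M\<^esub> x = a \<odot>\<^bsub>M\<^esub> x \<oplus>\<^bsub>M\<^esub> b \<odot>\<^bsub>M\<^esub> x"
    and left_smult_r_distr:
      "\<lbrakk>a \<in> carrier R; x \<in> carrier M; y \<in> carrier M\<rbrakk> \<Longrightarrow>
        a \<odot>\<^bsub>M\<^esub> (x \<oplus>\<^bsub>M\<^esub> y) = a \<odot>\<^bsub>M\<^esub> x \<oplus>\<^bsub>M\<^esub> a \<odot>\<^bsub>M\<^esub> y"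
    and left_smult_assoc:
      "\<lbrakk>a \<in> carrier R; b \<in> carrier R; x \<in> carrier M\<rbrakk> \<Longrightarrow>
        (a \<otimes> b) \<odot>\<^bsub>M\<^esub> x = a \<odot>\<^bsub>M\<^esub> (b \<odot>\<^bsub>M\<^esub> x)"
    and left_smult_one:
      "x \<in> carrier M \<Longrightarrow> \<one> \<odot>\<^bsub>M\<^esub> x = x"

definition with_smult :: "('a, 'm) module \<Rightarrow> ('b \<Rightarrow> 'm \<Rightarrow> 'm) \<Rightarrow> ('b, 'm) module" where
  "with_smult M act = \<lparr>carrier = carrier M, monoid.mult = monoid.mult M, one = one M,
     ring.zero = ring.zero M, add = add M, module.smult = act\<rparr>"

definition regular_module :: "'a ring \<Rightarrow> ('a, 'a) module" where
  "regular_module R = \<lparr>carrier = carrier R, monoid.mult = monoid.mult R, one = one R,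
     ring.zero = ring.zero R, add = add R, module.smult = monoid.mult R\<rparr>"

definition linear_maps :: "'a ring \<Rightarrow> ('a, 'm) module \<Rightarrow> ('a, 'p) module \<Rightarrow> ('m \<Rightarrow> 'p) set" where
  "linear_maps R M N = {f \<in> carrier M \<rightarrow> carrier N.
     (\<forall>x\<in>carrier M. \<forall>y\<in>carrier M. f (x \<oplus>\<^bsub>M\<^esub> y) = f x \<oplus>\<^bsub>N\<^esub> f y) \<and>
     (\<forall>a\<in>carrier R. \<forall>x\<in>carrier M. f (a \<odot>\<^bsub>M\<^esub> x) = a \<odot>\<^bsub>N\<^esub> f x)}"

definition module_isomorphic :: "'a ring \<Rightarrow> ('a, 'm) module \<Rightarrow> ('a, 'p) module \<Rightarrow> bool" where
  "module_isomorphic R M N \<longleftrightarrow> (\<exists>f\<in>linear_maps R M N. bij_betw f (carrier M) (carrier N))"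

text \<open>The multiplicative fields inherited from the ring record are meaningless for the modules
  built below, and are left undefined.\<close>

definition Hom_module :: "'a ring \<Rightarrow> ('a, 'm) module \<Rightarrow> ('a, 'p) module \<Rightarrow> ('a, 'm \<Rightarrow> 'p) module" where
  "Hom_module R M N = \<lparr>carrier = linear_maps R M N \<inter> extensional (carrier M),
     monoid.mult = undefined, one = undefined,
     ring.zero = (\<lambda>x\<in>carrier M. \<zero>\<^bsub>N\<^esub>),
     add = (\<lambda>f g. \<lambda>x\<in>carrier M. f x \<oplus>\<^bsub>N\<^esub> g x),
     module.smult = (\<lambda>a f. \<lambda>x\<in>carrier M. a \<odot>\<^bsub>N\<^esub> f x)\<rparr>"

definition dual_module :: "'a ring \<Rightarrow> ('a, 'm) module \<Rightarrow> ('a, 'm \<Rightarrow> 'a) module" where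
  "dual_module R M = Hom_module R M (regular_module R)"

definition quotient_module :: "('a, 'm) module \<Rightarrow> 'm set \<Rightarrow> ('a, 'm set) module" where
  "quotient_module M B = \<lparr>carrier = a_rcosets\<^bsub>M\<^esub> B,
     monoid.mult = undefined, one = undefined,
     ring.zero = B,
     add = set_add M,
     module.smult = (\<lambda>a C. \<Union>x\<in>C. B +>\<^bsub>M\<^esub> (a \<odot>\<^bsub>M\<^esub> x))\<rparr>"

definition finitely_generated :: "'a ring \<Rightarrow> ('a, 'm) module \<Rightarrow> bool" where
  "finitely_generated R M \<longleftrightarrow> (\<exists>B. finite B \<and> B \<subseteq> carrier M \<and>
     (\<forall>x\<in>carrier M. \<exists>c\<in>B \<rightarrow> carrier R. x = (\<Oplus>\<^bsub>M\<^esub>b\<in>B. c b \<odot>\<^bsub>M\<^esub> b)))"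

definition internal_direct_sum :: "('a, 'm) module \<Rightarrow> (int \<Rightarrow> 'm set) \<Rightarrow> bool" where
  "internal_direct_sum M gr \<longleftrightarrow>
     (\<forall>l. additive_subgroup (gr l) M) \<and>
     (\<forall>m\<in>carrier M. \<exists>!c. (\<forall>l. c l \<in> gr l) \<and> finite {l. c l \<noteq> \<zero>\<^bsub>M\<^esub>} \<and>
        m = (\<Oplus>\<^bsub>M\<^esub>l\<in>{l. c l \<noteq> \<zero>\<^bsub>M\<^esub>}. c l))"


section \<open>The polynomial ring and its differential operators\<close>

text \<open>The variables are indexed by a finite linearly ordered type, so their number is
  \<^term>\<open>CARD('n)\<close>; a monomial is the finitely supported function of its exponents.\<close>

type_synonym ('n, 'k) mpoly = "('n \<Rightarrow>\<^sub>0 nat) \<Rightarrow>\<^sub>0 'k"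

abbreviation poly_ring :: "('n, 'k::comm_ring_1) mpoly ring" where
  "poly_ring \<equiv> ring_of_type_algebra"

abbreviation base_field :: "'k::field ring" where
  "base_field \<equiv> ring_of_type_algebra"

definition const_poly :: "'k \<Rightarrow> ('n, 'k::comm_ring_1) mpoly" where
  "const_poly c = Poly_Mapping.single 0 c"

definition homogeneous_polys :: "int \<Rightarrow> ('n::finite, 'k::comm_ring_1) mpoly set" where
  "homogeneous_polys d =
     {p. \<forall>a\<in>Poly_Mapping.keys p. (\<Sum>j\<in>UNIV. int (Poly_Mapping.lookup a j)) = d}"

definition mult_op :: "('n, 'k::comm_ring_1) mpoly \<Rightarrow> ('n, 'k) mpoly \<Rightarrow> ('n, 'k) mpoly" where
  "mult_op r = (\<lambda>p. r * p)"

definition partial_op :: "'n \<Rightarrow> ('n, 'k::comm_ring_1) mpoly \<Rightarrow> ('n, 'k) mpoly" where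
  "partial_op j = (\<lambda>p. \<Sum>a\<in>Poly_Mapping.keys p. Poly_Mapping.single
     (a - Poly_Mapping.single j 1) (of_nat (Poly_Mapping.lookup a j) * Poly_Mapping.lookup p a))"

definition endo_ring :: "(('n, 'k::comm_ring_1) mpoly \<Rightarrow> ('n, 'k) mpoly) ring" where
  "endo_ring = \<lparr>carrier = {f. (\<forall>p q. f (p + q) = f p + f q) \<and>
       (\<forall>c p. f (const_poly c * p) = const_poly c * f p)},
     monoid.mult = (\<circ>), one = id, ring.zero = (\<lambda>p. 0), add = (\<lambda>f g p. f p + g p)\<rparr>"

definition diff_op_ring :: "(('n, 'k::comm_ring_1) mpoly \<Rightarrow> ('n, 'k) mpoly) ring" where
  "diff_op_ring = endo_ring\<lparr>carrier :=
     generate_ring endo_ring ({mult_op r | r. True} \<union> {partial_op j | j. True})\<rparr>"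


section \<open>Graded modules\<close>

definition graded_poly_module ::
    "(('n::finite, 'k::comm_ring_1) mpoly, 'm) module \<Rightarrow> (int \<Rightarrow> 'm set) \<Rightarrow> bool" where
  "graded_poly_module M gr \<longleftrightarrow> Module.module poly_ring M \<and> internal_direct_sum M gr \<and>
     (\<forall>d l. \<forall>r\<in>homogeneous_polys d. \<forall>m\<in>gr l. r \<odot>\<^bsub>M\<^esub> m \<in> gr (l + d))"

type_synonym ('n, 'k, 'm) dmodule = "(('n, 'k) mpoly \<Rightarrow> ('n, 'k) mpoly, 'm) module"

definition underlying_poly_module ::
    "('n, 'k::comm_ring_1, 'm) dmodule \<Rightarrow> (('n, 'k) mpoly, 'm) module" where
  "underlying_poly_module M = with_smult M (\<lambda>r m. mult_op r \<odot>\<^bsub>M\<^esub> m)"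

definition graded_dmodule ::
    "('n::finite, 'k::comm_ring_1, 'm) dmodule \<Rightarrow> (int \<Rightarrow> 'm set) \<Rightarrow> bool" where
  "graded_dmodule M gr \<longleftrightarrow> left_module diff_op_ring M \<and>
     graded_poly_module (underlying_poly_module M) gr \<and>
     (\<forall>j l. \<forall>m\<in>gr l. partial_op j \<odot>\<^bsub>M\<^esub> m \<in> gr (l - 1))"


section \<open>The top local cohomology module\<close>

text \<open>An element is a finite linear combination of inverse monomials, recorded by its coefficients
  as a function of the (all negative) exponents. A product of a monomial with an inverse monomial
  is zero as soon as one exponent becomes nonnegative.\<close>

type_synonym ('n, 'k) inv_poly = "('n \<Rightarrow> int) \<Rightarrow>\<^sub>0 'k"

definition local_coh :: "(('n::finite, 'k::comm_ring_1) mpoly, ('n, 'k) inv_poly) module" where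
  "local_coh = \<lparr>carrier = {e. \<forall>b\<in>Poly_Mapping.keys e. \<forall>j. b j \<le> -1},
     monoid.mult = undefined, one = undefined, ring.zero = 0, add = (+),
     module.smult = (\<lambda>r e. \<Sum>a\<in>Poly_Mapping.keys r. \<Sum>b\<in>Poly_Mapping.keys e.
       if \<forall>j. int (Poly_Mapping.lookup a j) + b j \<le> -1
       then Poly_Mapping.single (\<lambda>j. int (Poly_Mapping.lookup a j) + b j)
              (Poly_Mapping.lookup r a * Poly_Mapping.lookup e b)
       else 0)\<rparr>"

definition local_coh_deg :: "int \<Rightarrow> ('n::finite, 'k::comm_ring_1) inv_poly set" where
  "local_coh_deg l = {e \<in> carrier local_coh. \<forall>b\<in>Poly_Mapping.keys e. (\<Sum>j\<in>UNIV. b j) = l}"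

definition local_coh_partial :: "'n \<Rightarrow> ('n, 'k::comm_ring_1) inv_poly \<Rightarrow> ('n, 'k) inv_poly" where
  "local_coh_partial j e = (\<Sum>b\<in>Poly_Mapping.keys e.
     Poly_Mapping.single (b(j := b j - 1)) (of_int (b j) * Poly_Mapping.lookup e b))"


section \<open>The graded Matlis dual\<close>

definition Hom_deg ::
    "(('n, 'k::comm_ring_1) mpoly, 'm) module \<Rightarrow> (int \<Rightarrow> 'm set) \<Rightarrow>
     (('n, 'k) mpoly, 'p) module \<Rightarrow> (int \<Rightarrow> 'p set) \<Rightarrow> int \<Rightarrow> ('m \<Rightarrow> 'p) set" where
  "Hom_deg M grM N grN d =
     {f \<in> carrier (Hom_module poly_ring M N). \<forall>l. f ` grM l \<subseteq> grN (l + d)}"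

definition graded_Hom ::
    "(('n, 'k::comm_ring_1) mpoly, 'm) module \<Rightarrow> (int \<Rightarrow> 'm set) \<Rightarrow>
     (('n, 'k) mpoly, 'p) module \<Rightarrow> (int \<Rightarrow> 'p set) \<Rightarrow> (('n, 'k) mpoly, 'm \<Rightarrow> 'p) module" where
  "graded_Hom M grM N grN = (Hom_module poly_ring M N)\<lparr>carrier :=
     {(\<Oplus>\<^bsub>Hom_module poly_ring M N\<^esub>d\<in>A. c d) | A c.
        finite A \<and> (\<forall>d\<in>A. c d \<in> Hom_deg M grM N grN d)}\<rparr>"

definition matlis_dual ::
    "('n::finite, 'k::comm_ring_1, 'm) dmodule \<Rightarrow> (int \<Rightarrow> 'm set) \<Rightarrow>
     (('n, 'k) mpoly, 'm \<Rightarrow> ('n, 'k) inv_poly) module" where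
  "matlis_dual M gr = graded_Hom (underlying_poly_module M) gr local_coh local_coh_deg"

definition matlis_dual_deg ::
    "('n::finite, 'k::comm_ring_1, 'm) dmodule \<Rightarrow> (int \<Rightarrow> 'm set) \<Rightarrow>
     int \<Rightarrow> ('m \<Rightarrow> ('n, 'k) inv_poly) set" where
  "matlis_dual_deg M gr = Hom_deg (underlying_poly_module M) gr local_coh local_coh_deg"

definition matlis_dual_action ::
    "('n::finite, 'k::comm_ring_1, 'm) dmodule \<Rightarrow> (int \<Rightarrow> 'm set) \<Rightarrow>
     ((('n, 'k) mpoly \<Rightarrow> ('n, 'k) mpoly) \<Rightarrow>
       ('m \<Rightarrow> ('n, 'k) inv_poly) \<Rightarrow> 'm \<Rightarrow> ('n, 'k) inv_poly) \<Rightarrow> bool" where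
  "matlis_dual_action M gr act \<longleftrightarrow>
     graded_dmodule (with_smult (matlis_dual M gr) act) (matlis_dual_deg M gr) \<and>
     (\<forall>r. \<forall>\<phi>\<in>carrier (matlis_dual M gr).
        act (mult_op r) \<phi> = r \<odot>\<^bsub>matlis_dual M gr\<^esub> \<phi>) \<and>
     (\<forall>j. \<forall>\<phi>\<in>carrier (matlis_dual M gr). \<forall>m\<in>carrier M.
        act (partial_op j) \<phi> m = local_coh_partial j (\<phi> m) - \<phi> (partial_op j \<odot>\<^bsub>M\<^esub> m))"


section \<open>De Rham cohomology\<close>

text \<open>A form of degree \<open>i\<close> is the family of its coefficients, where the coefficient at a set
  \<open>J\<close> of \<open>i\<close> indices belongs to the increasingly ordered wedge product of the corresponding
  \<open>dx\<^sub>j\<close>. For \<open>s \<notin> J\<close>, moving \<open>dx\<^sub>s\<close> into place in \<open>dx\<^sub>s \<and> dx\<^sub>J\<close> costs one sign for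
  every \<open>j \<in> J\<close> with \<open>j < s\<close>; for \<open>s \<in> J\<close> the product vanishes.\<close>

definition forms ::
    "nat \<Rightarrow> ('n::{finite,linorder}, 'k::field, 'm) dmodule \<Rightarrow> ('k, 'n set \<Rightarrow> 'm) module" where
  "forms i M = \<lparr>carrier = {J. card J = i} \<rightarrow>\<^sub>E carrier M,
     monoid.mult = undefined, one = undefined,
     ring.zero = (\<lambda>J\<in>{J. card J = i}. \<zero>\<^bsub>M\<^esub>),
     add = (\<lambda>\<omega> \<eta>. \<lambda>J\<in>{J. card J = i}. \<omega> J \<oplus>\<^bsub>M\<^esub> \<eta> J),
     module.smult = (\<lambda>c \<omega>. \<lambda>J\<in>{J. card J = i}. mult_op (const_poly c) \<odot>\<^bsub>M\<^esub> \<omega> J)\<rparr>"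

definition de_rham_diff ::
    "nat \<Rightarrow> ('n::{finite,linorder}, 'k::field, 'm) dmodule \<Rightarrow> ('n set \<Rightarrow> 'm) \<Rightarrow> 'n set \<Rightarrow> 'm" where
  "de_rham_diff i M \<omega> = (\<lambda>J\<in>{J. card J = Suc i}. \<Oplus>\<^bsub>M\<^esub>s\<in>J.
     (if even (card {j \<in> J. j < s}) then partial_op s \<odot>\<^bsub>M\<^esub> \<omega> (J - {s})
      else \<ominus>\<^bsub>M\<^esub> (partial_op s \<odot>\<^bsub>M\<^esub> \<omega> (J - {s}))))"

definition cocycles ::
    "nat \<Rightarrow> ('n::{finite,linorder}, 'k::field, 'm) dmodule \<Rightarrow> ('n set \<Rightarrow> 'm) set" where
  "cocycles i M = {\<omega> \<in> carrier (forms i M). de_rham_diff i M \<omega> = \<zero>\<^bsub>forms (Suc i) M\<^esub>}"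

definition coboundaries ::
    "nat \<Rightarrow> ('n::{finite,linorder}, 'k::field, 'm) dmodule \<Rightarrow> ('n set \<Rightarrow> 'm) set" where
  "coboundaries i M = (case i of 0 \<Rightarrow> {\<zero>\<^bsub>forms 0 M\<^esub>}
     | Suc h \<Rightarrow> de_rham_diff h M ` carrier (forms h M))"

definition de_rham_cohomology ::
    "nat \<Rightarrow> ('n::{finite,linorder}, 'k::field, 'm) dmodule \<Rightarrow> ('k, ('n set \<Rightarrow> 'm) set) module" where
  "de_rham_cohomology i M =
     quotient_module ((forms i M)\<lparr>carrier := cocycles i M\<rparr>) (coboundaries i M)"

end

theory Submission
  imports Defs
begin

text \<open>Let \<open>\<rho> : E \<rightarrow> k\<close> be the coefficient of the inverse monomial with all exponents \<open>-1\<close>. Composing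
  with \<open>\<rho>\<close> identifies the graded Matlis dual of \<open>M\<close> with the \<open>k\<close>-linear functionals on \<open>M\<close> that
  vanish in all but finitely many degrees; a functional \<open>f\<close> corresponds to
  \<open>m \<mapsto> \<Sum>\<^sub>a f(x\<^sup>a m) x\<^sup>-\<^sup>1\<^sup>-\<^sup>a\<close>. As \<open>\<rho>\<close> kills the derivatives in \<open>E\<close>, \<open>x\<^sub>j\<close> and \<open>\<partial>\<^sub>j\<close> act on functionals
  by \<open>f \<mapsto> f \<circ> x\<^sub>j\<close> and \<open>f \<mapsto> - f \<circ> \<partial>\<^sub>j\<close>, so \<open>P\<close> acts by \<open>f \<mapsto> f \<circ> P\<^sup>T\<close> for the anti-automorphism \<open>P \<mapsto> P\<^sup>T\<close>
  of the ring of differential operators fixing the \<open>x\<^sub>j\<close> and negating the \<open>\<partial>\<^sub>j\<close>.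

  Up to signs, the de Rham complex of the dual is then the graded dual of the de Rham complex of
  \<open>M\<close>, and the two cohomologies are paired. A functional given on cocycles or on coboundaries
  extends to all forms; projecting to finitely many degrees makes the extension an element of the
  graded dual, and this is harmless because finite-dimensional cohomology lives in finitely many
  degrees.\<close>

text \<open>The main obstacle is the action on the dual. The required formula fixes it on
  \<open>mult_op r\<close> and \<open>partial_op j\<close> only, and \<open>diff_op_ring\<close> is
  the ring of endomorphisms generated by these, not a ring given by generators and relations. So the
  transpose of \<open>P\<close> must be shown to depend on \<open>P\<close> alone, not on an
  expression of it in the generators. To this end P x^a is written as the sum of s_c(a) x^(a+c) with
  polynomial s_c. The operator determines the s_c, because a polynomial in one variable over a field
  of characteristic zero that vanishes at infinitely many integers is zero; and the s_c determine
  the transpose.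

  The second obstacle is that the M_l may be infinite-dimensional. Functionals are extended by
  Zorn's lemma, and an extension may be nonzero in infinitely many degrees. Cutting it down must
  respect the differential, hence the use of the total degree l + i on i-forms, which d preserves.
  When a form on the dual is to be written as a coboundary, the finitely many total degrees kept are
  those that the form itself sees.\<close>

lemma type_ring_simps [simp]:
  "carrier ring_of_type_algebra = UNIV"
  "monoid.mult ring_of_type_algebra = (*)"
  "one ring_of_type_algebra = 1"
  "ring.zero ring_of_type_algebra = 0"
  "add ring_of_type_algebra = (+)"
  by (simp_all add: ring_of_type_algebra_def)

lemma regular_module_simps [simp]:
  "carrier (regular_module R) = carrier R" "add (regular_module R) = add R"
  "module.smult (regular_module R) = monoid.mult R" "ring.zero (regular_module R) = ring.zero R"
  by (simp_all add: regular_module_def)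

lemma Hom_module_simps [simp]:
  "carrier (Hom_module R M N) = linear_maps R M N \<inter> extensional (carrier M)"
  "ring.zero (Hom_module R M N) = (\<lambda>x\<in>carrier M. \<zero>\<^bsub>N\<^esub>)"
  "add (Hom_module R M N) = (\<lambda>f g. \<lambda>x\<in>carrier M. f x \<oplus>\<^bsub>N\<^esub> g x)"
  "module.smult (Hom_module R M N) = (\<lambda>a f. \<lambda>x\<in>carrier M. a \<odot>\<^bsub>N\<^esub> f x)"
  by (simp_all add: Hom_module_def)

lemma quotient_module_simps [simp]:
  "carrier (quotient_module M B) = a_rcosets\<^bsub>M\<^esub> B"
  "ring.zero (quotient_module M B) = B"
  "add (quotient_module M B) = set_add M"
  "module.smult (quotient_module M B) = (\<lambda>a C. \<Union>x\<in>C. B +>\<^bsub>M\<^esub> (a \<odot>\<^bsub>M\<^esub> x))"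
  by (simp_all add: quotient_module_def)

lemma with_smult_simps [simp]:
  "carrier (with_smult M act) = carrier M" "ring.zero (with_smult M act) = ring.zero M"
  "add (with_smult M act) = add M" "module.smult (with_smult M act) = act"
  by (simp_all add: with_smult_def)

section \<open>Additive structure shared by different records\<close>

lemma abelian_group_cong:
  assumes "abelian_group M" "carrier N = carrier M" "add N = add M" "ring.zero N = ring.zero M"
  shows "abelian_group N"
  using abelian_groupE[OF assms(1)] assms(2-) by (intro abelian_groupI) auto

lemma finsum_cong_record:
  assumes "carrier N = carrier M" "add N = add M" "ring.zero N = ring.zero M"
  shows "finsum N f A = finsum M f A"
  using assms by (simp add: finsum_def finprod_def)

lemma a_inv_cong_record:
  assumes "carrier N = carrier M" "add N = add M" "ring.zero N = ring.zero M"
  shows "\<ominus>\<^bsub>N\<^esub> x = \<ominus>\<^bsub>M\<^esub> x"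
  using assms by (simp add: a_inv_def m_inv_def)


section \<open>Linear algebra over a field\<close>

lemma module_base_field_a_inv:
  fixes V (structure)
  assumes "Module.module base_field V" "x \<in> carrier V"
  shows "\<ominus> x = (-1) \<odot> x"
proof -
  interpret Module.module base_field V by fact
  have "(-1) \<odot> x \<oplus> x = ((-1) + 1) \<odot> x"
    using smult_l_distr[of "-1" 1 x] smult_one[of x] assms(2) by simp
  also have "\<dots> = \<zero>" using smult_l_null[of x] assms(2) by simp
  finally show ?thesis using assms(2) smult_closed[of "-1" x]
    by (metis M.add.inv_equality UNIV_I type_ring_simps(1))
qed

text \<open>Closure under negation comes from the scalars, since
  \<open>\<ominus> x = (-1) \<odot> x\<close>.\<close>

lemma submodule_base_field_iff:
  fixes V (structure)
  assumes "Module.module base_field V"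
  shows "submodule U base_field V \<longleftrightarrow> U \<subseteq> carrier V \<and> \<zero> \<in> U \<and>
     (\<forall>x\<in>U. \<forall>y\<in>U. x \<oplus> y \<in> U) \<and> (\<forall>c. \<forall>x\<in>U. c \<odot> x \<in> U)"
proof -
  interpret Module.module base_field V by fact
  show ?thesis
  proof
    assume U: "submodule U base_field V"
    then interpret U: submodule U base_field V .
    show "U \<subseteq> carrier V \<and> \<zero> \<in> U \<and>
     (\<forall>x\<in>U. \<forall>y\<in>U. x \<oplus> y \<in> U) \<and> (\<forall>c. \<forall>x\<in>U. c \<odot> x \<in> U)"
      using submoduleE[OF U] U.one_closed by auto
  next
    assume *: "U \<subseteq> carrier V \<and> \<zero> \<in> U \<and>
     (\<forall>x\<in>U. \<forall>y\<in>U. x \<oplus> y \<in> U) \<and> (\<forall>c. \<forall>x\<in>U. c \<odot> x \<in> U)"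
    then show "submodule U base_field V"
      by (intro submoduleI) (auto simp: module_base_field_a_inv[OF assms] subset_iff)
  qed
qed

text \<open>Linearity is demanded on the subset \<open>W\<close> only, so that one notion covers
  functionals on a whole space and those on a subspace that are still to be extended. Values outside
  \<open>W\<close> are unconstrained.\<close>

definition functional_on :: "'v set \<Rightarrow> ('k::field, 'v) module \<Rightarrow> ('v \<Rightarrow> 'k) \<Rightarrow> bool" where
  "functional_on W V g \<longleftrightarrow> (\<forall>x\<in>W. \<forall>y\<in>W. g (x \<oplus>\<^bsub>V\<^esub> y) = g x + g y) \<and>
     (\<forall>c. \<forall>x\<in>W. g (c \<odot>\<^bsub>V\<^esub> x) = c * g x)"

lemma functional_onD:
  fixes V (structure)
  assumes "functional_on W V g"
  shows "x \<in> W \<Longrightarrow> y \<in> W \<Longrightarrow> g (x \<oplus> y) = g x + g y"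
    "x \<in> W \<Longrightarrow> g (c \<odot> x) = c * g x"
  using assms by (auto simp: functional_on_def)

lemma functional_on_mono: "functional_on W V g \<Longrightarrow> W' \<subseteq> W \<Longrightarrow> functional_on W' V g"
  unfolding functional_on_def by blast

lemma functional_on_zero:
  fixes V (structure)
  assumes "Module.module base_field V" "functional_on W V g" "\<zero> \<in> W"
  shows "g \<zero> = 0"
proof -
  interpret Module.module base_field V by fact
  have "g (0 \<odot> \<zero>) = 0" using functional_onD(2)[OF assms(2,3), of 0] by simp
  then show ?thesis using smult_r_null[of 0] by simp
qed

text \<open>A subspace maximal among those meeting \<open>W\<close> exactly in the kernel of \<open>g\<close> is a hyperplane,
  and it is the kernel of the extension.\<close>

lemma functional_extension:
  fixes V (structure)
  assumes V: "Module.module base_field V" and W: "submodule W base_field V"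
    and g: "functional_on W V g"
  obtains h where "functional_on (carrier V) V h" "\<And>w. w \<in> W \<Longrightarrow> h w = g w"
proof (cases "\<forall>w\<in>W. g w = 0")
  case True
  then show ?thesis by (intro that[of "\<lambda>_. 0"]) (auto simp: functional_on_def)
next
  case False
  interpret Module.module base_field V by fact
  note sub = submodule_base_field_iff[OF V]
  have sc [simp]: "c \<odot> x \<in> carrier V" if "x \<in> carrier V" for c x using that smult_closed by simp
  have ld: "(c + d) \<odot> x = c \<odot> x \<oplus> d \<odot> x" if "x \<in> carrier V" for c d x
    using smult_l_distr[of c d x] that by simp
  have rd: "c \<odot> (x \<oplus> y) = c \<odot> x \<oplus> c \<odot> y" if "x \<in> carrier V" "y \<in> carrier V" for c x y
    using smult_r_distr[of c x y] that by simp
  have as: "c \<odot> (d \<odot> x) = (c * d) \<odot> x" if "x \<in> carrier V" for c d x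
    using smult_assoc1[of c d x] that by simp
  have one: "1 \<odot> x = x" if "x \<in> carrier V" for x using smult_one[of x] that by simp
  have nul: "0 \<odot> x = \<zero>" if "x \<in> carrier V" for x using smult_l_null[of x] that by simp
  have Wc: "W \<subseteq> carrier V" and Wa: "\<And>x y. x \<in> W \<Longrightarrow> y \<in> W \<Longrightarrow> x \<oplus> y \<in> W"
    and Ws: "\<And>c x. x \<in> W \<Longrightarrow> c \<odot> x \<in> W" and W0: "\<zero> \<in> W"
    using W sub by auto
  define N where "N = {w \<in> W. g w = 0}"
  obtain w1 where w1: "w1 \<in> W" "g w1 \<noteq> 0" using False by auto
  \<comment> \<open>Scaled so that \<open>g w0 = 1\<close>; the line through \<open>w0\<close> will
    be the complement of the hyperplane.\<close>
  define w0 where "w0 = inverse (g w1) \<odot> w1"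
  have w0: "w0 \<in> W" "g w0 = 1" using w1 Ws functional_onD(2)[OF g w1(1)] by (auto simp: w0_def)
  then have w0c [simp]: "w0 \<in> carrier V" using Wc by auto
  have N: "submodule N base_field V"
    unfolding sub N_def using Wc Wa Ws W0 functional_onD[OF g] functional_on_zero[OF V g W0] by auto
  define SS where "SS = {U. submodule U base_field V \<and> U \<inter> W = N}"
  have "\<exists>U\<in>SS. \<forall>Y\<in>SS. U \<subseteq> Y \<longrightarrow> Y = U"
  proof (rule subset_Zorn_nonempty)
    show "SS \<noteq> {}" using N by (auto simp: SS_def N_def)
    fix CC assume ne: "CC \<noteq> {}" and ch: "subset.chain SS CC"
    then have C: "\<And>Y. Y \<in> CC \<Longrightarrow> Y \<in> SS" and tot: "\<And>Y Y2. Y \<in> CC \<Longrightarrow> Y2 \<in> CC \<Longrightarrow> Y \<subseteq> Y2 \<or> Y2 \<subseteq> Y"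
      by (auto simp: subset_chain_def)
    have "x \<oplus> y \<in> \<Union>CC" if xy: "x \<in> \<Union>CC" "y \<in> \<Union>CC" for x y
    proof -
      obtain Y where "Y \<in> CC" "x \<in> Y" "y \<in> Y" using tot xy by blast
      then show ?thesis using C[of Y] by (auto simp: SS_def sub)
    qed
    moreover have "\<Union>CC \<inter> W = N" using C ne by (auto simp: SS_def)
    moreover have "\<zero> \<in> \<Union>CC" using ne C by (fastforce simp: SS_def sub)
    moreover have "\<Union>CC \<subseteq> carrier V" using C unfolding SS_def sub by blast
    moreover have "c \<odot> x \<in> \<Union>CC" if "x \<in> \<Union>CC" for c x using C that unfolding SS_def sub by blast
    ultimately show "\<Union>CC \<in> SS" unfolding SS_def sub by blast
  qed
  then obtain U where US_mem: "U \<in> SS" and max: "\<And>Y. Y \<in> SS \<Longrightarrow> U \<subseteq> Y \<Longrightarrow> Y = U" by blast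
  then have Uc: "U \<subseteq> carrier V" and Ua: "\<And>x y. x \<in> U \<Longrightarrow> y \<in> U \<Longrightarrow> x \<oplus> y \<in> U"
    and Us: "\<And>c x. x \<in> U \<Longrightarrow> c \<odot> x \<in> U" and U0: "\<zero> \<in> U" and UW: "U \<inter> W = N"
    by (auto simp: SS_def sub)
  \<comment> \<open>If \<open>v\<close> is not in \<open>U\<close>, maximality forces U + k v to
    meet \<open>W\<close> in some w = u + c v with g w nonzero; here c is nonzero, as otherwise w
    would lie in U and hence in N. Subtracting g w times \<open>w0\<close> from w gives an element
    of N, so w lies in U + k w0, and solving for v puts v there as well.\<close>
  have ex: "\<exists>d. \<exists>u\<in>U. v = u \<oplus> d \<odot> w0" if v: "v \<in> carrier V" for v
  proof (cases "v \<in> U")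
    case True
    then show ?thesis using v by (intro exI[of _ 0] bexI[of _ v]) (auto simp: nul)
  next
    case False
    define U' where "U' = {u \<oplus> c \<odot> v | u c. u \<in> U}"
    have U'I: "u \<oplus> c \<odot> v \<in> U'" if "u \<in> U" for u c using that by (auto simp: U'_def)
    have "submodule U' base_field V" unfolding sub
    proof (intro conjI ballI allI)
      show "U' \<subseteq> carrier V" using Uc v by (auto simp: U'_def)
      show "\<zero> \<in> U'" using U'I[OF U0, of 0] v by (simp add: nul)
      fix x y assume "x \<in> U'" "y \<in> U'"
      then obtain u c u' c' where 1: "u \<in> U" "u' \<in> U" "x = u \<oplus> c \<odot> v" "y = u' \<oplus> c' \<odot> v"
        by (auto simp: U'_def)
      have "x \<oplus> y = (u \<oplus> u') \<oplus> (c + c') \<odot> v"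
        using 1 Uc v by (auto simp: ld M.a_ac subset_iff)
      then show "x \<oplus> y \<in> U'" using U'I[OF Ua] 1 by auto
    next
      fix a x assume "x \<in> U'"
      then obtain u c where 1: "u \<in> U" "x = u \<oplus> c \<odot> v" by (auto simp: U'_def)
      have "a \<odot> x = a \<odot> u \<oplus> (a * c) \<odot> v"
        using 1 Uc v by (auto simp: rd as subset_iff)
      then show "a \<odot> x \<in> U'" using U'I[OF Us] 1 by auto
    qed
    moreover have UU': "U \<subseteq> U'" using U'I[of _ 0] Uc v by (auto simp: nul subset_iff) 
    moreover have "v \<in> U'" using U'I[OF U0, of 1] v by (simp add: one)
    ultimately have "U' \<inter> W \<noteq> N" using max[of U'] False by (auto simp: SS_def)
    then obtain w where w: "w \<in> U'" "w \<in> W" "g w \<noteq> 0" using UU' UW by (auto simp: N_def)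
    then obtain u c where uc: "u \<in> U" "w = u \<oplus> c \<odot> v" by (auto simp: U'_def)
    have c: "c \<noteq> 0"
    proof
      assume "c = 0"
      then have "w \<in> U" using uc v Uc by (auto simp: nul subset_iff)
      then show False using w UW by (auto simp: N_def)
    qed
    define n where "n = w \<oplus> (- g w) \<odot> w0"
    have "n \<in> N" unfolding n_def N_def using w w0 Wa Ws functional_onD[OF g] by auto
    then have n: "n \<in> U" using UW by auto
    have uV: "u \<in> carrier V" "w \<in> carrier V" "n \<in> carrier V" using uc Uc w Wc n by auto
    have wn: "w = n \<oplus> g w \<odot> w0"
      using uV ld[of w0 "- g w" "g w"] by (simp add: n_def M.a_ac nul)
    have "c \<odot> v = w \<oplus> (-1) \<odot> u"
      using uV v module_base_field_a_inv[OF V, of u] uc(2) 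
      by (metis M.add.inv_solve_left' M.add.m_comm M.add.inv_closed sc)
    also have "\<dots> = (n \<oplus> (-1) \<odot> u) \<oplus> g w \<odot> w0"
      by (subst wn) (use uV in \<open>simp add: M.a_ac\<close>)
    finally have e: "c \<odot> v = (n \<oplus> (-1) \<odot> u) \<oplus> g w \<odot> w0" .
    have "v = inverse c \<odot> (c \<odot> v)" using c v by (simp add: as one)
    also have "\<dots> = inverse c \<odot> (n \<oplus> (-1) \<odot> u) \<oplus> (inverse c * g w) \<odot> w0"
      unfolding e using uV by (simp add: rd as)
    finally show ?thesis using n uc Us Ua by blast
  qed
  \<comment> \<open>Two decompositions of one vector differ by a multiple of \<open>w0\<close> that
    lies in U and in W, hence in N, where \<open>g\<close> vanishes; as \<open>g w0 = 1\<close>, the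
    multiple is zero.\<close>
  have uniq: "d = d'" if "u \<in> U" "u' \<in> U" "u \<oplus> d \<odot> w0 = u' \<oplus> d' \<odot> w0" for u u' d d'
  proof -
    have uV: "u \<in> carrier V" "u' \<in> carrier V" using that Uc by auto
    have "u \<oplus> (d - d') \<odot> w0 = (u \<oplus> d \<odot> w0) \<oplus> (- d') \<odot> w0"
      using uV ld[of w0 d "- d'"] by (simp add: M.a_assoc)
    also have "\<dots> = u' \<oplus> (d' - d') \<odot> w0"
      unfolding that(3) using uV ld[of w0 d' "- d'"] by (simp add: M.a_assoc)
    finally have "u' = u \<oplus> (d - d') \<odot> w0" using uV by (simp add: nul)
    then have "(d - d') \<odot> w0 = (-1) \<odot> u \<oplus> u'"
      using uV module_base_field_a_inv[OF V, of u] M.r_neg1[of u "(d - d') \<odot> w0"] by simp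
    then have "(d - d') \<odot> w0 \<in> U" using that Ua Us by auto
    then have "(d - d') \<odot> w0 \<in> U \<inter> W" using Ws w0 by auto
    then have "g ((d - d') \<odot> w0) = 0" using UW by (auto simp: N_def)
    then show ?thesis using functional_onD(2)[OF g w0(1)] w0 by simp
  qed
  define h where "h v = (THE d. \<exists>u\<in>U. v = u \<oplus> d \<odot> w0)" for v
  have h: "h (u \<oplus> d \<odot> w0) = d" if "u \<in> U" for u d
    unfolding h_def using that uniq by (intro the_equality) blast+
  show ?thesis
  proof (rule that[of h])
    show "functional_on (carrier V) V h" unfolding functional_on_def
    proof (intro conjI ballI allI)
      fix x y assume "x \<in> carrier V" "y \<in> carrier V"
      then obtain d u d' u' where 1: "u \<in> U" "u' \<in> U" "x = u \<oplus> d \<odot> w0" "y = u' \<oplus> d' \<odot> w0"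
        using ex by meson
      have "x \<oplus> y = (u \<oplus> u') \<oplus> (d + d') \<odot> w0"
        using 1 Uc by (auto simp: ld M.a_ac subset_iff)
      then show "h (x \<oplus> y) = h x + h y" using 1 h Ua by simp
    next
      fix c x assume "x \<in> carrier V"
      then obtain d u where 1: "u \<in> U" "x = u \<oplus> d \<odot> w0" using ex by meson
      have "c \<odot> x = c \<odot> u \<oplus> (c * d) \<odot> w0"
        using 1 Uc by (auto simp: rd as subset_iff)
      then show "h (c \<odot> x) = c * h x" using 1 h Us by simp
    qed
    fix w assume w: "w \<in> W"
    define n where "n = w \<oplus> (- g w) \<odot> w0"
    have "n \<in> N" unfolding n_def N_def using w w0 Wa Ws functional_onD[OF g] by auto
    then have n: "n \<in> U" using UW by auto
    have "w = n \<oplus> g w \<odot> w0"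
      using w Wc ld[of w0 "- g w" "g w"] by (auto simp add: n_def M.a_ac nul subset_iff)
    then show "h w = g w" using h[OF n] by metis
  qed
qed


text \<open>If \<open>x\<close> were nonzero, c x \<mapsto> c would be a functional on the line
  through \<open>x\<close>, and its extension would take the value 1 at \<open>x\<close>. This
  allows equations in a module to be checked by comparing values in the field.\<close>

lemma functional_separates:
  fixes V (structure)
  assumes V: "Module.module base_field V" and x: "x \<in> carrier V"
    and null: "\<And>h. functional_on (carrier V) V h \<Longrightarrow> h x = 0"
  shows "x = \<zero>"
proof (rule ccontr)
  assume ne: "x \<noteq> \<zero>"
  interpret Module.module base_field V by fact
  define W where "W = range (\<lambda>c. c \<odot> x)"
  have add: "c \<odot> x \<oplus> d \<odot> x = (c + d) \<odot> x" for c d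
    using smult_l_distr[of c d x] x by simp
  have mul: "c \<odot> (d \<odot> x) = (c * d) \<odot> x" for c d
    using smult_assoc1[of c d x] x by simp
  have W: "submodule W base_field V"
    unfolding submodule_base_field_iff[OF V]
  proof (intro conjI ballI allI)
    show "W \<subseteq> carrier V" using smult_closed x by (auto simp: W_def)
    show "\<zero> \<in> W" using smult_l_null[OF x] unfolding W_def by (metis rangeI type_ring_simps(4))
    show "a \<oplus> b \<in> W" if "a \<in> W" "b \<in> W" for a b using that add by (auto simp: W_def)
    show "c \<odot> a \<in> W" if "a \<in> W" for a c using that mul by (auto simp: W_def)
  qed
  have inj: "c = d" if "c \<odot> x = d \<odot> x" for c d
  proof (rule ccontr)
    assume "c \<noteq> d"
    have "(c - d) \<odot> x = \<zero>"
      using add[of c "- d"] that add[of d "- d"] smult_l_null[OF x] by simp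
    then have "inverse (c - d) \<odot> ((c - d) \<odot> x) = \<zero>" using smult_r_null by simp
    then show False using mul smult_one[OF x] ne \<open>c \<noteq> d\<close> by simp
  qed
  define g where "g y = (THE c. y = c \<odot> x)" for y
  have g: "g (c \<odot> x) = c" for c unfolding g_def by (rule the_equality) (auto dest: inj)
  have "functional_on W V g" unfolding functional_on_def W_def by (auto simp: add mul g)
  from functional_extension[OF V W this] obtain h
    where h: "functional_on (carrier V) V h" "\<And>w. w \<in> W \<Longrightarrow> h w = g w" by blast
  have "x = 1 \<odot> x" using smult_one[OF x] by simp
  then have "h x = 1" using h(2)[of x] g[of 1] unfolding W_def by (metis rangeI)
  then show False using null[OF h(1)] by simp
qed


section \<open>Quotients and their duals\<close>

lemma submodule_abelian_subgroup:
  assumes V: "Module.module base_field V" and B: "submodule B base_field V"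
  shows "abelian_subgroup B V"
  using V B by (intro abelian_subgroupI3 additive_subgroupI submodule.axioms(1))
    (auto simp: Module.module_def)

lemma coset_iff:
  "y \<in> B +>\<^bsub>V\<^esub> x \<longleftrightarrow> (\<exists>b\<in>B. y = b \<oplus>\<^bsub>V\<^esub> x)"
  by (auto simp: a_r_coset_def')

lemma rcosets_eq: "a_rcosets\<^bsub>V\<^esub> B = (\<lambda>x. B +>\<^bsub>V\<^esub> x) ` carrier V"
  by (auto simp: A_RCOSETS_def')

lemma coset_eq_iff:
  fixes V (structure)
  assumes V: "Module.module base_field V" and B: "submodule B base_field V"
    and x: "x \<in> carrier V" and y: "y \<in> carrier V"
  shows "B +> x = B +> y \<longleftrightarrow> (\<exists>b\<in>B. y = b \<oplus> x)"
proof -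
  interpret abelian_subgroup B V using submodule_abelian_subgroup[OF V B] .
  show ?thesis
    using a_rcos_self[OF y] a_repr_independence[OF _ x a_subgroup, of y] coset_iff[of y V B x] by metis
qed

lemma coset_eq_self_iff:
  fixes V (structure)
  assumes V: "Module.module base_field V" and B: "submodule B base_field V"
    and x: "x \<in> carrier V"
  shows "B +> x = B \<longleftrightarrow> x \<in> B"
proof -
  interpret abelian_subgroup B V using submodule_abelian_subgroup[OF V B] .
  have "x \<in> B" if "B +> x = B" using a_rcos_self[OF x] that by simp
  moreover have "B +> x = B" if "x \<in> B" by (rule a_coset_join2) (use x that a_subgroup in auto)
  ultimately show ?thesis by (rule iffI)
qed

text \<open>The scalar action of the quotient is a union over all representatives of a coset. The
  cosets in this union coincide, since changing the representative by \<open>b \<in> B\<close>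
  changes the multiple by \<open>c \<odot> b \<in> B\<close>.\<close>

lemma quotient_smult:
  fixes V (structure)
  assumes V: "Module.module base_field V" and B: "submodule B base_field V"
    and x: "x \<in> carrier V"
  shows "c \<odot>\<^bsub>quotient_module V B\<^esub> (B +> x) = B +> (c \<odot> x)"
proof -
  interpret abelian_subgroup B V using submodule_abelian_subgroup[OF V B] .
  interpret Module.module base_field V by fact
  have sc: "c \<odot> z \<in> carrier V" if "z \<in> carrier V" for z using that smult_closed by simp
  have "B +> (c \<odot> y) = B +> (c \<odot> x)" if y: "y \<in> B +> x" for y
  proof -
    obtain b where b: "b \<in> B" "y = b \<oplus> x" using y unfolding coset_iff by blast
    have bV: "b \<in> carrier V" using a_subset b(1) by (rule subsetD)
    have yV: "y \<in> carrier V" unfolding b(2) using bV x by simp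
    have "c \<odot> y = c \<odot> b \<oplus> c \<odot> x"
      unfolding b(2) by (rule smult_r_distr) (use bV x in simp_all)
    moreover have "c \<odot> b \<in> B" using B b by (auto simp: submodule_base_field_iff[OF V])
    ultimately show ?thesis
      using coset_eq_iff[OF V B, of "c \<odot> x" "c \<odot> y"] sc[OF x] sc[OF yV] by metis
  qed
  then have "(\<Union>y\<in>B +> x. B +> (c \<odot> y)) = (\<Union>y\<in>B +> x. B +> (c \<odot> x))"
    by (intro SUP_cong) auto
  also have "\<dots> = B +> (c \<odot> x)" using a_rcos_self[OF x] by (metis UN_constant empty_iff)
  finally show ?thesis by simp
qed

lemma quotient_add:
  fixes V (structure)
  assumes V: "Module.module base_field V" and B: "submodule B base_field V"
    and x: "x \<in> carrier V" "y \<in> carrier V"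
  shows "(B +> x) \<oplus>\<^bsub>quotient_module V B\<^esub> (B +> y) = B +> (x \<oplus> y)"
proof -
  interpret abelian_subgroup B V using submodule_abelian_subgroup[OF V B] .
  show ?thesis using a_rcos_sum x by simp
qed

lemma quotient_module_is_module:
  fixes V (structure)
  assumes V: "Module.module base_field V" and B: "submodule B base_field V"
  shows "Module.module base_field (quotient_module V B)"
proof -
  interpret S: abelian_subgroup B V using submodule_abelian_subgroup[OF V B] .
  interpret Module.module base_field V by fact
  note add = quotient_add[OF V B] and sm = quotient_smult[OF V B]
  have zero: "\<zero>\<^bsub>quotient_module V B\<^esub> = B +> \<zero>" using S.a_subset by simp
  have car: "carrier (quotient_module V B) = (\<lambda>x. B +> x) ` carrier V"
    by (simp add: rcosets_eq)
  have sc: "c \<odot> x \<in> carrier V" if "x \<in> carrier V" for c x using that smult_closed by simp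
  have ab: "abelian_group (quotient_module V B)"
  proof (rule abelian_groupI, goal_cases)
    case (6 x)
    then obtain a where a: "a \<in> carrier V" "x = B +> a" unfolding car by auto
    then show ?case unfolding car zero
      by (intro bexI[of _ "B +> (\<ominus> a)"]) (auto simp: add S.l_neg simp del: quotient_module_simps)
  qed (auto simp: car zero add S.a_ac simp del: quotient_module_simps)
  show ?thesis
  proof (intro moduleI ab comm_ring_1_class.cring_from_type_algebra, goal_cases)
    case (1 a x)
    then show ?case by (auto simp: car sm sc simp del: quotient_module_simps)
  next
    case (2 a b x)
    then show ?case using smult_l_distr by (auto simp: car sm sc add simp del: quotient_module_simps)
  next
    case (3 a x y)
    then show ?case using smult_r_distr by (auto simp: car sm sc add simp del: quotient_module_simps)
  next
    case (4 a b x)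
    then show ?case using smult_assoc1 by (auto simp: car sm sc add simp del: quotient_module_simps)
  next
    case (5 x)
    then show ?case using smult_one by (auto simp: car sm sc add simp del: quotient_module_simps)
  qed
qed

text \<open>The formal part of the duality, for any pairing of \<open>W\<close> with
  \<open>V\<close> that kills \<open>B\<close>. The isomorphism sends a functional on V/B to the
  class of an element of \<open>W\<close> representing it. Such an element exists by
  \<open>ext\<close>; its class is well defined by \<open>B'_iff\<close>, the map is injective by
  \<open>kill'\<close>, and it is onto because by \<open>kill\<close> every element of
  \<open>W\<close> induces a functional on V/B.\<close>

lemma dual_quotient_isomorphic:
  fixes pair :: "'w \<Rightarrow> 'v \<Rightarrow> 'k::field"
    and V (structure)
  assumes V: "Module.module base_field V" and B: "submodule B base_field V"
    and W: "Module.module base_field W" and B': "submodule B' base_field W"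
    and pair_add: "\<And>p q x. p \<in> carrier W \<Longrightarrow> q \<in> carrier W \<Longrightarrow> x \<in> carrier V \<Longrightarrow>
          pair (p \<oplus>\<^bsub>W\<^esub> q) x = pair p x + pair q x"
    and pair_smult: "\<And>c p x. p \<in> carrier W \<Longrightarrow> x \<in> carrier V \<Longrightarrow>
          pair (c \<odot>\<^bsub>W\<^esub> p) x = c * pair p x"
    and pair_fun: "\<And>p. p \<in> carrier W \<Longrightarrow> functional_on (carrier V) V (pair p)"
    and kill: "\<And>p b. p \<in> carrier W \<Longrightarrow> b \<in> B \<Longrightarrow> pair p b = 0"
    and B'_iff: "\<And>p. p \<in> carrier W \<Longrightarrow> (\<And>x. x \<in> carrier V \<Longrightarrow> pair p x = 0) \<Longrightarrow> p \<in> B'"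
    and kill': "\<And>p x. p \<in> B' \<Longrightarrow> x \<in> carrier V \<Longrightarrow> pair p x = 0"
    and ext: "\<And>g. functional_on (carrier V) V g \<Longrightarrow> (\<And>b. b \<in> B \<Longrightarrow> g b = 0) \<Longrightarrow>
        \<exists>p\<in>carrier W. \<forall>x\<in>carrier V. pair p x = g x"
  shows "module_isomorphic base_field (dual_module base_field (quotient_module V B)) (quotient_module W B')"
proof -
  interpret BV: abelian_subgroup B V using submodule_abelian_subgroup[OF V B] .
  interpret BW: abelian_subgroup B' W using submodule_abelian_subgroup[OF W B'] .
  interpret V: Module.module base_field V by fact
  interpret W: Module.module base_field W by fact
  interpret QV: Module.module base_field "quotient_module V B"
    using quotient_module_is_module[OF V B] .
  interpret QW: Module.module base_field "quotient_module W B'"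
    using quotient_module_is_module[OF W B'] .
  let ?Q = "quotient_module V B" and ?Q' = "quotient_module W B'"
  let ?D = "dual_module base_field ?Q"
  have car: "carrier ?Q = (\<lambda>x. B +> x) ` carrier V" "carrier ?Q' = (\<lambda>x. B' +>\<^bsub>W\<^esub> x) ` carrier W"
    by (simp_all add: rcosets_eq)
  note simps = car quotient_add[OF V B] quotient_add[OF W B'] quotient_smult[OF V B] quotient_smult[OF W B']
  have Wsc: "c \<odot>\<^bsub>W\<^esub> x \<in> carrier W" if "x \<in> carrier W" for c x using that W.smult_closed by simp
  have Vsc: "c \<odot> x \<in> carrier V" if "x \<in> carrier V" for c x using that V.smult_closed by simp
  define rep where "rep f p \<longleftrightarrow> p \<in> carrier W \<and> (\<forall>x\<in>carrier V. pair p x = f (B +> x))" for f p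
  have D_iff: "f \<in> carrier ?D \<longleftrightarrow> functional_on (carrier ?Q) ?Q f \<and> f \<in> extensional (carrier ?Q)" for f
    by (auto simp: dual_module_def linear_maps_def functional_on_def simp del: quotient_module_simps)
  have diff: "\<exists>b\<in>B'. q = b \<oplus>\<^bsub>W\<^esub> p" if "p \<in> carrier W" "q \<in> carrier W"
      and eq: "\<And>x. x \<in> carrier V \<Longrightarrow> pair p x = pair q x" for p q
  proof (intro bexI[of _ "q \<oplus>\<^bsub>W\<^esub> (-1) \<odot>\<^bsub>W\<^esub> p"] B'_iff)
    have "(-1) \<odot>\<^bsub>W\<^esub> p = \<ominus>\<^bsub>W\<^esub> p" using module_base_field_a_inv[OF W] that by simp
    then show "q = q \<oplus>\<^bsub>W\<^esub> (-1) \<odot>\<^bsub>W\<^esub> p \<oplus>\<^bsub>W\<^esub> p" using that by (simp add: BW.a_assoc BW.l_neg)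
  qed (use that Wsc in \<open>auto simp: pair_add pair_smult\<close>)
  have rep_ex: "\<exists>p. rep f p" if f: "f \<in> carrier ?D" for f
  proof -
    have f': "functional_on (carrier ?Q) ?Q f" using f D_iff by blast
    have "functional_on (carrier V) V (\<lambda>x. f (B +> x))"
      unfolding functional_on_def
    proof (intro conjI ballI allI)
      fix x y assume xy: "x \<in> carrier V" "y \<in> carrier V"
      show "f (B +> (x \<oplus> y)) = f (B +> x) + f (B +> y)"
        unfolding quotient_add[OF V B xy, symmetric]
        by (rule functional_onD(1)[OF f']) (use xy in \<open>auto simp: car simp del: quotient_module_simps\<close>)
    next
      fix c x assume x: "x \<in> carrier V"
      show "f (B +> (c \<odot> x)) = c * f (B +> x)"
        unfolding quotient_smult[OF V B x, symmetric]
        by (rule functional_onD(2)[OF f']) (use x in \<open>auto simp: car simp del: quotient_module_simps\<close>)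
    qed
    moreover have "f (B +> b) = 0" if "b \<in> B" for b
      using coset_eq_self_iff[OF V B, of b] that BV.a_subset functional_on_zero[OF QV.module_axioms f' QV.M.zero_closed]
      by auto
    ultimately show ?thesis using ext[of "\<lambda>x. f (B +> x)"] by (auto simp: rep_def)
  qed
  \<comment> \<open>By \<open>diff\<close>, the choice of the representing element does not affect
    its class modulo \<open>B'\<close>.\<close>
  define F where "F f = B' +>\<^bsub>W\<^esub> (SOME p. rep f p)" for f
  have F: "F f = B' +>\<^bsub>W\<^esub> p" if "rep f p" for f p
  proof -
    define q where "q = (SOME p. rep f p)"
    have "rep f q" unfolding q_def using that by (rule someI)
    then show ?thesis unfolding F_def q_def[symmetric]
      by (subst coset_eq_iff[OF W B']) (use that in \<open>auto simp: rep_def intro!: diff\<close>)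
  qed
  show ?thesis unfolding module_isomorphic_def
  proof (intro bexI[of _ F])
    show "F \<in> linear_maps base_field ?D ?Q'"
      unfolding linear_maps_def
    proof (intro CollectI conjI ballI)
      show "F \<in> carrier ?D \<rightarrow> carrier ?Q'"
      proof
        fix f assume "f \<in> carrier ?D"
        then obtain p where p: "rep f p" using rep_ex by blast
        then show "F f \<in> carrier ?Q'" unfolding F[OF p] by (auto simp: car rep_def simp del: quotient_module_simps)
      qed
    next
      fix f g assume "f \<in> carrier ?D" "g \<in> carrier ?D"
      then obtain p q where p: "rep f p" and q: "rep g q" using rep_ex by blast
      have "rep (f \<oplus>\<^bsub>?D\<^esub> g) (p \<oplus>\<^bsub>W\<^esub> q)"
        using p q by (auto simp: rep_def dual_module_def pair_add car simp del: quotient_module_simps)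
      then show "F (f \<oplus>\<^bsub>?D\<^esub> g) = F f \<oplus>\<^bsub>?Q'\<^esub> F g"
        unfolding F[OF p] F[OF q] using F[of "f \<oplus>\<^bsub>?D\<^esub> g" "p \<oplus>\<^bsub>W\<^esub> q"] p q by (subst quotient_add[OF W B']) (auto simp: rep_def)
    next
      fix c :: 'k and f assume "f \<in> carrier ?D"
      then obtain p where p: "rep f p" using rep_ex by blast
      have "rep (c \<odot>\<^bsub>?D\<^esub> f) (c \<odot>\<^bsub>W\<^esub> p)"
        using p by (auto simp: rep_def dual_module_def pair_smult Wsc car simp del: quotient_module_simps)
      then show "F (c \<odot>\<^bsub>?D\<^esub> f) = c \<odot>\<^bsub>?Q'\<^esub> F f"
        unfolding F[OF p] using F[of "c \<odot>\<^bsub>?D\<^esub> f" "c \<odot>\<^bsub>W\<^esub> p"] p by (subst quotient_smult[OF W B']) (auto simp: rep_def)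
    qed
    show "bij_betw F (carrier ?D) (carrier ?Q')"
      unfolding bij_betw_def
    proof (intro conjI inj_onI equalityI subsetI)
      fix f g assume fg: "f \<in> carrier ?D" "g \<in> carrier ?D" "F f = F g"
      then obtain p q where p: "rep f p" and q: "rep g q" using rep_ex by blast
      then have "B' +>\<^bsub>W\<^esub> p = B' +>\<^bsub>W\<^esub> q" using F[OF p] F[OF q] fg(3) by simp
      then obtain b where b: "b \<in> B'" "q = b \<oplus>\<^bsub>W\<^esub> p"
        using coset_eq_iff[OF W B'] p q by (auto simp: rep_def)
      have "f C = g C" if C: "C \<in> carrier ?Q" for C
      proof -
        obtain x where x: "x \<in> carrier V" "C = B +> x" using C car by auto
        have "pair q x = pair b x + pair p x" using b p x BW.a_subset by (auto simp: rep_def pair_add)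
        then show ?thesis using kill'[OF b(1) x(1)] p q x by (simp add: rep_def)
      qed
      then show "f = g" using fg D_iff by (meson extensionalityI)
    next
      fix C assume "C \<in> F ` carrier ?D"
      then obtain f where f: "f \<in> carrier ?D" "C = F f" by auto
      then obtain p where p: "rep f p" using rep_ex by blast
      then show "C \<in> carrier ?Q'" unfolding f(2) F[OF p] by (auto simp: car rep_def simp del: quotient_module_simps)
    next
      fix C assume "C \<in> carrier ?Q'"
      then obtain p where p: "p \<in> carrier W" "C = B' +>\<^bsub>W\<^esub> p" using car by auto
      \<comment> \<open>The functional induced by \<open>p\<close> on the quotient, computed on a
        chosen representative. Another choice gives the same value because \<open>pair p\<close>
        kills \<open>B\<close>.\<close>
      define f where "f = (\<lambda>D\<in>carrier ?Q. pair p (SOME x. x \<in> carrier V \<and> D = B +> x))"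
      have f: "f (B +> x) = pair p x" if x: "x \<in> carrier V" for x
      proof -
        define y where "y = (SOME y. y \<in> carrier V \<and> B +> x = B +> y)"
        have y: "y \<in> carrier V \<and> B +> x = B +> y" unfolding y_def using x by (intro someI) auto
        then obtain b where "b \<in> B" "y = b \<oplus> x" using coset_eq_iff[OF V B x, of y] by blast
        then have "pair p y = pair p x"
          using functional_onD(1)[OF pair_fun[OF p(1)]] kill[OF p(1)] BV.a_subset x by auto
        moreover have "f (B +> x) = pair p y" using x by (simp add: f_def y_def car del: quotient_module_simps)
        ultimately show ?thesis by simp
      qed
      have "functional_on (carrier ?Q) ?Q f"
        unfolding functional_on_def using functional_onD[OF pair_fun[OF p(1)]]
        by (auto simp: simps f Vsc simp del: quotient_module_simps)
      then have fD: "f \<in> carrier ?D" unfolding D_iff by (auto simp: f_def)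
      have "rep f p" using p f by (auto simp: rep_def)
      then have "C = F f" using p(2) F[of f p] by metis
      then show "C \<in> F ` carrier ?D" using fD by blast
    qed
  qed
qed

section \<open>Polynomials and differential operators\<close>

abbreviation "lookup \<equiv> Poly_Mapping.lookup"
abbreviation "single \<equiv> Poly_Mapping.single"
abbreviation "keys \<equiv> Poly_Mapping.keys"

lemma poly_mapping_sum_monomials: "(\<Sum>a\<in>keys p. single a (lookup p a)) = (p :: 'a \<Rightarrow>\<^sub>0 'b::comm_monoid_add)"
  by (rule poly_mapping_eqI)
    (auto simp: lookup_sum lookup_single when_def sum.If_cases in_keys_iff if_distrib sum.delta' cong: if_cong)

lemma poly_mapping_add_induct [case_names zero single add]:
  fixes p :: "'a \<Rightarrow>\<^sub>0 'b::comm_monoid_add"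
  assumes "K 0" "\<And>a c. K (single a c)" "\<And>p q. K p \<Longrightarrow> K q \<Longrightarrow> K (p + q)"
  shows "K p"
proof -
  have "K (\<Sum>a\<in>A. single a (lookup p a))" if "finite A" for A
    using that by (induction A rule: finite_induct) (auto intro: assms)
  then show ?thesis using poly_mapping_sum_monomials[of p] finite_keys[of p] by metis
qed

lemma lookup_const_poly_mult [simp]: "lookup (const_poly c * p) a = c * lookup p a"
  unfolding const_poly_def mult_map_scale_conv_mult[symmetric] by (simp add: map.rep_eq when_def)

text \<open>Subtraction of natural numbers leaves an exponent \<open>a\<close> with
  \<open>lookup a j = 0\<close> unchanged, but its coefficient is then zero. So only
  \<open>a = e + single j 1\<close> contributes.\<close>

lemma lookup_partial_op:
  fixes p :: "('n, 'k::comm_ring_1) mpoly"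
  shows "lookup (partial_op j p) e = of_nat (Suc (lookup e j)) * lookup p (e + single j 1)"
proof -
  have iff: "a - single j 1 = e \<longleftrightarrow> a = e + single j 1" if "lookup a j \<noteq> 0" for a :: "'n \<Rightarrow>\<^sub>0 nat"
  proof
    assume "a - single j 1 = e"
    then show "a = e + single j 1" using that
      by (intro poly_mapping_eqI) (auto simp: lookup_add lookup_minus lookup_single when_def)
  qed simp
  have "lookup (partial_op j p) e = (\<Sum>a\<in>keys p. if a = e + single j 1 then
     of_nat (lookup a j) * lookup p a else 0)"
    unfolding partial_op_def lookup_sum
  proof (rule sum.cong[OF refl])
    fix a
    show "lookup (single (a - single j 1) (of_nat (lookup a j) * lookup p a)) e =
         (if a = e + single j 1 then of_nat (lookup a j) * lookup p a else 0)"
      using iff[of a] by (cases "lookup a j = 0") (auto simp: lookup_single when_def)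
  qed
  also have "\<dots> = of_nat (Suc (lookup e j)) * lookup p (e + single j 1)"
    by (auto simp: sum.delta in_keys_iff lookup_add algebra_simps)
  finally show ?thesis .
qed

lemma partial_op_add: "partial_op j (p + q) = partial_op j p + partial_op j q"
  by (rule poly_mapping_eqI) (simp add: lookup_partial_op lookup_add algebra_simps)

lemma partial_op_const_mult: "partial_op j (const_poly c * p) = const_poly c * partial_op j p"
  by (rule poly_mapping_eqI) (simp add: lookup_partial_op mult.left_commute del: of_nat_Suc)

lemma partial_op_commute: "partial_op i (partial_op j p) = partial_op j (partial_op i p)"
  by (rule poly_mapping_eqI)
    (auto simp add: lookup_partial_op lookup_add lookup_single when_def algebra_simps)

lemma partial_op_single:
  "partial_op j (single a c) = single (a - single j 1) (of_nat (lookup a j) * c)"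
  by (cases "c = 0") (simp_all add: partial_op_def)

lemma single_mult_const: "single a c = const_poly c * single a (1::'k::comm_ring_1)"
  by (simp add: const_poly_def mult_single)

text \<open>The Leibniz rule for a monomial factor. The truncated exponent
  \<open>a - single j 1\<close> is harmless: when \<open>lookup a j = 0\<close> its coefficient is
  zero.\<close>

lemma partial_op_single_mult:
  fixes p :: "('n, 'k::comm_ring_1) mpoly"
  shows "partial_op j (single a 1 * p) = single a 1 * partial_op j p +
     single (a - single j 1) (of_nat (lookup a j)) * p"
proof (induction p rule: poly_mapping_add_induct)
  case zero
  then show ?case by (simp add: partial_op_def)
next
  case (single b c)
  have 1: "a + b - single j 1 = a + (b - single j 1)" if "lookup b j \<noteq> 0"
    using that by (intro poly_mapping_eqI) (auto simp: lookup_add lookup_minus lookup_single when_def)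
  have 2: "a + b - single j 1 = (a - single j 1) + b" if "lookup a j \<noteq> 0"
    using that by (intro poly_mapping_eqI) (auto simp: lookup_add lookup_minus lookup_single when_def)
  show ?case
    using 1 2 by (cases "lookup a j = 0"; cases "lookup b j = 0")
      (auto simp: mult_single partial_op_single lookup_add algebra_simps single_add[symmetric])
next
  case (add p q)
  then show ?case by (simp add: partial_op_add algebra_simps)
qed

lemma endo_ring_simps [simp]:
  "monoid.mult endo_ring = (\<circ>)" "one endo_ring = id" "ring.zero endo_ring = (\<lambda>p. 0)"
  "add endo_ring = (\<lambda>f g p. f p + g p)"
  "f \<in> carrier endo_ring \<longleftrightarrow> (\<forall>p q. f (p + q) = f p + f q) \<and> (\<forall>c p. f (const_poly c * p) = const_poly c * f p)"
  by (simp_all add: endo_ring_def)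

lemma ring_endo_ring: "ring (endo_ring :: (('n, 'k::comm_ring_1) mpoly \<Rightarrow> ('n, 'k) mpoly) ring)"
proof (rule ringI)
  show "abelian_group (endo_ring :: (('n, 'k) mpoly \<Rightarrow> ('n, 'k) mpoly) ring)"
  proof (rule abelian_groupI, goal_cases)
    case (6 f)
    then show ?case by (intro bexI[of _ "\<lambda>p. - f p"]) auto
  qed (auto simp: fun_eq_iff algebra_simps)
  show "monoid (endo_ring :: (('n, 'k) mpoly \<Rightarrow> ('n, 'k) mpoly) ring)"
    by (rule monoidI) (auto simp: fun_eq_iff)
qed (auto simp: fun_eq_iff)

lemma mult_op_endo: "mult_op r \<in> carrier endo_ring"
  by (simp add: mult_op_def algebra_simps)

lemma partial_op_endo: "partial_op j \<in> carrier endo_ring"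
  by (simp add: partial_op_add partial_op_const_mult)

lemma diff_op_ring_simps [simp]:
  "monoid.mult diff_op_ring = (\<circ>)" "one diff_op_ring = id" "ring.zero diff_op_ring = (\<lambda>p. 0)"
  "add diff_op_ring = (\<lambda>f g p. f p + g p)"
  by (simp_all add: diff_op_ring_def)

lemma ring_diff_op_ring: "ring (diff_op_ring :: (('n, 'k::comm_ring_1) mpoly \<Rightarrow> ('n, 'k) mpoly) ring)"
  unfolding diff_op_ring_def
  by (rule ring.generate_ring_is_ring[OF ring_endo_ring]) (auto simp del: endo_ring_simps(5) intro: mult_op_endo partial_op_endo)

lemma diff_op_endo:
  assumes "P \<in> carrier diff_op_ring" shows "P \<in> carrier endo_ring"
proof (rule ring.generate_ring_in_carrier[OF ring_endo_ring])
  show "P \<in> generate_ring endo_ring ({mult_op r | r. True} \<union> {partial_op j | j. True})"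
    using assms by (simp add: diff_op_ring_def)
qed (auto simp del: endo_ring_simps(5) intro: mult_op_endo partial_op_endo)

lemma mult_op_diff_op [simp]: "mult_op r \<in> carrier diff_op_ring"
  unfolding diff_op_ring_def by (auto intro: generate_ring.incl)

lemma partial_op_diff_op [simp]: "partial_op j \<in> carrier diff_op_ring"
  unfolding diff_op_ring_def by (auto intro: generate_ring.incl)

lemma diff_op_add [simp]:
  "P \<in> carrier diff_op_ring \<Longrightarrow> Q \<in> carrier diff_op_ring \<Longrightarrow> (\<lambda>p. P p + Q p) \<in> carrier diff_op_ring"
  using abelian_groupE(1)[OF ringE(1)[OF ring_diff_op_ring], of P Q] by simp

lemma diff_op_comp [simp]:
  "P \<in> carrier diff_op_ring \<Longrightarrow> Q \<in> carrier diff_op_ring \<Longrightarrow> P \<circ> Q \<in> carrier diff_op_ring"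
  using monoid.m_closed[OF ringE(2)[OF ring_diff_op_ring], of P Q] by simp

lemma id_eq_mult_op: "id = mult_op 1"
  by (simp add: mult_op_def fun_eq_iff)

text \<open>The generated ring also contains the identity and negatives, but these are
  \<open>mult_op 1\<close> and composites with \<open>mult_op (-1)\<close>, so four cases
  suffice.\<close>

lemma diff_op_induct [consumes 1, case_names mult partial add comp]:
  fixes P :: "('n, 'k::comm_ring_1) mpoly \<Rightarrow> ('n, 'k) mpoly"
  assumes "P \<in> carrier diff_op_ring"
    and mult: "\<And>r. K (mult_op r)" and partial: "\<And>j. K (partial_op j)"
    and add: "\<And>P Q. P \<in> carrier diff_op_ring \<Longrightarrow> Q \<in> carrier diff_op_ring \<Longrightarrow> K P \<Longrightarrow> K Q \<Longrightarrow> K (\<lambda>p. P p + Q p)"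
    and comp: "\<And>P Q. P \<in> carrier diff_op_ring \<Longrightarrow> Q \<in> carrier diff_op_ring \<Longrightarrow> K P \<Longrightarrow> K Q \<Longrightarrow> K (P \<circ> Q)"
  shows "K P"
proof -
  have "P \<in> generate_ring endo_ring ({mult_op r | r. True} \<union> {partial_op j | j. True})"
    using assms(1) by (simp add: diff_op_ring_def)
  then have "P \<in> carrier diff_op_ring \<and> K P"
  proof induction
    case one
    then show ?case using mult[of 1] by (simp add: id_eq_mult_op)
  next
    case (incl h)
    then show ?case using mult partial by auto
  next
    case (a_inv h)
    interpret E: ring "endo_ring :: (('n, 'k) mpoly \<Rightarrow> ('n, 'k) mpoly) ring" by (rule ring_endo_ring)
    have h: "h \<in> carrier endo_ring" using a_inv diff_op_endo by blast
    have "mult_op (-1) \<circ> h = \<ominus>\<^bsub>endo_ring\<^esub> h"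
      by (rule E.minus_equality[symmetric]) (use h in \<open>auto simp: mult_op_def fun_eq_iff algebra_simps\<close>)
    then show ?case using comp[of "mult_op (-1)" h] a_inv mult diff_op_comp[of "mult_op (-1)" h] by auto
  next
    case (eng_add h1 h2)
    then show ?case using add[of h1 h2] diff_op_add[of h1 h2] by simp
  next
    case (eng_mult h1 h2)
    then show ?case using comp[of h1 h2] diff_op_comp[of h1 h2] by (simp add: comp_def)
  qed
  then show ?thesis by blast
qed

lemma endo_lookup:
  assumes "P \<in> carrier endo_ring"
  shows "lookup (P p) e = (\<Sum>a\<in>keys p. lookup p a * lookup (P (single a 1)) e)"
proof -
  have add: "P (p + q) = P p + P q" and sc: "P (const_poly c * p) = const_poly c * P p" for c p q
    using assms by simp_all
  from add[of 0 0] have 0: "P 0 = 0" by simp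
  have "P (\<Sum>a\<in>A. single a (lookup p a)) = (\<Sum>a\<in>A. const_poly (lookup p a) * P (single a 1))" if "finite A" for A
    using that
  proof (induction A rule: finite_induct)
    case (insert x F)
    have "P (single x (lookup p x)) = const_poly (lookup p x) * P (single x 1)"
      by (subst single_mult_const[of x "lookup p x"]) (rule sc)
    then show ?case using insert by (simp add: add)
  qed (simp add: 0)
  from this[of "keys p"] have "P p = (\<Sum>a\<in>keys p. const_poly (lookup p a) * P (single a 1))"
    by (simp add: poly_mapping_sum_monomials)
  then show ?thesis by (simp add: lookup_sum)
qed

lemma endo_eqI:
  assumes "P \<in> carrier endo_ring" "Q \<in> carrier endo_ring"
    and "\<And>a e. lookup (P (single a 1)) e = lookup (Q (single a 1)) e"
  shows "P = Q"
  by (intro ext poly_mapping_eqI, subst endo_lookup[OF assms(1)], subst endo_lookup[OF assms(2)])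
    (simp only: assms(3))


section \<open>The transposition of differential operators\<close>

text \<open>The coefficients of \<open>P x\<^sup>a\<close> are polynomial functions of the exponents \<open>a\<close>. In characteristic
  zero they are determined by their values at nonnegative exponents, and evaluating them at negative
  exponents yields the transposed operator: formally, this is the adjoint for the residue pairing
  on Laurent polynomials.\<close>

inductive_set polyfun :: "(('n \<Rightarrow> int) \<Rightarrow> 'k::comm_ring_1) set" where
  const: "(\<lambda>b. c) \<in> polyfun"
| var: "(\<lambda>b. of_int (b j)) \<in> polyfun"
| add: "f \<in> polyfun \<Longrightarrow> g \<in> polyfun \<Longrightarrow> (\<lambda>b. f b + g b) \<in> polyfun"
| mult: "f \<in> polyfun \<Longrightarrow> g \<in> polyfun \<Longrightarrow> (\<lambda>b. f b * g b) \<in> polyfun"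

lemma polyfun_sum:
  assumes "finite A" "\<And>i. i \<in> A \<Longrightarrow> f i \<in> polyfun"
  shows "(\<lambda>b. \<Sum>i\<in>A. f i b) \<in> polyfun"
  using assms by (induction A rule: finite_induct) (auto intro: polyfun.intros)

lemma polyfun_shift:
  assumes "f \<in> polyfun" shows "(\<lambda>b. f (\<lambda>j. b j + c j)) \<in> polyfun"
  using assms
proof induction
  case (var j)
  show ?case unfolding of_int_add by (intro polyfun.intros)
qed (auto intro: polyfun.intros)

lemma polyfun_univariate:
  assumes "f \<in> polyfun"
  shows "\<exists>p. \<forall>t. f (b(j := t)) = poly p (of_int t)"
  using assms
proof induction
  case (const c)
  then show ?case by (intro exI[of _ "[:c:]"]) auto
next
  case (var i)
  then show ?case by (intro exI[of _ "if i = j then [:0, 1:] else [:of_int (b i):]"]) auto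
next
  case (add f g)
  then show ?case by (metis poly_add)
next
  case (mult f g)
  then show ?case by (metis poly_mult)
qed

text \<open>The lower bounds are removed one coordinate at a time; \<open>A\<close> is the set of
  coordinates already free. In each step the function of the new coordinate is a univariate
  polynomial with infinitely many integer roots, where characteristic zero keeps distinct integers
  distinct in the field.\<close>

lemma polyfun_eq_0:
  fixes f :: "('n::finite \<Rightarrow> int) \<Rightarrow> 'k::field_char_0"
  assumes f: "f \<in> polyfun" and zero: "\<And>b. (\<And>j. b j \<ge> N j) \<Longrightarrow> f b = 0"
  shows "f b = 0"
proof -
  have "\<forall>b. (\<forall>j. j \<notin> A \<longrightarrow> b j \<ge> N j) \<longrightarrow> f b = 0" if "finite A" for A
    using that
  proof (induction A rule: finite_induct)
    case empty
    then show ?case using zero by auto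
  next
    case (insert j A)
    show ?case
    proof (intro allI impI)
      fix b assume b: "\<forall>i. i \<notin> insert j A \<longrightarrow> N i \<le> b i"
      obtain p where p: "\<And>t. f (b(j := t)) = poly p (of_int t)" using polyfun_univariate[OF f] by blast
      have "p = 0"
      proof (rule ccontr)
        assume "p \<noteq> 0"
        then have "finite {x. poly p x = 0}" by (rule poly_roots_finite)
        moreover have "of_int ` {N j..} \<subseteq> {x. poly p x = 0}"
          using b insert.IH by (auto simp flip: p)
        ultimately have "finite (of_int ` {N j..} :: 'k set)" by (rule finite_subset[rotated])
        then have "finite {N j..}" by (rule finite_imageD) (auto intro: inj_onI)
        then show False by (simp add: infinite_Ici)
      qed
      then show "f b = 0" using p[of "b j"] by simp
    qed
  qed
  from this[of UNIV] show ?thesis by simp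
qed

abbreviation int_exp :: "('n \<Rightarrow>\<^sub>0 nat) \<Rightarrow> 'n \<Rightarrow> int" where
  "int_exp a \<equiv> (\<lambda>j. int (lookup a j))"

definition nat_exp :: "('n::finite \<Rightarrow> int) \<Rightarrow> 'n \<Rightarrow>\<^sub>0 nat" where
  "nat_exp b = Abs_poly_mapping (\<lambda>j. nat (b j))"

lemma lookup_nat_exp [simp]: "lookup (nat_exp b) j = nat (b j)"
  by (simp add: nat_exp_def)

text \<open>Here P x^a is the sum of s_c(a) x^(a+c). For the residue pairing, in which x^b and x^a
  pair to 1 exactly if b + a = -1 in all coordinates, the adjoint has coefficient s_(e-a)(-1-e) at
  x^e in the image of x^a: x^e pairs with x^b for b = -1-e, and P shifts this b to -1-a, that is, by
  c = e-a. The third condition says that no coordinate passes from a nonnegative to a negative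
  exponent, for all integer \<open>b\<close> and not only for exponents of polynomials; this is what
  makes composites work on the transposed side too.\<close>

definition symbol_of :: "(('n \<Rightarrow> int) \<Rightarrow> ('n \<Rightarrow> int) \<Rightarrow> 'k::comm_ring_1) \<Rightarrow>
    (('n, 'k) mpoly \<Rightarrow> ('n, 'k) mpoly) \<Rightarrow> (('n, 'k) mpoly \<Rightarrow> ('n, 'k) mpoly) \<Rightarrow> bool" where
  "symbol_of s P Q \<longleftrightarrow> finite {c. s c \<noteq> (\<lambda>b. 0)} \<and> (\<forall>c. s c \<in> polyfun) \<and>
     (\<forall>c b j. b j \<ge> 0 \<longrightarrow> b j + c j < 0 \<longrightarrow> s c b = 0) \<and>
     (\<forall>a e. lookup (P (single a 1)) e = s (\<lambda>j. int_exp e j - int_exp a j) (int_exp a)) \<and>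
     (\<forall>a e. lookup (Q (single a 1)) e = s (\<lambda>j. int_exp e j - int_exp a j) (\<lambda>j. - 1 - int_exp e j))"

definition is_transpose ::
    "(('n, 'k::comm_ring_1) mpoly \<Rightarrow> ('n, 'k) mpoly) \<Rightarrow> (('n, 'k) mpoly \<Rightarrow> ('n, 'k) mpoly) \<Rightarrow> bool" where
  "is_transpose P Q \<longleftrightarrow> P \<in> carrier diff_op_ring \<and> Q \<in> carrier diff_op_ring \<and> (\<exists>s. symbol_of s P Q)"

text \<open>The operator gives the values of its symbol only at exponents of monomials, but these
  values determine the polynomial functions everywhere, in particular at the negative arguments that
  define the transpose.\<close>

lemma is_transpose_unique:
  fixes P :: "('n::finite, 'k::field_char_0) mpoly \<Rightarrow> ('n, 'k) mpoly"
  assumes "is_transpose P Q" "is_transpose P Q'"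
  shows "Q = Q'"
proof -
  obtain s s' where s: "symbol_of s P Q" and s': "symbol_of s' P Q'"
    using assms by (auto simp: is_transpose_def)
  have "s c b = s' c b" for c b
  proof -
    have "(\<lambda>b. s c b + (- 1) * s' c b) \<in> polyfun"
      using s s' by (intro polyfun.intros) (auto simp: symbol_of_def)
    \<comment> \<open>The bound makes both \<open>b\<close> and its shift by \<open>c\<close>
      exponents of monomials, so that the value of the symbol is a coefficient of
      \<open>P\<close>.\<close>
    moreover have "s c b + (- 1) * s' c b = 0" if "\<And>j. b j \<ge> max 0 (- c j)" for b
    proof -
      define a e where "a = nat_exp b" and "e = nat_exp (\<lambda>j. b j + c j)"
      have *: "b j \<ge> 0" "b j + c j \<ge> 0" for j using that[of j] by auto
      have eqs: "int_exp a = b" "(\<lambda>j. int_exp e j - int_exp a j) = c"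
        using * by (auto simp: a_def e_def fun_eq_iff)
      have "s (\<lambda>j. int_exp e j - int_exp a j) (int_exp a) = s' (\<lambda>j. int_exp e j - int_exp a j) (int_exp a)"
        using s s' unfolding symbol_of_def by simp
      then show ?thesis unfolding eqs by simp
    qed
    ultimately have "s c b + (- 1) * s' c b = 0" by (rule polyfun_eq_0)
    then show ?thesis by simp
  qed
  then have "s = s'" by (intro ext)
  then have "lookup (Q (single a 1)) e = lookup (Q' (single a 1)) e" for a e
    using s s' unfolding symbol_of_def by simp
  then show ?thesis using assms by (intro endo_eqI diff_op_endo) (simp_all only: is_transpose_def)
qed

lemma is_transpose_add:
  assumes "is_transpose P Q" "is_transpose P' Q'"
  shows "is_transpose (\<lambda>p. P p + P' p) (\<lambda>p. Q p + Q' p)"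
proof -
  obtain s s' where s: "symbol_of s P Q" and s': "symbol_of s' P' Q'"
    using assms by (auto simp: is_transpose_def)
  have "{c. (\<lambda>b. s c b + s' c b) \<noteq> (\<lambda>b. 0)} \<subseteq> {c. s c \<noteq> (\<lambda>b. 0)} \<union> {c. s' c \<noteq> (\<lambda>b. 0)}" by auto
  moreover have "finite \<dots>" using s s' by (auto simp: symbol_of_def)
  ultimately have "finite {c. (\<lambda>b. s c b + s' c b) \<noteq> (\<lambda>b. 0)}" by (rule finite_subset)
  then have "symbol_of (\<lambda>c b. s c b + s' c b) (\<lambda>p. P p + P' p) (\<lambda>p. Q p + Q' p)"
    using s s' unfolding symbol_of_def by (auto simp: lookup_add intro: polyfun.intros)
  then show ?thesis using assms by (auto simp: is_transpose_def)
qed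

text \<open>The symbol of a composite is the sum over all ways to shift first by c' using
  \<open>P2\<close> and then by c - c' using \<open>P1\<close>. The composite of the transposes in
  reverse order gives the same sum evaluated at -1-e. In both cases the sum over shifts must be
  matched with a sum over intermediate monomials, and the vanishing condition removes the shifts
  that have no such monomial.\<close>

lemma is_transpose_comp:
  fixes P1 :: "('n::finite, 'k::comm_ring_1) mpoly \<Rightarrow> ('n, 'k) mpoly"
  assumes "is_transpose P1 Q1" "is_transpose P2 Q2"
  shows "is_transpose (P1 \<circ> P2) (Q2 \<circ> Q1)"
proof -
  obtain s1 s2 where s1: "symbol_of s1 P1 Q1" and s2: "symbol_of s2 P2 Q2"
    using assms by (auto simp: is_transpose_def)
  have endo: "P1 \<in> carrier endo_ring" "Q2 \<in> carrier endo_ring"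
    using assms diff_op_endo by (auto simp: is_transpose_def)
  define C where "C = {c. s2 c \<noteq> (\<lambda>b. 0)}"
  define s where "s c b = (\<Sum>c'\<in>C. s1 (\<lambda>j. c j - c' j) (\<lambda>j. b j + c' j) * s2 c' b)" for c b :: "'n \<Rightarrow> int"
  have finC: "finite C" using s2 by (simp add: C_def symbol_of_def)
  have P1: "lookup (P1 (single a 1)) e = s1 (\<lambda>j. int_exp e j - int_exp a j) (int_exp a)"
    and Q1: "lookup (Q1 (single a 1)) e = s1 (\<lambda>j. int_exp e j - int_exp a j) (\<lambda>j. - 1 - int_exp e j)"
    and P2: "lookup (P2 (single a 1)) e = s2 (\<lambda>j. int_exp e j - int_exp a j) (int_exp a)"
    and Q2: "lookup (Q2 (single a 1)) e = s2 (\<lambda>j. int_exp e j - int_exp a j) (\<lambda>j. - 1 - int_exp e j)"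
    for a e using s1 s2 by (auto simp: symbol_of_def)
  have v1: "s1 c b = 0" if "b j \<ge> 0" "b j + c j < 0" for c b j using s1 that by (auto simp: symbol_of_def)
  have v2: "s2 c b = 0" if "b j \<ge> 0" "b j + c j < 0" for c b j using s2 that by (auto simp: symbol_of_def)
  have "symbol_of s (P1 \<circ> P2) (Q2 \<circ> Q1)"
    unfolding symbol_of_def
  proof (intro conjI allI impI)
    have "{c. s c \<noteq> (\<lambda>b. 0)} \<subseteq> (\<lambda>(c, c') j. c j + c' j) ` ({c. s1 c \<noteq> (\<lambda>b. 0)} \<times> C)"
    proof
      fix c assume "c \<in> {c. s c \<noteq> (\<lambda>b. 0)}"
      then obtain b where "s c b \<noteq> 0" by auto
      then obtain c' where "c' \<in> C" "s1 (\<lambda>j. c j - c' j) (\<lambda>j. b j + c' j) * s2 c' b \<noteq> 0"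
        unfolding s_def by (meson sum.not_neutral_contains_not_neutral)
      then show "c \<in> (\<lambda>(c, c') j. c j + c' j) ` ({c. s1 c \<noteq> (\<lambda>b. 0)} \<times> C)"
        by (intro image_eqI[of _ _ "(\<lambda>j. c j - c' j, c')"]) auto
    qed
    then show "finite {c. s c \<noteq> (\<lambda>b. 0)}"
      by (rule finite_subset) (use s1 finC in \<open>auto simp: symbol_of_def\<close>)
  next
    show "s c \<in> polyfun" for c
      unfolding s_def using s1 s2
      by (intro polyfun_sum finC polyfun.mult polyfun_shift) (auto simp: symbol_of_def)
  next
    fix c b :: "'n \<Rightarrow> int" and j assume b: "b j \<ge> 0" "b j + c j < 0"
    \<comment> \<open>Either c' already makes coordinate \<open>j\<close> negative and
      \<open>s2\<close> vanishes, or the remaining shift does so and \<open>s1\<close>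
      vanishes.\<close>
    have "s1 (\<lambda>j. c j - c' j) (\<lambda>j. b j + c' j) * s2 c' b = 0" for c'
      using v1[of "\<lambda>j. b j + c' j" j "\<lambda>j. c j - c' j"] v2[of b j c'] b
      by (cases "b j + c' j < 0") auto
    then show "s c b = 0" by (simp add: s_def)
  next
    fix a e
    have "lookup ((P1 \<circ> P2) (single a 1)) e =
       (\<Sum>g\<in>keys (P2 (single a 1)). s2 (\<lambda>j. int_exp g j - int_exp a j) (int_exp a) *
          s1 (\<lambda>j. int_exp e j - int_exp g j) (int_exp g))"
      using endo_lookup[OF endo(1), of "P2 (single a 1)" e] P1 P2 by simp
    \<comment> \<open>The intermediate monomial reached by the shift c' has exponent g = a + c'. If
      this is not an exponent of a polynomial, the factor \<open>s2\<close> is zero.\<close>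
    also have "\<dots> = s (\<lambda>j. int_exp e j - int_exp a j) (int_exp a)"
      unfolding s_def
    proof (rule sum.reindex_bij_witness_not_neutral[where S' = "{}" and T' = "{c' \<in> C. s2 c' (int_exp a) = 0}"
          and i = "\<lambda>c'. nat_exp (\<lambda>j. int_exp a j + c' j)" and j = "\<lambda>g j. int_exp g j - int_exp a j"])
      fix g assume g: "g \<in> keys (P2 (single a 1)) - {}"
      show "nat_exp (\<lambda>j. int_exp a j + (int_exp g j - int_exp a j)) = g"
        by (rule poly_mapping_eqI) simp
      show "(\<lambda>j. int_exp g j - int_exp a j) \<in> C - {c' \<in> C. s2 c' (int_exp a) = 0}"
        using g by (auto simp: in_keys_iff P2 C_def)
    next
      fix c' assume c': "c' \<in> C - {c' \<in> C. s2 c' (int_exp a) = 0}"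
      have nn: "int_exp a j + c' j \<ge> 0" for j
      proof (rule ccontr)
        assume "\<not> int_exp a j + c' j \<ge> 0"
        then have "s2 c' (int_exp a) = 0" by (intro v2[where j = j]) auto
        then show False using c' by auto
      qed
      then show *: "(\<lambda>j. int_exp (nat_exp (\<lambda>j. int_exp a j + c' j)) j - int_exp a j) = c'"
        by (simp add: fun_eq_iff)
      have "lookup (P2 (single a 1)) (nat_exp (\<lambda>j. int_exp a j + c' j)) = s2 c' (int_exp a)"
        by (simp only: P2 *)
      then show "nat_exp (\<lambda>j. int_exp a j + c' j) \<in> keys (P2 (single a 1)) - {}"
        using c' by (auto simp only: in_keys_iff)
    qed (auto simp: finC algebra_simps)
    finally show "lookup ((P1 \<circ> P2) (single a 1)) e = s (\<lambda>j. int_exp e j - int_exp a j) (int_exp a)" .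
  next
    fix a e :: "'n \<Rightarrow>\<^sub>0 nat"
    let ?b = "\<lambda>j. - 1 - int_exp e j"
    let ?t = "\<lambda>c'. s1 (\<lambda>j. int_exp e j - int_exp a j - c' j) (\<lambda>j. ?b j + c' j) * s2 c' ?b"
    have "lookup ((Q2 \<circ> Q1) (single a 1)) e =
       (\<Sum>g\<in>keys (Q1 (single a 1)). s1 (\<lambda>j. int_exp g j - int_exp a j) (\<lambda>j. - 1 - int_exp g j) *
          s2 (\<lambda>j. int_exp e j - int_exp g j) ?b)"
      using endo_lookup[OF endo(2), of "Q1 (single a 1)" e] Q1 Q2 by simp
    \<comment> \<open>On the transposed side the intermediate exponent is g = e - c'. If it has a
      negative entry, the zero factor is now \<open>s1\<close>: its argument -1-g is nonnegative
      there and is shifted to -1-a, which is negative.\<close>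
    also have "\<dots> = (\<Sum>c'\<in>C. ?t c')"
    proof (rule sum.reindex_bij_witness_not_neutral[where
          S' = "{g \<in> keys (Q1 (single a 1)). s1 (\<lambda>j. int_exp g j - int_exp a j) (\<lambda>j. - 1 - int_exp g j) * s2 (\<lambda>j. int_exp e j - int_exp g j) ?b = 0}"
          and T' = "{c' \<in> C. ?t c' = 0}"
          and i = "\<lambda>c'. nat_exp (\<lambda>j. int_exp e j - c' j)" and j = "\<lambda>g j. int_exp e j - int_exp g j"])
      fix g assume g: "g \<in> keys (Q1 (single a 1)) - {g \<in> keys (Q1 (single a 1)).
        s1 (\<lambda>j. int_exp g j - int_exp a j) (\<lambda>j. - 1 - int_exp g j) * s2 (\<lambda>j. int_exp e j - int_exp g j) ?b = 0}"
      show "nat_exp (\<lambda>j. int_exp e j - (int_exp e j - int_exp g j)) = g"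
        by (rule poly_mapping_eqI) simp
      have "s2 (\<lambda>j. int_exp e j - int_exp g j) ?b \<noteq> 0" using g by auto
      then have "(\<lambda>j. int_exp e j - int_exp g j) \<in> C" by (auto simp: C_def)
      then show "(\<lambda>j. int_exp e j - int_exp g j) \<in> C - {c' \<in> C. ?t c' = 0}"
        using g by (simp add: algebra_simps)
    next
      fix c' assume c': "c' \<in> C - {c' \<in> C. ?t c' = 0}"
      have nn: "int_exp e j - c' j \<ge> 0" for j
      proof (rule ccontr)
        assume "\<not> int_exp e j - c' j \<ge> 0"
        then have "s1 (\<lambda>j. int_exp e j - int_exp a j - c' j) (\<lambda>j. ?b j + c' j) = 0"
          by (intro v1[where j = j]) auto
        then show False using c' by auto
      qed
      then show *: "(\<lambda>j. int_exp e j - int_exp (nat_exp (\<lambda>j. int_exp e j - c' j)) j) = c'"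
        by (simp add: fun_eq_iff)
      define g where "g = nat_exp (\<lambda>j. int_exp e j - c' j)"
      have g: "int_exp g j = int_exp e j - c' j" for j using nn by (simp add: g_def)
      have "s1 (\<lambda>j. int_exp g j - int_exp a j) (\<lambda>j. - 1 - int_exp g j) * s2 (\<lambda>j. int_exp e j - int_exp g j) ?b = ?t c'"
        by (simp only: g) (simp add: algebra_simps)
      then have 1: "s1 (\<lambda>j. int_exp g j - int_exp a j) (\<lambda>j. - 1 - int_exp g j) * s2 (\<lambda>j. int_exp e j - int_exp g j) ?b \<noteq> 0"
        using c' by auto
      then have "s1 (\<lambda>j. int_exp g j - int_exp a j) (\<lambda>j. - 1 - int_exp g j) \<noteq> 0" by auto
      then show "nat_exp (\<lambda>j. int_exp e j - c' j) \<in> keys (Q1 (single a 1)) - {g \<in> keys (Q1 (single a 1)).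
         s1 (\<lambda>j. int_exp g j - int_exp a j) (\<lambda>j. - 1 - int_exp g j) * s2 (\<lambda>j. int_exp e j - int_exp g j) ?b = 0}"
        unfolding g_def[symmetric] using 1 by (simp add: in_keys_iff Q1)
    qed (auto simp: finC algebra_simps)
    finally show "lookup ((Q2 \<circ> Q1) (single a 1)) e = s (\<lambda>j. int_exp e j - int_exp a j) ?b"
      by (simp add: s_def)
  qed
  then show ?thesis using assms by (auto simp: is_transpose_def)
qed

text \<open>Multiplication by a monomial has a symbol that is constant in \<open>b\<close>, so
  evaluation at -1-e instead of a changes nothing.\<close>

lemma is_transpose_mult_op:
  fixes r :: "('n::finite, 'k::comm_ring_1) mpoly"
  shows "is_transpose (mult_op r) (mult_op r)"
proof (induction r rule: poly_mapping_add_induct)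
  case zero
  have "symbol_of (\<lambda>c b. 0) (mult_op (0 :: ('n, 'k) mpoly)) (mult_op 0)"
    by (auto simp: symbol_of_def mult_op_def intro: polyfun.intros)
  then show ?case by (auto simp: is_transpose_def)
next
  case (single g r)
  define s where "s c b = (if c = int_exp g then r else 0)" for c b :: "'n \<Rightarrow> int"
  have eq: "g + a = e \<longleftrightarrow> (\<lambda>j. int_exp e j - int_exp a j) = int_exp g" for a e
  proof -
    have "lookup g x + lookup a x = lookup e x \<longleftrightarrow> int_exp e x - int_exp a x = int_exp g x" for x by linarith
    then show ?thesis by (simp add: fun_eq_iff lookup_add poly_mapping_eq_iff)
  qed
  have "{c. s c \<noteq> (\<lambda>b. 0)} \<subseteq> {int_exp g}" by (auto simp: s_def)
  then have "finite {c. s c \<noteq> (\<lambda>b. 0)}" by (rule finite_subset) simp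
  moreover have "s c \<in> polyfun" for c
    by (rule subst[of "\<lambda>b. if c = int_exp g then r else 0" "s c"]) (auto simp: s_def fun_eq_iff intro: polyfun.intros)
  moreover have "s c b = 0" if "b j \<ge> 0" "b j + c j < 0" for c b j
    using that by (auto simp: s_def)
  moreover have "lookup (mult_op (single g r) (single a 1)) e = (if g + a = e then r else 0)" for a e
    by (simp add: mult_op_def mult_single lookup_single when_def)
  then have "lookup (mult_op (single g r) (single a 1)) e = s (\<lambda>j. int_exp e j - int_exp a j) b" for a e b
    by (simp add: s_def eq)
  ultimately have "symbol_of s (mult_op (single g r)) (mult_op (single g r))"
    unfolding symbol_of_def by blast
  then show ?case by (auto simp: is_transpose_def)
next
  case (add p q)
  have "mult_op (p + q) = (\<lambda>x. mult_op p x + mult_op q x)" by (auto simp: mult_op_def algebra_simps)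
  then show ?case using is_transpose_add[OF add] by simp
qed

text \<open>The symbol is b_j, for the shift that lowers coordinate \<open>j\<close> by one. If e is
  a lowered in this way, the entry of -1-e at \<open>j\<close> is -a_j, which is the sign of
  integration by parts.\<close>

lemma is_transpose_partial_op:
  fixes j :: "'n::finite"
  shows "is_transpose (partial_op j :: ('n, 'k::comm_ring_1) mpoly \<Rightarrow> ('n, 'k) mpoly) (mult_op (-1) \<circ> partial_op j)"
proof -
  define s :: "('n \<Rightarrow> int) \<Rightarrow> ('n \<Rightarrow> int) \<Rightarrow> 'k"
    where "s c b = (if c = (\<lambda>i. if i = j then - 1 else 0) then of_int (b j) else 0)" for c b
  have eq: "a - single j 1 = e \<longleftrightarrow> (\<lambda>i. int_exp e i - int_exp a i) = (\<lambda>i. if i = j then - 1 else 0)"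
    if "lookup a j \<noteq> 0" for a e
  proof
    assume "(\<lambda>i. int_exp e i - int_exp a i) = (\<lambda>i. if i = j then - 1 else 0)"
    then have e: "int_exp e i - int_exp a i = (if i = j then - 1 else 0)" for i by meson
    show "a - single j 1 = e"
    proof (rule poly_mapping_eqI)
      fix i
      show "lookup (a - single j 1) i = lookup e i"
        using e[of i] by (cases "i = j") (auto simp: lookup_minus lookup_single when_def)
    qed
  qed (use that in \<open>auto simp: fun_eq_iff lookup_minus lookup_single when_def\<close>)
  have z: "(\<lambda>i. int_exp e i - int_exp a i) \<noteq> (\<lambda>i. if i = j then - 1 else 0)"
    if "lookup a j = 0" for a e using that by (auto simp: fun_eq_iff intro!: exI[of _ j])
  have "{c. s c \<noteq> (\<lambda>b. 0)} \<subseteq> {\<lambda>i. if i = j then - 1 else 0}" by (auto simp: s_def)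
  then have fin: "finite {c. s c \<noteq> (\<lambda>b. 0)}" by (rule finite_subset) simp
  have pf: "s c \<in> polyfun" for c
  proof (cases "c = (\<lambda>i. if i = j then - 1 else 0)")
    case True
    then have "s c = (\<lambda>b. of_int (b j))" by (simp add: s_def fun_eq_iff)
    then show ?thesis by (simp add: polyfun.var)
  next
    case False
    then have "s c = (\<lambda>b. 0)" by (auto simp add: s_def)
    then show ?thesis by (simp add: polyfun.const)
  qed
  have l1: "lookup (partial_op j (single a 1)) e = s (\<lambda>j. int_exp e j - int_exp a j) (int_exp a)" for a e
    using eq[of a e] z[of a e]
    by (cases "lookup a j = 0") (auto simp: partial_op_single s_def lookup_single when_def)
  have "s (\<lambda>j. int_exp e j - int_exp a j) (\<lambda>j. - 1 - int_exp e j) = - s (\<lambda>j. int_exp e j - int_exp a j) (int_exp a)" for a e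
  proof (cases "(\<lambda>i. int_exp e i - int_exp a i) = (\<lambda>i. if i = j then - 1 else 0)")
    case True
    from fun_cong[OF True, of j] have "int_exp e j - int_exp a j = - 1" by simp
    then have "- 1 - int_exp e j = - int_exp a j" by simp
    then show ?thesis using True by (simp add: s_def del: of_int_of_nat_eq flip: of_int_minus)
  qed (simp add: s_def)
  then have l2: "lookup ((mult_op (-1) \<circ> partial_op j) (single a 1)) e = s (\<lambda>j. int_exp e j - int_exp a j) (\<lambda>j. - 1 - int_exp e j)" for a e
    using l1[of a e] by (simp add: mult_op_def)
  \<comment> \<open>Since the only shift lowers coordinate \<open>j\<close> by one, a sign change
    happens only at b_j = 0, where the symbol is zero.\<close>
  have van: "s c b = 0" if "b i \<ge> 0" "b i + c i < 0" for c b i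
    using that by (cases "b j = 0") (auto simp: s_def split: if_splits)
  have "symbol_of s (partial_op j) (mult_op (-1) \<circ> partial_op j)"
    unfolding symbol_of_def using fin pf l1 l2 van by blast
  then show ?thesis by (auto simp: is_transpose_def)
qed

definition transpose_op ::
    "(('n, 'k::field_char_0) mpoly \<Rightarrow> ('n, 'k) mpoly) \<Rightarrow> ('n, 'k) mpoly \<Rightarrow> ('n, 'k) mpoly" where
  "transpose_op P = (THE Q. is_transpose P Q)"

lemma is_transpose_transpose_op:
  fixes P :: "('n::finite, 'k::field_char_0) mpoly \<Rightarrow> ('n, 'k) mpoly"
  assumes "P \<in> carrier diff_op_ring"
  shows "is_transpose P (transpose_op P)"
proof -
  have "\<exists>Q. is_transpose P Q" using assms
    by (induction rule: diff_op_induct)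
      (blast intro: is_transpose_mult_op is_transpose_partial_op is_transpose_add is_transpose_comp)+
  then have "\<exists>!Q. is_transpose P Q" using is_transpose_unique by blast
  then show ?thesis unfolding transpose_op_def by (rule theI')
qed

lemma transpose_op_eqI:
  fixes P :: "('n::finite, 'k::field_char_0) mpoly \<Rightarrow> ('n, 'k) mpoly"
  assumes "is_transpose P Q" shows "transpose_op P = Q"
proof -
  have "P \<in> carrier diff_op_ring" using assms by (simp add: is_transpose_def)
  then show ?thesis using is_transpose_unique[OF is_transpose_transpose_op assms] by simp
qed

lemma transpose_op_closed [simp]:
  fixes P :: "('n::finite, 'k::field_char_0) mpoly \<Rightarrow> ('n, 'k) mpoly"
  shows "P \<in> carrier diff_op_ring \<Longrightarrow> transpose_op P \<in> carrier diff_op_ring"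
  using is_transpose_transpose_op by (auto simp: is_transpose_def)

text \<open>As transposes are unique, each equation only requires the right-hand side to be a
  transpose of the operator.\<close>

lemma transpose_op_simps:
  fixes P :: "('n::finite, 'k::field_char_0) mpoly \<Rightarrow> ('n, 'k) mpoly"
  shows "transpose_op (mult_op r :: ('n, 'k) mpoly \<Rightarrow> ('n, 'k) mpoly) = mult_op r"
    and "transpose_op (partial_op j :: ('n, 'k) mpoly \<Rightarrow> ('n, 'k) mpoly) = mult_op (-1) \<circ> partial_op j"
    and "P \<in> carrier diff_op_ring \<Longrightarrow> Q \<in> carrier diff_op_ring \<Longrightarrow>
      transpose_op (\<lambda>p. P p + Q p) = (\<lambda>p. transpose_op P p + transpose_op Q p)"
    and "P \<in> carrier diff_op_ring \<Longrightarrow> Q \<in> carrier diff_op_ring \<Longrightarrow>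
      transpose_op (P \<circ> Q) = transpose_op Q \<circ> transpose_op P"
  by (intro transpose_op_eqI is_transpose_mult_op is_transpose_partial_op is_transpose_add
      is_transpose_comp is_transpose_transpose_op; assumption)+

section \<open>Modules of homomorphisms\<close>

lemma Hom_module_is_module:
  assumes M: "Module.module R M" and N: "Module.module R N"
  shows "Module.module R (Hom_module R M N)"
proof -
  interpret M: Module.module R M by fact
  interpret N: Module.module R N by fact
  let ?H = "Hom_module R M N"
  have closed: "f \<oplus>\<^bsub>?H\<^esub> g \<in> carrier ?H" if "f \<in> carrier ?H" "g \<in> carrier ?H" for f g
    using that by (auto simp: linear_maps_def Pi_iff N.a_ac N.smult_r_distr)
  have zero: "\<zero>\<^bsub>?H\<^esub> \<in> carrier ?H" by (auto simp: linear_maps_def N.smult_r_null)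
  have sc: "a \<odot>\<^bsub>?H\<^esub> f \<in> carrier ?H" if "a \<in> carrier R" "f \<in> carrier ?H" for a f
  proof -
    \<comment> \<open>Commutativity of the scalars makes a multiple of a linear map linear.\<close>
    have "a \<odot>\<^bsub>N\<^esub> (b \<odot>\<^bsub>N\<^esub> x) = b \<odot>\<^bsub>N\<^esub> (a \<odot>\<^bsub>N\<^esub> x)" if "b \<in> carrier R" "x \<in> carrier N" for b x
      using that \<open>a \<in> carrier R\<close> by (simp add: N.smult_assoc1[symmetric] M.m_comm)
    then show ?thesis using that by (auto simp: linear_maps_def Pi_iff N.smult_r_distr)
  qed
  have val: "f x \<in> carrier N" if "f \<in> carrier ?H" "x \<in> carrier M" for f x
    using that by (auto simp: linear_maps_def)
  have ext: "f = g" if "f \<in> carrier ?H" "g \<in> carrier ?H" "\<And>x. x \<in> carrier M \<Longrightarrow> f x = g x" for f g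
    using that by (auto intro: extensionalityI)
  have ab: "abelian_group ?H"
  proof (rule abelian_groupI)
    fix f assume f: "f \<in> carrier ?H"
    let ?g = "\<lambda>x\<in>carrier M. \<ominus>\<^bsub>N\<^esub> f x"
    have "?g \<in> carrier ?H"
      using f by (auto simp: linear_maps_def Pi_iff N.minus_add N.smult_r_minus N.a_comm)
    moreover have "?g \<oplus>\<^bsub>?H\<^esub> f = \<zero>\<^bsub>?H\<^esub>"
      using val[OF f] by (auto simp: fun_eq_iff N.l_neg)
    ultimately show "\<exists>g\<in>carrier ?H. g \<oplus>\<^bsub>?H\<^esub> f = \<zero>\<^bsub>?H\<^esub>" by blast
  next
    fix f g h assume fgh: "f \<in> carrier ?H" "g \<in> carrier ?H" "h \<in> carrier ?H"
    show "f \<oplus>\<^bsub>?H\<^esub> g \<oplus>\<^bsub>?H\<^esub> h = f \<oplus>\<^bsub>?H\<^esub> (g \<oplus>\<^bsub>?H\<^esub> h)"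
      using val[OF fgh(1)] val[OF fgh(2)] val[OF fgh(3)] by (auto simp: N.a_assoc)
  next
    fix f g assume fg: "f \<in> carrier ?H" "g \<in> carrier ?H"
    show "f \<oplus>\<^bsub>?H\<^esub> g = g \<oplus>\<^bsub>?H\<^esub> f"
      using val[OF fg(1)] val[OF fg(2)] by (auto simp: N.a_comm fun_eq_iff)
  next
    fix f assume f: "f \<in> carrier ?H"
    show "\<zero>\<^bsub>?H\<^esub> \<oplus>\<^bsub>?H\<^esub> f = f"
      using val[OF f] by (intro ext closed zero f) auto
  qed (use closed zero in auto)
  show ?thesis
  proof (rule moduleI[OF M.is_cring ab sc])
    fix a b f assume ab: "a \<in> carrier R" "b \<in> carrier R" and f: "f \<in> carrier ?H"
    show "(a \<oplus>\<^bsub>R\<^esub> b) \<odot>\<^bsub>?H\<^esub> f = a \<odot>\<^bsub>?H\<^esub> f \<oplus>\<^bsub>?H\<^esub> b \<odot>\<^bsub>?H\<^esub> f"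
      using ab val[OF f] by (auto simp: N.smult_l_distr)
    show "(a \<otimes>\<^bsub>R\<^esub> b) \<odot>\<^bsub>?H\<^esub> f = a \<odot>\<^bsub>?H\<^esub> (b \<odot>\<^bsub>?H\<^esub> f)"
      using ab val[OF f] by (auto simp: N.smult_assoc1)
  next
    fix a f g assume a: "a \<in> carrier R" and fg: "f \<in> carrier ?H" "g \<in> carrier ?H"
    show "a \<odot>\<^bsub>?H\<^esub> (f \<oplus>\<^bsub>?H\<^esub> g) = a \<odot>\<^bsub>?H\<^esub> f \<oplus>\<^bsub>?H\<^esub> a \<odot>\<^bsub>?H\<^esub> g"
      using a val[OF fg(1)] val[OF fg(2)] by (auto simp: N.smult_r_distr)
  next
    fix f assume f: "f \<in> carrier ?H"
    show "\<one>\<^bsub>R\<^esub> \<odot>\<^bsub>?H\<^esub> f = f"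
      using val[OF f] by (intro ext sc f M.one_closed) auto
  qed
qed

text \<open>The Matlis dual is obtained from the module of all homomorphisms by shrinking the
  carrier; sums of its elements can therefore be computed in the larger module.\<close>

lemma finsum_sub_record:
  assumes N: "abelian_monoid N" and N': "abelian_monoid N'"
    and sub: "carrier N' \<subseteq> carrier N" and add: "add N' = add N" and zero: "ring.zero N' = ring.zero N"
    and f: "f \<in> A \<rightarrow> carrier N'"
  shows "finsum N' f A = finsum N f A"
proof -
  interpret N: abelian_monoid N by fact
  interpret N': abelian_monoid N' by fact
  show ?thesis using f
  proof (induction A rule: infinite_finite_induct)
    case (insert x F)
    then have "f x \<in> carrier N'" "f \<in> F \<rightarrow> carrier N'" by auto
    moreover from this have "f x \<in> carrier N" "f \<in> F \<rightarrow> carrier N" using sub by auto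
    ultimately show ?case using insert by (simp add: add)
  qed (simp_all add: zero)
qed

lemma finsum_additive:
  fixes f :: "'m \<Rightarrow> 'z::ab_group_add"
  assumes M: "abelian_group M" and f: "\<And>x y. x \<in> carrier M \<Longrightarrow> y \<in> carrier M \<Longrightarrow> f (x \<oplus>\<^bsub>M\<^esub> y) = f x + f y"
    and c: "c \<in> A \<rightarrow> carrier M"
  shows "f (finsum M c A) = (\<Sum>i\<in>A. f (c i))"
proof -
  interpret abelian_group M by fact
  have 0: "f \<zero>\<^bsub>M\<^esub> = 0" using f[of "\<zero>\<^bsub>M\<^esub>" "\<zero>\<^bsub>M\<^esub>"] by simp
  show ?thesis using c
  proof (induction A rule: infinite_finite_induct)
    case (insert x F)
    then have "c x \<in> carrier M" "c \<in> F \<rightarrow> carrier M" by auto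
    then show ?case using insert by (simp add: f)
  qed (simp_all add: 0)
qed

lemma finsum_Hom_module:
  fixes N :: "('a, 'z::ab_group_add) module"
  assumes M: "Module.module R M" and N: "Module.module R N" and add: "add N = (+)"
    and c: "c \<in> A \<rightarrow> carrier (Hom_module R M N)" and x: "x \<in> carrier M"
  shows "finsum (Hom_module R M N) c A x = (\<Sum>i\<in>A. c i x)"
proof (rule finsum_additive[where f = "\<lambda>g. g x"])
  show "abelian_group (Hom_module R M N)"
    using Hom_module_is_module[OF M N] by (simp add: Module.module_def)
qed (use x c add in auto)


section \<open>The top local cohomology module\<close>

lemma local_coh_simps [simp]:
  "e \<in> carrier local_coh \<longleftrightarrow> (\<forall>b\<in>keys e. \<forall>j. b j \<le> -1)"
  "ring.zero local_coh = 0" "add local_coh = (+)"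
  by (simp_all add: local_coh_def)

lemma local_coh_lookup_0: "e \<in> carrier local_coh \<Longrightarrow> \<not> (\<forall>j. b j \<le> -1) \<Longrightarrow> lookup e b = 0"
  by (auto simp: in_keys_iff)

text \<open>The exponent \<open>b\<close> of a product arises from \<open>a\<close> and b' only for
  b' = b - a. In this coefficient form the only trace of the truncation is the condition on
  \<open>b\<close>.\<close>

lemma lookup_local_coh_smult:
  fixes r :: "('n::finite, 'k::comm_ring_1) mpoly"
  shows "lookup (r \<odot>\<^bsub>local_coh\<^esub> e) b = (if \<forall>j. b j \<le> -1
    then \<Sum>a\<in>keys r. lookup r a * lookup e (\<lambda>j. b j - int_exp a j) else 0)"
proof -
  have "lookup (r \<odot>\<^bsub>local_coh\<^esub> e) b = (\<Sum>a\<in>keys r. \<Sum>b'\<in>keys e.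
     if b' = (\<lambda>j. b j - int_exp a j) then (if \<forall>j. b j \<le> -1 then lookup r a * lookup e b' else 0) else 0)"
    unfolding local_coh_def module.simps lookup_sum
  proof (intro sum.cong refl)
    fix a b'
    have "(\<lambda>j. int_exp a j + b' j) = b \<Longrightarrow> b' = (\<lambda>j. b j - int_exp a j)" by auto
    then show "lookup (if \<forall>j. int_exp a j + b' j \<le> - 1
        then single (\<lambda>j. int_exp a j + b' j) (lookup r a * lookup e b') else 0) b =
      (if b' = (\<lambda>j. b j - int_exp a j) then if \<forall>j. b j \<le> - 1 then lookup r a * lookup e b' else 0 else 0)"
      by (cases "b' = (\<lambda>j. b j - int_exp a j)") (auto simp: lookup_single when_def)
  qed
  also have "\<dots> = (if \<forall>j. b j \<le> -1
    then \<Sum>a\<in>keys r. lookup r a * lookup e (\<lambda>j. b j - int_exp a j) else 0)"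
  proof (cases "\<forall>j. b j \<le> -1")
    case True
    then show ?thesis by (auto simp: sum.delta in_keys_iff intro!: sum.cong)
  next
    case False
    then show ?thesis by (simp only: if_False if_cancel sum.neutral_const)
  qed
  finally show ?thesis .
qed

lemma lookup_local_coh_smult_single:
  fixes e :: "('n::finite, 'k::comm_ring_1) inv_poly"
  shows "lookup (single a c \<odot>\<^bsub>local_coh\<^esub> e) b = (if \<forall>j. b j \<le> -1 then c * lookup e (\<lambda>j. b j - int_exp a j) else 0)"
  by (cases "c = 0") (simp_all add: lookup_local_coh_smult)

lemma local_coh_smult_closed:
  fixes r :: "('n::finite, 'k::comm_ring_1) mpoly"
  shows "r \<odot>\<^bsub>local_coh\<^esub> e \<in> carrier local_coh"
  by (auto simp: in_keys_iff lookup_local_coh_smult split: if_splits)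

lemma local_coh_smult_add:
  fixes r s :: "('n::finite, 'k::comm_ring_1) mpoly"
  shows "(r + s) \<odot>\<^bsub>local_coh\<^esub> e = r \<odot>\<^bsub>local_coh\<^esub> e + s \<odot>\<^bsub>local_coh\<^esub> e"
    and "r \<odot>\<^bsub>local_coh\<^esub> (e + e') = r \<odot>\<^bsub>local_coh\<^esub> e + r \<odot>\<^bsub>local_coh\<^esub> e'"
    and "0 \<odot>\<^bsub>local_coh\<^esub> e = 0"
proof -
  let ?A = "keys r \<union> keys s"
  have *: "(\<Sum>a\<in>keys t. lookup t a * f a) = (\<Sum>a\<in>?A. lookup t a * f a)" if "keys t \<subseteq> ?A"
    for t :: "('n, 'k) mpoly" and f :: "('n \<Rightarrow>\<^sub>0 nat) \<Rightarrow> 'k"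
    by (rule sum.mono_neutral_left) (use that in \<open>auto simp: in_keys_iff\<close>)
  have "keys (r + s) \<subseteq> ?A" by (rule keys_add)
  then show "(r + s) \<odot>\<^bsub>local_coh\<^esub> e = r \<odot>\<^bsub>local_coh\<^esub> e + s \<odot>\<^bsub>local_coh\<^esub> e"
    by (intro poly_mapping_eqI)
      (simp only: lookup_add[of "r \<odot>\<^bsub>local_coh\<^esub> e"] lookup_local_coh_smult * Un_upper1 Un_upper2,
        simp add: lookup_add ring_distribs sum.distrib)
  show "r \<odot>\<^bsub>local_coh\<^esub> (e + e') = r \<odot>\<^bsub>local_coh\<^esub> e + r \<odot>\<^bsub>local_coh\<^esub> e'"
    by (intro poly_mapping_eqI)
      (simp add: lookup_local_coh_smult lookup_add ring_distribs sum.distrib)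
  show "0 \<odot>\<^bsub>local_coh\<^esub> e = 0" by (intro poly_mapping_eqI) (simp add: lookup_local_coh_smult)
qed

lemma local_coh_smult_0: "(r :: ('n::finite, 'k::comm_ring_1) mpoly) \<odot>\<^bsub>local_coh\<^esub> 0 = 0"
  by (intro poly_mapping_eqI) (simp add: lookup_local_coh_smult)

lemma local_coh_smult_assoc:
  fixes r s :: "('n::finite, 'k::comm_ring_1) mpoly"
  shows "(r * s) \<odot>\<^bsub>local_coh\<^esub> e = r \<odot>\<^bsub>local_coh\<^esub> (s \<odot>\<^bsub>local_coh\<^esub> e)"
proof (induction r rule: poly_mapping_add_induct)
  case (single a c)
  show ?case
  proof (induction s rule: poly_mapping_add_induct)
    case (single a' c')
    show ?case
    proof (rule poly_mapping_eqI)
      fix b :: "'n \<Rightarrow> int"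
      \<comment> \<open>If the final exponent is in range, so is the one before multiplication by
        x^a: truncation in the inner product loses nothing that survives in the outer one.\<close>
      have "b j - int_exp a j \<le> - 1" if "\<forall>j. b j \<le> - 1" for j using spec[OF that, of j] by simp
      then show "lookup ((single a c * single a' c') \<odot>\<^bsub>local_coh\<^esub> e) b =
         lookup (single a c \<odot>\<^bsub>local_coh\<^esub> (single a' c' \<odot>\<^bsub>local_coh\<^esub> e)) b"
        by (simp add: mult_single lookup_local_coh_smult_single lookup_add algebra_simps)
    qed
  qed (simp_all add: local_coh_smult_add local_coh_smult_0 ring_distribs)
qed (simp_all add: local_coh_smult_add ring_distribs)

lemma module_local_coh: "Module.module poly_ring (local_coh :: (('n::finite, 'k::comm_ring_1) mpoly, ('n, 'k) inv_poly) module)"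
proof (intro moduleI comm_ring_1_class.cring_from_type_algebra)
  show "abelian_group (local_coh :: (('n::finite, 'k::comm_ring_1) mpoly, ('n, 'k) inv_poly) module)"
  proof (rule abelian_groupI)
    fix x y :: "('n, 'k) inv_poly" assume "x \<in> carrier local_coh" "y \<in> carrier local_coh"
    then show "x \<oplus>\<^bsub>local_coh\<^esub> y \<in> carrier local_coh" using keys_add[of x y] by auto
  next
    fix x :: "('n, 'k) inv_poly" assume "x \<in> carrier local_coh"
    then show "\<exists>y\<in>carrier local_coh. y \<oplus>\<^bsub>local_coh\<^esub> x = \<zero>\<^bsub>local_coh\<^esub>"
      by (intro bexI[of _ "- x"]) (auto simp: in_keys_iff)
  qed (auto simp: algebra_simps)
  show "\<one>\<^bsub>ring_of_type_algebra\<^esub> \<odot>\<^bsub>local_coh\<^esub> x = x" if "x \<in> carrier local_coh" for x :: "('n, 'k) inv_poly"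
  proof (rule poly_mapping_eqI)
    fix b
    have "single 0 1 \<odot>\<^bsub>local_coh\<^esub> x = \<one>\<^bsub>poly_ring\<^esub> \<odot>\<^bsub>local_coh\<^esub> x" by simp
    then show "lookup (\<one>\<^bsub>ring_of_type_algebra\<^esub> \<odot>\<^bsub>local_coh\<^esub> x) b = lookup x b"
      using local_coh_lookup_0[OF that, of b] lookup_local_coh_smult_single[of 0 1 x b] by auto
  qed
qed (use local_coh_smult_closed in \<open>auto simp: local_coh_smult_add local_coh_smult_assoc simp del: local_coh_simps(1)\<close>)

text \<open>The factor is zero when \<open>b j = - 1\<close>, so derivatives have residue
  zero.\<close>

lemma lookup_local_coh_partial:
  "lookup (local_coh_partial j e) b = of_int (b j + 1) * lookup e (b(j := b j + 1))"
proof -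
  have "lookup (local_coh_partial j e) b = (\<Sum>b'\<in>keys e. if b' = b(j := b j + 1) then of_int (b' j) * lookup e b' else 0)"
    unfolding local_coh_partial_def lookup_sum lookup_single when_def
    by (intro sum.cong refl if_cong) (auto simp: fun_eq_iff)
  also have "\<dots> = of_int (b j + 1) * lookup e (b(j := b j + 1))"
    by (auto simp: sum.delta in_keys_iff)
  finally show ?thesis .
qed

definition residue_of :: "('n, 'k::zero) inv_poly \<Rightarrow> 'k" where
  "residue_of e = lookup e (\<lambda>j. - 1)"

lemma residue_of_add [simp]: "residue_of (e + e') = residue_of e + residue_of e'"
  by (simp add: residue_of_def lookup_add)

lemma residue_of_0 [simp]: "residue_of 0 = 0" by (simp add: residue_of_def)

text \<open>Multiplication by x^a moves the coefficient at -1-a to the place of the residue. So the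
  residues of the monomial multiples of an element recover all its coefficients.\<close>

lemma residue_of_single_smult:
  fixes e :: "('n::finite, 'k::comm_ring_1) inv_poly"
  shows "residue_of (single a c \<odot>\<^bsub>local_coh\<^esub> e) = c * lookup e (\<lambda>j. - 1 - int_exp a j)"
  by (simp add: residue_of_def lookup_local_coh_smult_single)

lemma residue_of_const_smult:
  fixes e :: "('n::finite, 'k::comm_ring_1) inv_poly"
  shows "residue_of (const_poly c \<odot>\<^bsub>local_coh\<^esub> e) = c * residue_of e"
  by (simp add: const_poly_def residue_of_single_smult) (simp add: residue_of_def)

lemma neg_exp_eq:
  assumes "\<forall>j. b j \<le> (-1::int)"
  shows "b = (\<lambda>j. - 1 - int_exp (nat_exp (\<lambda>j. - 1 - b j)) j)"
proof
  fix j show "b j = - 1 - int_exp (nat_exp (\<lambda>j. - 1 - b j)) j" using spec[OF assms, of j] by simp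
qed

lemma local_coh_eqI:
  fixes e e' :: "('n::finite, 'k::comm_ring_1) inv_poly"
  assumes "e \<in> carrier local_coh" "e' \<in> carrier local_coh"
    and "\<And>a. lookup e (\<lambda>j. - 1 - int_exp a j) = lookup e' (\<lambda>j. - 1 - int_exp a j)"
  shows "e = e'"
proof (rule poly_mapping_eqI)
  fix b :: "'n \<Rightarrow> int"
  show "lookup e b = lookup e' b"
  proof (cases "\<forall>j. b j \<le> -1")
    case True
    show ?thesis by (subst (1 2) neg_exp_eq[OF True]) (rule assms(3))
  next
    case False
    then show ?thesis using local_coh_lookup_0 assms by metis
  qed
qed

text \<open>Behind the finite support of the values of \<open>lift_functional\<close>: monomials of
  bounded degree are finite in number.\<close>

lemma finite_bounded_exponents: "finite {a :: 'n::finite \<Rightarrow>\<^sub>0 nat. (\<Sum>j\<in>UNIV. int (lookup a j)) \<le> N}"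
proof -
  have "lookup ` {a :: 'n \<Rightarrow>\<^sub>0 nat. (\<Sum>j\<in>UNIV. int (lookup a j)) \<le> N} \<subseteq> Pi\<^sub>E UNIV (\<lambda>_. {..nat N})"
  proof (intro subsetI, elim imageE)
    fix f and a :: "'n \<Rightarrow>\<^sub>0 nat" assume f: "f = lookup a" and a: "a \<in> {a. (\<Sum>j\<in>UNIV. int (lookup a j)) \<le> N}"
    have "lookup a i \<le> nat N" for i
    proof -
      have "int (lookup a i) \<le> (\<Sum>j\<in>UNIV. int (lookup a j))" by (rule member_le_sum) auto
      then show ?thesis using a by simp
    qed
    then show "f \<in> Pi\<^sub>E UNIV (\<lambda>_. {..nat N})" using f by auto
  qed
  moreover have "finite (Pi\<^sub>E (UNIV :: 'n set) (\<lambda>_. {..nat N}))" by (intro finite_PiE) auto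
  ultimately have "finite (lookup ` {a :: 'n \<Rightarrow>\<^sub>0 nat. (\<Sum>j\<in>UNIV. int (lookup a j)) \<le> N})"
    by (rule finite_subset)
  then show ?thesis by (rule finite_imageD) (rule inj_onI, rule poly_mapping_eqI, simp)
qed

section \<open>Graded modules over the ring of differential operators\<close>

definition kspace :: "('n, 'k::field, 'm) dmodule \<Rightarrow> ('k, 'm) module" where
  "kspace M = with_smult M (\<lambda>c m. mult_op (const_poly c) \<odot>\<^bsub>M\<^esub> m)"

lemma kspace_simps [simp]:
  "carrier (kspace M) = carrier M" "add (kspace M) = add M" "ring.zero (kspace M) = ring.zero M"
  "module.smult (kspace M) = (\<lambda>c m. mult_op (const_poly c) \<odot>\<^bsub>M\<^esub> m)"
  by (simp_all add: kspace_def)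

lemma underlying_poly_module_simps [simp]:
  "carrier (underlying_poly_module M) = carrier M" "add (underlying_poly_module M) = add M"
  "ring.zero (underlying_poly_module M) = ring.zero M"
  "module.smult (underlying_poly_module M) = (\<lambda>r m. mult_op r \<odot>\<^bsub>M\<^esub> m)"
  by (simp_all add: underlying_poly_module_def)

lemma mult_op_plus: "mult_op (r + s) = (\<lambda>p. mult_op r p + mult_op s p)"
  by (simp add: mult_op_def ring_distribs)

lemma mult_op_times: "mult_op (r * s) = mult_op r \<circ> mult_op s"
  by (simp add: mult_op_def fun_eq_iff mult.assoc)

lemma const_poly_simps: "const_poly (c + d) = const_poly c + const_poly d"
  "const_poly (c * d) = const_poly c * const_poly d" "const_poly 1 = 1"
  by (simp_all add: const_poly_def single_add mult_single)

text \<open>Instantiated both for \<open>M\<close> and for its dual, since the de Rham complexes of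
  both are needed.\<close>

locale left_dmodule =
  fixes M :: "('n::finite, 'k::field_char_0, 'm) dmodule" (structure)
  assumes ldm: "left_module diff_op_ring M"
begin

sublocale A: abelian_group M
  using ldm by (simp add: left_module_def)

lemma dsmult_closed [simp]: "P \<in> carrier diff_op_ring \<Longrightarrow> m \<in> carrier M \<Longrightarrow> P \<odot> m \<in> carrier M"
  using left_module.left_smult_closed[OF ldm] .

lemma dsmult_add: "P \<in> carrier diff_op_ring \<Longrightarrow> m \<in> carrier M \<Longrightarrow> m' \<in> carrier M \<Longrightarrow>
    P \<odot> (m \<oplus> m') = P \<odot> m \<oplus> P \<odot> m'"
  using left_module.left_smult_r_distr[OF ldm] .

lemma add_dsmult: "P \<in> carrier diff_op_ring \<Longrightarrow> Q \<in> carrier diff_op_ring \<Longrightarrow> m \<in> carrier M \<Longrightarrow>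
    (\<lambda>p. P p + Q p) \<odot> m = P \<odot> m \<oplus> Q \<odot> m"
  using left_module.left_smult_l_distr[OF ldm, of P Q m] by simp

lemma comp_dsmult: "P \<in> carrier diff_op_ring \<Longrightarrow> Q \<in> carrier diff_op_ring \<Longrightarrow> m \<in> carrier M \<Longrightarrow>
    P \<odot> (Q \<odot> m) = (P \<circ> Q) \<odot> m"
  using left_module.left_smult_assoc[OF ldm, of P Q m] by simp

lemma one_dsmult: "m \<in> carrier M \<Longrightarrow> mult_op 1 \<odot> m = m"
  using left_module.left_smult_one[OF ldm, of m] by (simp add: id_eq_mult_op)

lemma mult_add_dsmult: "m \<in> carrier M \<Longrightarrow> mult_op (r + s) \<odot> m = mult_op r \<odot> m \<oplus> mult_op s \<odot> m"
  by (simp add: mult_op_plus add_dsmult)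

lemma mult_mult_dsmult: "m \<in> carrier M \<Longrightarrow> mult_op r \<odot> (mult_op s \<odot> m) = mult_op (r * s) \<odot> m"
  by (simp add: mult_op_times comp_dsmult)

lemma dsmult_zero [simp]: "P \<in> carrier diff_op_ring \<Longrightarrow> P \<odot> \<zero> = \<zero>"
  using dsmult_add[of P "\<zero>" "\<zero>"] dsmult_closed[of P "\<zero>"] by (simp add: A.add.l_cancel_one')

lemma module_kspace: "Module.module base_field (kspace M)"
proof (intro moduleI comm_ring_1_class.cring_from_type_algebra)
  show "abelian_group (kspace M)" by (rule abelian_group_cong[OF A.abelian_group_axioms]) simp_all
qed (simp_all add: const_poly_simps mult_add_dsmult mult_mult_dsmult dsmult_add one_dsmult)

lemma module_underlying: "Module.module poly_ring (underlying_poly_module M)"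
proof (intro moduleI comm_ring_1_class.cring_from_type_algebra)
  show "abelian_group (underlying_poly_module M)" by (rule abelian_group_cong[OF A.abelian_group_axioms]) simp_all
qed (simp_all add: mult_add_dsmult mult_mult_dsmult dsmult_add one_dsmult)

text \<open>Operators in \<open>diff_op_ring\<close> are k-linear endomorphisms of R, so they
  commute with multiplication by constants.\<close>

lemma const_dsmult_commute:
  assumes P: "P \<in> carrier diff_op_ring" and m: "m \<in> carrier M"
  shows "P \<odot> (mult_op (const_poly c) \<odot> m) = mult_op (const_poly c) \<odot> (P \<odot> m)"
proof -
  have "P \<circ> mult_op (const_poly c) = mult_op (const_poly c) \<circ> P"
    using diff_op_endo[OF P] by (simp add: mult_op_def fun_eq_iff)
  then show ?thesis using P m by (simp add: comp_dsmult)
qed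

lemma partial_mult_dsmult:
  assumes m: "m \<in> carrier M"
  shows "partial_op j \<odot> (mult_op (single a 1) \<odot> m) =
    mult_op (single a 1) \<odot> (partial_op j \<odot> m) \<oplus>
    mult_op (single (a - single j 1) (of_nat (lookup a j))) \<odot> m"
proof -
  have "partial_op j \<circ> mult_op (single a (1::'k)) = (\<lambda>p. (mult_op (single a 1) \<circ> partial_op j) p +
     mult_op (single (a - single j 1) (of_nat (lookup a j))) p)"
    by (simp add: mult_op_def fun_eq_iff partial_op_single_mult)
  then show ?thesis using m
    by (simp add: comp_dsmult add_dsmult diff_op_comp del: comp_apply)
qed

lemma functional_comp_dsmult:
  assumes P: "P \<in> carrier diff_op_ring" and f: "functional_on (carrier M) (kspace M) f"
  shows "functional_on (carrier M) (kspace M) (\<lambda>m. f (P \<odot> m))"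
  unfolding functional_on_def
  using functional_onD[OF f] P by (auto simp: dsmult_add const_dsmult_commute)

end

locale graded_dmod =
  fixes M :: "('n::finite, 'k::field_char_0, 'm) dmodule" (structure) and gr :: "int \<Rightarrow> 'm set"
  assumes gd: "graded_dmodule M gr"
begin

sublocale left_dmodule M
  using gd by (intro left_dmodule.intro) (simp add: graded_dmodule_def)

lemma gr_subgroup: "additive_subgroup (gr l) (underlying_poly_module M)"
  using gd by (simp add: graded_dmodule_def graded_poly_module_def internal_direct_sum_def)

lemma gr_carrier: "m \<in> gr l \<Longrightarrow> m \<in> carrier M"
  using additive_subgroup.a_subset[OF gr_subgroup] by auto

lemma gr_add: "m \<in> gr l \<Longrightarrow> m' \<in> gr l \<Longrightarrow> m \<oplus> m' \<in> gr l"
  using additive_subgroup.a_closed[OF gr_subgroup] by simp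

lemma gr_zero: "\<zero> \<in> gr l"
  using additive_subgroup.zero_closed[OF gr_subgroup] by simp

lemma gr_homogeneous: "r \<in> homogeneous_polys d \<Longrightarrow> m \<in> gr l \<Longrightarrow> mult_op r \<odot> m \<in> gr (l + d)"
  using gd by (simp add: graded_dmodule_def graded_poly_module_def)

lemma gr_single: "m \<in> gr l \<Longrightarrow> mult_op (single a c) \<odot> m \<in> gr (l + (\<Sum>j\<in>UNIV. int (lookup a j)))"
  by (rule gr_homogeneous) (auto simp: homogeneous_polys_def split: if_splits)

lemma gr_const: "m \<in> gr l \<Longrightarrow> mult_op (const_poly c) \<odot> m \<in> gr l"
  using gr_single[of m l 0 c] by (simp add: const_poly_def)

lemma gr_partial: "m \<in> gr l \<Longrightarrow> partial_op j \<odot> m \<in> gr (l - 1)"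
  using gd by (simp add: graded_dmodule_def)

section \<open>Homogeneous components and truncation to a set of degrees\<close>

definition decomposes :: "'m \<Rightarrow> (int \<Rightarrow> 'm) \<Rightarrow> bool" where
  "decomposes m c \<longleftrightarrow> (\<forall>l. c l \<in> gr l) \<and> finite {l. c l \<noteq> \<zero>} \<and> m = (\<Oplus>l\<in>{l. c l \<noteq> \<zero>}. c l)"

definition comps :: "'m \<Rightarrow> int \<Rightarrow> 'm" where
  "comps m = (THE c. decomposes m c)"

lemma decomposes_ex1: "m \<in> carrier M \<Longrightarrow> \<exists>!c. decomposes m c"
proof -
  have *: "finsum (underlying_poly_module M) c A = finsum M c A" for c :: "int \<Rightarrow> 'm" and A
    by (rule finsum_cong_record) simp_all
  assume "m \<in> carrier M"
  then show ?thesis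
    using gd unfolding graded_dmodule_def graded_poly_module_def internal_direct_sum_def decomposes_def
    by (simp add: *)
qed

lemma decomposes_comps: "m \<in> carrier M \<Longrightarrow> decomposes m (comps m)"
  unfolding comps_def using theI'[OF decomposes_ex1] .

lemma comps_eqI: "m \<in> carrier M \<Longrightarrow> decomposes m c \<Longrightarrow> comps m = c"
  using decomposes_comps decomposes_ex1 by blast

lemma comps_in_gr: "m \<in> carrier M \<Longrightarrow> comps m l \<in> gr l"
  using decomposes_comps by (simp add: decomposes_def)

lemma comps_finite: "m \<in> carrier M \<Longrightarrow> finite {l. comps m l \<noteq> \<zero>}"
  using decomposes_comps by (simp add: decomposes_def)

lemma finsum_superset:
  assumes "finite F" "{l \<in> T. c l \<noteq> \<zero>} \<subseteq> F" "F \<subseteq> T" "\<And>l. c l \<in> carrier M"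
  shows "(\<Oplus>l\<in>{l \<in> T. c l \<noteq> \<zero>}. c l) = (\<Oplus>l\<in>F. c l)"
  by (rule A.add.finprod_mono_neutral_cong_left) (use assms in auto)

text \<open>The projection to the degrees in \<open>T\<close>. The set \<open>T\<close> may be
  infinite, because only the finitely many degrees of nonzero components enter the sum.\<close>

definition truncate :: "int set \<Rightarrow> 'm \<Rightarrow> 'm" where
  "truncate T m = (\<Oplus>l\<in>{l \<in> T. comps m l \<noteq> \<zero>}. comps m l)"

lemma comps_carrier [simp]: "m \<in> carrier M \<Longrightarrow> comps m l \<in> carrier M"
  using comps_in_gr gr_carrier by blast

lemma truncate_closed [simp]: "m \<in> carrier M \<Longrightarrow> truncate T m \<in> carrier M"
  unfolding truncate_def by (rule A.finsum_closed) auto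

lemma truncate_UNIV: "m \<in> carrier M \<Longrightarrow> truncate UNIV m = m"
  using decomposes_comps[of m] by (simp add: truncate_def decomposes_def)

lemma truncate_superset:
  assumes m: "m \<in> carrier M" and "{l. comps m l \<noteq> \<zero>} \<subseteq> T"
  shows "truncate T m = m"
proof -
  have "{l \<in> T. comps m l \<noteq> \<zero>} = {l \<in> UNIV. comps m l \<noteq> \<zero>}" using assms by auto
  then show ?thesis using truncate_UNIV[OF m] by (simp add: truncate_def)
qed

lemma comps_add:
  assumes m: "m \<in> carrier M" "m' \<in> carrier M"
  shows "comps (m \<oplus> m') = (\<lambda>l. comps m l \<oplus> comps m' l)"
proof (rule comps_eqI)
  \<comment> \<open>A sum may have fewer nonzero components than its summands; both sides are
    computed over the union of the two supports.\<close>
  let ?F = "{l. comps m l \<noteq> \<zero>} \<union> {l. comps m' l \<noteq> \<zero>}"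
  let ?c = "\<lambda>l. comps m l \<oplus> comps m' l"
  have fin: "finite ?F" using m comps_finite by auto
  have sub: "{l. ?c l \<noteq> \<zero>} \<subseteq> ?F" by auto
  have "(\<Oplus>l\<in>{l. ?c l \<noteq> \<zero>}. ?c l) = (\<Oplus>l\<in>?F. ?c l)"
    using finsum_superset[of ?F UNIV ?c] fin sub m by simp
  also have "\<dots> = (\<Oplus>l\<in>?F. comps m l) \<oplus> (\<Oplus>l\<in>?F. comps m' l)"
    by (rule A.finsum_addf) (use m in auto)
  also have "\<dots> = truncate UNIV m \<oplus> truncate UNIV m'"
    using finsum_superset[of ?F UNIV "comps m"] finsum_superset[of ?F UNIV "comps m'"] fin m
    by (simp add: truncate_def)
  finally show "decomposes (m \<oplus> m') ?c"
    using m fin finite_subset[OF sub fin] unfolding decomposes_def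
    by (auto simp: truncate_UNIV intro: gr_add comps_in_gr)
qed (use m in simp)

lemma truncate_add:
  assumes m: "m \<in> carrier M" "m' \<in> carrier M"
  shows "truncate T (m \<oplus> m') = truncate T m \<oplus> truncate T m'"
proof -
  let ?F = "T \<inter> ({l. comps m l \<noteq> \<zero>} \<union> {l. comps m' l \<noteq> \<zero>})"
  let ?c = "\<lambda>l. comps m l \<oplus> comps m' l"
  have fin: "finite ?F" using m comps_finite by auto
  have sub: "{l \<in> T. ?c l \<noteq> \<zero>} \<subseteq> ?F" by auto
  have "truncate T (m \<oplus> m') = (\<Oplus>l\<in>?F. ?c l)"
    unfolding truncate_def comps_add[OF m] using finsum_superset[of ?F T ?c] fin sub m by simp
  also have "\<dots> = (\<Oplus>l\<in>?F. comps m l) \<oplus> (\<Oplus>l\<in>?F. comps m' l)"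
    by (rule A.finsum_addf) (use m in auto)
  also have "(\<Oplus>l\<in>?F. comps m l) = truncate T m"
    unfolding truncate_def by (rule finsum_superset[symmetric]) (use fin m in auto)
  also have "(\<Oplus>l\<in>?F. comps m' l) = truncate T m'"
    unfolding truncate_def by (rule finsum_superset[symmetric]) (use fin m in auto)
  finally show ?thesis .
qed

lemma comps_gr:
  assumes m: "m \<in> gr l"
  shows "comps m = (\<lambda>l'. if l' = l then m else \<zero>)"
proof (rule comps_eqI)
  let ?c = "\<lambda>l'. if l' = l then m else \<zero>"
  have fin: "finite {l'. ?c l' \<noteq> \<zero>}" by (rule finite_subset[of _ "{l}"]) (auto split: if_splits)
  have "(\<Oplus>l'\<in>{l' \<in> UNIV. ?c l' \<noteq> \<zero>}. ?c l') = (\<Oplus>l'\<in>{l}. ?c l')"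
    by (rule finsum_superset) (use gr_carrier[OF m] in \<open>auto split: if_splits\<close>)
  also have "\<dots> = m" using gr_carrier[OF m] by simp
  finally show "decomposes m ?c" unfolding decomposes_def using m gr_zero fin by auto
qed (use m gr_carrier in simp)

lemma truncate_gr:
  assumes m: "m \<in> gr l"
  shows "truncate T m = (if l \<in> T then m else \<zero>)"
proof (cases "l \<in> T \<and> m \<noteq> \<zero>")
  case True
  then have "{l' \<in> T. (if l' = l then m else \<zero>) \<noteq> \<zero>} = {l}" by auto
  then show ?thesis using True gr_carrier[OF m] by (simp add: truncate_def comps_gr[OF m])
next
  case False
  then have "{l' \<in> T. (if l' = l then m else \<zero>) \<noteq> \<zero>} = {}" by auto
  then show ?thesis using False by (simp only: truncate_def comps_gr[OF m] A.finsum_empty) auto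
qed

lemma graded_induct [consumes 1, case_names gr add]:
  assumes m: "m \<in> carrier M"
    and gr: "\<And>l m. m \<in> gr l \<Longrightarrow> K m"
    and add: "\<And>m m'. m \<in> carrier M \<Longrightarrow> m' \<in> carrier M \<Longrightarrow> K m \<Longrightarrow> K m' \<Longrightarrow> K (m \<oplus> m')"
  shows "K m"
proof -
  have "K (\<Oplus>l\<in>F. comps m l)" if "finite F" for F
    using that
  proof (induction F rule: finite_induct)
    case empty
    show ?case using gr[OF gr_zero] by simp
  next
    case (insert l F)
    then show ?case using m gr[OF comps_in_gr[OF m]] by (simp add: add)
  qed
  from this[OF comps_finite[OF m]] show ?thesis
    using truncate_UNIV[OF m] by (simp add: truncate_def)
qed

lemma truncate_const:
  assumes "m \<in> carrier M"
  shows "truncate T (mult_op (const_poly c) \<odot> m) = mult_op (const_poly c) \<odot> truncate T m"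
  using assms
proof (induction rule: graded_induct)
  case (gr l m)
  then show ?case using gr_const[OF gr, of c] by (auto simp: truncate_gr)
qed (simp add: truncate_add dsmult_add)

text \<open>The derivative of an element of degree l has degree l - 1, which lies in
  \<open>{l. l + 1 \<in> T}\<close> exactly if l lies in \<open>T\<close>.\<close>

lemma truncate_partial:
  assumes "m \<in> carrier M"
  shows "partial_op j \<odot> truncate T m = truncate {l. l + 1 \<in> T} (partial_op j \<odot> m)"
  using assms
proof (induction rule: graded_induct)
  case (gr l m)
  then show ?case using gr_partial[OF gr, of j] by (auto simp: truncate_gr)
qed (simp add: truncate_add dsmult_add)


section \<open>Functionals of bounded degree and the graded Matlis dual\<close>

definition bounded_functional :: "('m \<Rightarrow> 'k) \<Rightarrow> bool" where
  "bounded_functional f \<longleftrightarrow> functional_on (carrier M) (kspace M) f \<and>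
     (\<exists>S. finite S \<and> (\<forall>l. l \<notin> S \<longrightarrow> (\<forall>m\<in>gr l. f m = 0)))"

lemma bounded_functional_add:
  assumes "bounded_functional f" "m \<in> carrier M" "m' \<in> carrier M"
  shows "f (m \<oplus> m') = f m + f m'"
  using functional_onD(1)[of "carrier M" "kspace M" f m m'] assms by (simp add: bounded_functional_def)

lemma bounded_functional_const:
  assumes "bounded_functional f" "m \<in> carrier M"
  shows "f (mult_op (const_poly c) \<odot> m) = c * f m"
  using functional_onD(2)[of "carrier M" "kspace M" f m c] assms by (simp add: bounded_functional_def)

lemma bounded_functional_zero: "bounded_functional f \<Longrightarrow> f \<zero> = 0"
  using functional_on_zero[OF module_kspace, of "carrier M" f] by (simp add: bounded_functional_def)

lemma bounded_functional_plus:
  assumes "bounded_functional f" "bounded_functional g"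
  shows "bounded_functional (\<lambda>m. f m + g m)"
proof -
  obtain S S' where "finite S" "\<forall>l. l \<notin> S \<longrightarrow> (\<forall>m\<in>gr l. f m = 0)"
    "finite S'" "\<forall>l. l \<notin> S' \<longrightarrow> (\<forall>m\<in>gr l. g m = 0)"
    using assms by (auto simp: bounded_functional_def)
  then show ?thesis using assms unfolding bounded_functional_def functional_on_def
    by (intro conjI exI[of _ "S \<union> S'"]) (auto simp: algebra_simps)
qed

text \<open>Functionals are total functions on the type, so two descriptions of one functional may
  differ outside the carrier.\<close>

lemma bounded_functional_cong:
  assumes "bounded_functional f" "\<And>m. m \<in> carrier M \<Longrightarrow> g m = f m"
  shows "bounded_functional g"
  using assms gr_carrier unfolding bounded_functional_def functional_on_def
  by (auto simp: Ball_def)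

text \<open>An operator need not be homogeneous, but it is built from monomials and derivatives,
  which shift degrees by constants. So the finite set of degrees in which the functional may be
  nonzero is replaced by a finite set at every stage.\<close>

lemma bounded_functional_dsmult:
  assumes "P \<in> carrier diff_op_ring" "bounded_functional f"
  shows "bounded_functional (\<lambda>m. f (P \<odot> m))"
  using assms
proof (induction arbitrary: f rule: diff_op_induct)
  case (mult r)
  then show ?case
  proof (induction r rule: poly_mapping_add_induct)
    case zero
    have "mult_op 0 \<odot> m = \<zero>" if "m \<in> carrier M" for m
      using mult_add_dsmult[OF that, of 0 0] that by (simp add: A.add.l_cancel_one')
    then show ?case
      unfolding bounded_functional_def
      using functional_comp_dsmult[of "mult_op 0" f] zero bounded_functional_zero[OF zero] gr_carrier
      by (auto simp: bounded_functional_def)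
  next
    case (single a c)
    then obtain S where S: "finite S" "\<forall>l. l \<notin> S \<longrightarrow> (\<forall>m\<in>gr l. f m = 0)"
      by (auto simp: bounded_functional_def)
    let ?d = "\<Sum>j\<in>UNIV. int (lookup a j)"
    \<comment> \<open>The monomial raises degrees by \<open>?d\<close>, so the degrees that matter
      before multiplication are those of \<open>S\<close> lowered by \<open>?d\<close>.\<close>
    have "f (mult_op (single a c) \<odot> m) = 0" if "l \<notin> (\<lambda>l. l - ?d) ` S" "m \<in> gr l" for l m
    proof -
      have "l + ?d \<notin> S" using that(1) by (metis add_diff_cancel_right' image_eqI)
      then show ?thesis using S gr_single[OF that(2)] by blast
    qed
    then show ?case using S(1) functional_comp_dsmult[of "mult_op (single a c)" f] single
      unfolding bounded_functional_def by (auto intro!: exI[of _ "(\<lambda>l. l - ?d) ` S"])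
  next
    case (add p q)
    show ?case
      by (rule bounded_functional_cong[OF bounded_functional_plus[OF add(1)[OF add(3)] add(2)[OF add(3)]]])
        (simp add: mult_add_dsmult bounded_functional_add[OF add(3)])
  qed
next
  case (partial j)
  then obtain S where S: "finite S" "\<forall>l. l \<notin> S \<longrightarrow> (\<forall>m\<in>gr l. f m = 0)"
    by (auto simp: bounded_functional_def)
  have "f (partial_op j \<odot> m) = 0" if "l \<notin> (\<lambda>l. l + 1) ` S" "m \<in> gr l" for l m
  proof -
    have "l - 1 \<notin> S" using that(1) by (metis diff_add_cancel image_eqI)
    then show ?thesis using S gr_partial[OF that(2)] by blast
  qed
  then show ?case using S(1) functional_comp_dsmult[of "partial_op j" f] partial
    unfolding bounded_functional_def by (auto intro!: exI[of _ "(\<lambda>l. l + 1) ` S"])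
next
  case (add P Q)
  show ?case
    by (rule bounded_functional_cong[OF bounded_functional_plus[OF add(3)[OF add(5)] add(4)[OF add(5)]]])
      (use add in \<open>simp add: add_dsmult bounded_functional_add\<close>)
next
  \<comment> \<open>The hypothesis for \<open>P\<close> is applied to \<open>f\<close>, the one for
    \<open>Q\<close> to the resulting functional; this is why \<open>f\<close> is arbitrary in the
    induction.\<close>
  case (comp P Q)
  show ?case
    by (rule bounded_functional_cong[OF comp(4)[OF comp(3)[OF comp(5)]]])
      (use comp in \<open>simp add: comp_dsmult comp_def\<close>)
qed

text \<open>This turns the functionals obtained by linear extension into elements of the graded
  dual.\<close>

lemma bounded_functional_truncate:
  assumes f: "functional_on (carrier M) (kspace M) f" and T: "finite T"
  shows "bounded_functional (\<lambda>m. f (truncate T m))"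
  unfolding bounded_functional_def
proof (intro conjI exI[of _ T] allI impI ballI T)
  show "functional_on (carrier M) (kspace M) (\<lambda>m. f (truncate T m))"
    using functional_onD[OF f] unfolding functional_on_def
    by (auto simp: truncate_add truncate_const)
  have "f \<zero> = 0" using functional_on_zero[OF module_kspace f] by simp
  then show "f (truncate T m) = 0" if "l \<notin> T" "m \<in> gr l" for l m
    using that by (simp add: truncate_gr)
qed

text \<open>The inverse of \<open>\<phi> \<mapsto> residue_of \<circ> \<phi>\<close>.\<close>

definition lift_functional :: "('m \<Rightarrow> 'k) \<Rightarrow> 'm \<Rightarrow> ('n, 'k) inv_poly" where
  "lift_functional f = (\<lambda>m\<in>carrier M. Abs_poly_mapping (\<lambda>b. if \<forall>j. b j \<le> -1
     then f (mult_op (single (nat_exp (\<lambda>j. - 1 - b j)) 1) \<odot> m) else 0))"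

text \<open>For \<open>m\<close> of degree l, a nonzero value at x^a m forces l + |a| into a finite
  set, hence bounds |a|. This makes the function under \<open>Abs_poly_mapping\<close> in
  \<open>lift_functional\<close> finitely supported.\<close>

lemma bounded_functional_finite:
  assumes f: "bounded_functional f" and m: "m \<in> carrier M"
  shows "finite {a. f (mult_op (single a 1) \<odot> m) \<noteq> 0}"
  using m
proof (induction rule: graded_induct)
  case (gr l m)
  obtain S where S: "finite S" "\<And>l m. l \<notin> S \<Longrightarrow> m \<in> gr l \<Longrightarrow> f m = 0"
    using f by (auto simp: bounded_functional_def)
  obtain N where N: "\<And>s. s \<in> S \<Longrightarrow> s \<le> N" using S(1) by (meson bdd_above.E bdd_above_finite)
  have "{a. f (mult_op (single a 1) \<odot> m) \<noteq> 0} \<subseteq> {a. (\<Sum>j\<in>UNIV. int (lookup a j)) \<le> N - l}"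
  proof
    fix a assume "a \<in> {a. f (mult_op (single a 1) \<odot> m) \<noteq> 0}"
    then have "l + (\<Sum>j\<in>UNIV. int (lookup a j)) \<in> S" using S(2) gr_single[OF gr] by blast
    from N[OF this] show "a \<in> {a. (\<Sum>j\<in>UNIV. int (lookup a j)) \<le> N - l}" by simp
  qed
  then show ?case using finite_bounded_exponents by (rule finite_subset)
next
  case (add m m')
  have "{a. f (mult_op (single a 1) \<odot> (m \<oplus> m')) \<noteq> 0} \<subseteq>
    {a. f (mult_op (single a 1) \<odot> m) \<noteq> 0} \<union> {a. f (mult_op (single a 1) \<odot> m') \<noteq> 0}"
    using add by (auto simp: dsmult_add bounded_functional_add[OF f])
  then show ?case using add by (meson finite_Un finite_subset)
qed

lemma lookup_lift_functional:
  assumes f: "bounded_functional f" and m: "m \<in> carrier M"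
  shows "lookup (lift_functional f m) b = (if \<forall>j. b j \<le> -1
     then f (mult_op (single (nat_exp (\<lambda>j. - 1 - b j)) 1) \<odot> m) else 0)"
proof -
  let ?g = "\<lambda>b. if \<forall>j. b j \<le> -1
     then f (mult_op (single (nat_exp (\<lambda>j. - 1 - b j)) 1) \<odot> m) else 0"
  have "{b. ?g b \<noteq> 0} \<subseteq> (\<lambda>a j. - 1 - int_exp a j) ` {a. f (mult_op (single a 1) \<odot> m) \<noteq> 0}"
  proof
    fix b assume b: "b \<in> {b. ?g b \<noteq> 0}"
    then have neg: "\<forall>j. b j \<le> -1" by (auto split: if_splits)
    then have "f (mult_op (single (nat_exp (\<lambda>j. - 1 - b j)) 1) \<odot> m) \<noteq> 0" using b by simp
    then show "b \<in> (\<lambda>a j. - 1 - int_exp a j) ` {a. f (mult_op (single a 1) \<odot> m) \<noteq> 0}"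
      by (intro image_eqI[where x = "nat_exp (\<lambda>j. - 1 - b j)"] neg_exp_eq[OF neg] CollectI)
  qed
  then have "finite {b. ?g b \<noteq> 0}" using bounded_functional_finite[OF f m] by (meson finite_surj)
  then show ?thesis using m by (simp add: lift_functional_def)
qed

lemma lookup_lift_functional_neg:
  assumes "bounded_functional f" "m \<in> carrier M"
  shows "lookup (lift_functional f m) (\<lambda>j. - 1 - int_exp a j) = f (mult_op (single a 1) \<odot> m)"
proof -
  have "nat_exp (int_exp a) = a" by (rule poly_mapping_eqI) simp
  then show ?thesis using lookup_lift_functional[OF assms] by simp
qed

lemma lift_functional_carrier:
  assumes "bounded_functional f" "m \<in> carrier M"
  shows "lift_functional f m \<in> carrier local_coh"
  using lookup_lift_functional[OF assms] by (auto simp: in_keys_iff split: if_splits)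

text \<open>The identity that characterizes the lift: the residues of all multiples of
  \<open>lift_functional f m\<close> are given by \<open>f\<close>, and they determine this element
  of E.\<close>

lemma residue_of_smult_lift_functional:
  assumes f: "bounded_functional f" and m: "m \<in> carrier M"
  shows "residue_of (r \<odot>\<^bsub>local_coh\<^esub> lift_functional f m) = f (mult_op r \<odot> m)"
proof (induction r rule: poly_mapping_add_induct)
  case zero
  have "mult_op 0 \<odot> m = \<zero>"
    using mult_add_dsmult[OF m, of 0 0] m by (simp add: A.add.l_cancel_one')
  then show ?case by (simp add: local_coh_smult_add bounded_functional_zero[OF f])
next
  case (single a c)
  have "mult_op (single a c) \<odot> m = mult_op (const_poly c) \<odot> (mult_op (single a 1) \<odot> m)"
    using m by (simp add: mult_mult_dsmult const_poly_def mult_single)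
  then show ?case using m
    by (simp add: residue_of_single_smult lookup_lift_functional_neg[OF f m] bounded_functional_const[OF f])
next
  case (add p q)
  then show ?case using m by (simp add: local_coh_smult_add mult_add_dsmult bounded_functional_add[OF f])
qed

lemma residue_of_lift_functional:
  assumes f: "bounded_functional f" and m: "m \<in> carrier M"
  shows "residue_of (lift_functional f m) = f m"
proof -
  have "lift_functional f m = 1 \<odot>\<^bsub>local_coh\<^esub> lift_functional f m"
    using Module.module.smult_one[OF module_local_coh lift_functional_carrier[OF f m]] by simp
  then show ?thesis using residue_of_smult_lift_functional[OF f m, of 1] one_dsmult[OF m] by simp
qed

section \<open>Linear maps into the local cohomology module and their residues\<close>

lemma residue_of_smult_eqI:
  fixes e e' :: "('n, 'k) inv_poly"
  assumes "e \<in> carrier local_coh" "e' \<in> carrier local_coh"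
    and "\<And>r :: ('n, 'k) mpoly. residue_of (r \<odot>\<^bsub>local_coh\<^esub> e) = residue_of (r \<odot>\<^bsub>local_coh\<^esub> e')"
  shows "e = e'"
  using assms(1,2)
proof (rule local_coh_eqI)
  show "lookup e (\<lambda>j. - 1 - int_exp a j) = lookup e' (\<lambda>j. - 1 - int_exp a j)" for a
    using assms(3)[of "single a 1"] by (simp add: residue_of_single_smult)
qed

abbreviation Homs :: "(('n, 'k) mpoly, 'm \<Rightarrow> ('n, 'k) inv_poly) module" where
  "Homs \<equiv> Hom_module poly_ring (underlying_poly_module M) local_coh"

lemma HomsD:
  assumes "\<phi> \<in> carrier Homs"
  shows "m \<in> carrier M \<Longrightarrow> \<phi> m \<in> carrier local_coh"
    and "m \<in> carrier M \<Longrightarrow> m' \<in> carrier M \<Longrightarrow> \<phi> (m \<oplus> m') = \<phi> m + \<phi> m'"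
    and "m \<in> carrier M \<Longrightarrow> \<phi> (mult_op r \<odot> m) = r \<odot>\<^bsub>local_coh\<^esub> \<phi> m"
    and "\<phi> \<in> extensional (carrier M)"
  using assms by (auto simp: linear_maps_def Pi_iff simp del: local_coh_simps(1))

text \<open>By linearity the residue of r times \<phi>(m) is the residue of \<phi>(r m). So the
  residue functional on all of \<open>M\<close> knows every coefficient of every value.\<close>

lemma Homs_eqI:
  assumes "\<phi> \<in> carrier Homs" "\<psi> \<in> carrier Homs"
    and eq: "\<And>m. m \<in> carrier M \<Longrightarrow> residue_of (\<phi> m) = residue_of (\<psi> m)"
  shows "\<phi> = \<psi>"
proof (rule extensionalityI)
  fix m assume m: "m \<in> carrier M"
  show "\<phi> m = \<psi> m"
  proof (rule residue_of_smult_eqI)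
    show "residue_of (r \<odot>\<^bsub>local_coh\<^esub> \<phi> m) = residue_of (r \<odot>\<^bsub>local_coh\<^esub> \<psi> m)" for r
      using eq[of "mult_op r \<odot> m"] m HomsD(3)[OF assms(1) m] HomsD(3)[OF assms(2) m] by simp
  qed (use m HomsD(1) assms in blast)+
qed (use HomsD(4) assms in blast)+

lemma residue_functional:
  assumes \<phi>: "\<phi> \<in> carrier Homs"
  shows "functional_on (carrier M) (kspace M) (\<lambda>m. residue_of (\<phi> m))"
  unfolding functional_on_def using HomsD[OF \<phi>] by (simp add: residue_of_const_smult)

text \<open>Additivity and R-linearity are tested by multiplying with an arbitrary r and taking
  residues, where they become properties of \<open>f\<close>.\<close>

lemma lift_functional_Homs:
  assumes f: "bounded_functional f"
  shows "lift_functional f \<in> carrier Homs"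
proof -
  have "lift_functional f (m \<oplus> m') = lift_functional f m + lift_functional f m'"
    if "m \<in> carrier M" "m' \<in> carrier M" for m m'
  proof (rule residue_of_smult_eqI)
    show "lift_functional f m + lift_functional f m' \<in> carrier local_coh"
      using abelian_groupE(1)[OF Module.module.axioms(2)[OF module_local_coh] lift_functional_carrier[OF f that(1)]
        lift_functional_carrier[OF f that(2)]] by simp
  qed (use that lift_functional_carrier[OF f] in
      \<open>simp_all add: residue_of_smult_lift_functional[OF f] local_coh_smult_add dsmult_add bounded_functional_add[OF f] del: local_coh_simps(1)\<close>)
  moreover have "lift_functional f (mult_op r \<odot> m) = r \<odot>\<^bsub>local_coh\<^esub> lift_functional f m"
    if "m \<in> carrier M" for r m
    by (rule residue_of_smult_eqI) (use that lift_functional_carrier[OF f] local_coh_smult_closed in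
      \<open>simp_all add: residue_of_smult_lift_functional[OF f] local_coh_smult_assoc[symmetric] mult_mult_dsmult del: local_coh_simps(1)\<close>)
  ultimately show ?thesis
    using lift_functional_carrier[OF f]
    by (auto simp: linear_maps_def lift_functional_def[of f] restrict_def extensional_def simp del: local_coh_simps(1))
qed

end

lemma residue_of_sum: "residue_of (\<Sum>i\<in>A. f i) = (\<Sum>i\<in>A. residue_of (f i))"
  by (simp add: residue_of_def lookup_sum)

lemma residue_of_uminus [simp]: "residue_of (- e) = - residue_of (e :: ('n, 'k::ab_group_add) inv_poly)"
  by (simp add: residue_of_def)

lemma local_coh_partial_carrier:
  assumes "e \<in> carrier local_coh"
  shows "local_coh_partial j e \<in> carrier local_coh"
proof -
  have "lookup (local_coh_partial j e) b = 0" if i: "\<not> b i \<le> - 1" for b i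
  proof -
    have "\<not> (b(j := b j + 1)) i \<le> - 1" using i by auto
    then have "\<not> (\<forall>i. (b(j := b j + 1)) i \<le> - 1)" by blast
    from local_coh_lookup_0[OF assms this] show ?thesis
      unfolding lookup_local_coh_partial by (simp only: mult_zero_right)
  qed
  then show ?thesis by (auto simp: in_keys_iff)
qed

section \<open>The graded Matlis dual described by residue functionals\<close>

context graded_dmod
begin

lemma Homs_lookup:
  assumes "\<phi> \<in> carrier Homs" "m \<in> carrier M"
  shows "lookup (\<phi> m) (\<lambda>j. - 1 - int_exp a j) = residue_of (\<phi> (mult_op (single a 1) \<odot> m))"
  using HomsD(3)[OF assms, of "single a 1"] by (simp add: residue_of_single_smult)

lemma Homs_zero: "\<phi> \<in> carrier Homs \<Longrightarrow> \<phi> \<zero> = 0"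
  using HomsD(2)[of \<phi> "\<zero>" "\<zero>"] by simp

lemma matlis_dual_deg_eq:
  "matlis_dual_deg M gr d = {f \<in> carrier Homs. \<forall>l. f ` gr l \<subseteq> local_coh_deg (l + d)}"
  by (simp add: matlis_dual_deg_def Hom_deg_def)

text \<open>With n variables the residue reads the part of E of degree -n, so a map of degree d has
  nonzero residues only on elements of degree -n-d. Conversely, each coefficient of \<phi>(m) is the
  residue of \<phi>(x^a m) for some a, and this forces its degree.\<close>

lemma matlis_dual_deg_iff:
  "\<phi> \<in> matlis_dual_deg M gr d \<longleftrightarrow> \<phi> \<in> carrier Homs \<and>
    (\<forall>l. l \<noteq> - int CARD('n) - d \<longrightarrow> (\<forall>m\<in>gr l. residue_of (\<phi> m) = 0))"
proof (intro iffI conjI allI impI ballI)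
  assume \<phi>: "\<phi> \<in> matlis_dual_deg M gr d"
  then show "\<phi> \<in> carrier Homs" by (simp add: matlis_dual_deg_eq)
  fix l m assume l: "l \<noteq> - int CARD('n) - d" and m: "m \<in> gr l"
  then have "\<phi> m \<in> local_coh_deg (l + d)" using \<phi> by (auto simp: matlis_dual_deg_eq)
  then have "(\<Sum>j\<in>(UNIV :: 'n set). - 1) = l + d" if "(\<lambda>j. - 1) \<in> keys (\<phi> m)"
    using that by (auto simp: local_coh_deg_def)
  then show "residue_of (\<phi> m) = 0" using l by (auto simp: residue_of_def in_keys_iff)
next
  assume *: "\<phi> \<in> carrier Homs \<and>
    (\<forall>l. l \<noteq> - int CARD('n) - d \<longrightarrow> (\<forall>m\<in>gr l. residue_of (\<phi> m) = 0))"
  have "\<phi> m \<in> local_coh_deg (l + d)" if m: "m \<in> gr l" for l m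
  proof -
    have mM: "m \<in> carrier M" using gr_carrier[OF m] .
    have c: "\<phi> m \<in> carrier local_coh" using HomsD(1)[OF conjunct1[OF *] mM] .
    have "(\<Sum>j\<in>UNIV. b j) = l + d" if b: "b \<in> keys (\<phi> m)" for b
    proof -
      have neg: "\<forall>j. b j \<le> - 1" using c b by simp
      define a where "a = nat_exp (\<lambda>j. - 1 - b j)"
      have ba: "b = (\<lambda>j. - 1 - int_exp a j)" unfolding a_def by (rule neg_exp_eq[OF neg])
      have "residue_of (\<phi> (mult_op (single a 1) \<odot> m)) \<noteq> 0"
        using b Homs_lookup[OF conjunct1[OF *] mM, of a] unfolding ba[symmetric] by (simp add: in_keys_iff)
      \<comment> \<open>From l + |a| = -n-d, the degree -n-|a| of the inverse monomial
        \<open>b\<close> is l + d.\<close>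
      then have "l + (\<Sum>j\<in>UNIV. int (lookup a j)) = - int CARD('n) - d"
        using * gr_single[OF m, of a 1] by blast
      then show ?thesis unfolding ba by (simp add: sum_subtractf)
    qed
    then show ?thesis using c by (simp add: local_coh_deg_def)
  qed
  then show "\<phi> \<in> matlis_dual_deg M gr d" using * by (auto simp: matlis_dual_deg_eq)
qed

lemma matlis_dual_simps [simp]:
  "add (matlis_dual M gr) = add Homs" "ring.zero (matlis_dual M gr) = ring.zero Homs"
  "module.smult (matlis_dual M gr) = module.smult Homs"
  by (simp_all add: matlis_dual_def graded_Hom_def)

lemma module_Homs: "Module.module poly_ring Homs"
  by (rule Hom_module_is_module[OF module_underlying module_local_coh])

lemma abelian_group_Homs: "abelian_group Homs"
  using module_Homs by (simp add: Module.module_def)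

lemma residue_finsum_Homs:
  assumes "\<And>d. d \<in> A \<Longrightarrow> c d \<in> carrier Homs" "m \<in> carrier M"
  shows "residue_of (finsum Homs c A m) = (\<Sum>d\<in>A. residue_of (c d m))"
proof -
  have "finsum Homs c A m = (\<Sum>d\<in>A. c d m)"
    by (rule finsum_Hom_module[OF module_underlying module_local_coh]) (use assms in auto)
  then show ?thesis by (simp add: residue_of_sum)
qed

lemma finsum_Homs_closed:
  assumes "\<And>d. d \<in> A \<Longrightarrow> c d \<in> carrier Homs"
  shows "finsum Homs c A \<in> carrier Homs"
  using abelian_monoid.finsum_closed[of Homs c A] abelian_group_Homs assms
  by (auto simp: abelian_group_def simp del: Hom_module_simps)

lemma matlis_dual_carrier_eq:
  "carrier (matlis_dual M gr) = {finsum Homs c A | A c. finite A \<and> (\<forall>d\<in>A. c d \<in> matlis_dual_deg M gr d)}"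
  by (simp add: matlis_dual_def graded_Hom_def matlis_dual_deg_def)

text \<open>A finite sum of homogeneous maps has residues in finitely many degrees. Conversely, a
  bounded residue functional is cut into its homogeneous parts, each of which is lifted, and the
  lifts sum to \<phi> because residues determine maps.\<close>

lemma matlis_dual_carrier_iff:
  "\<phi> \<in> carrier (matlis_dual M gr) \<longleftrightarrow>
    \<phi> \<in> carrier Homs \<and> bounded_functional (\<lambda>m. residue_of (\<phi> m))"
proof
  assume "\<phi> \<in> carrier (matlis_dual M gr)"
  then obtain A c where A: "finite A" and c: "\<And>d. d \<in> A \<Longrightarrow> c d \<in> matlis_dual_deg M gr d"
    and \<phi>: "\<phi> = finsum Homs c A" unfolding matlis_dual_carrier_eq by blast
  have cH: "c d \<in> carrier Homs" if "d \<in> A" for d using c[OF that] unfolding matlis_dual_deg_iff by blast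
  have H: "\<phi> \<in> carrier Homs" unfolding \<phi> by (rule finsum_Homs_closed) (rule cH)
  have "residue_of (\<phi> m) = 0" if "l \<notin> (\<lambda>d. - int CARD('n) - d) ` A" "m \<in> gr l" for l m
  proof -
    have "residue_of (c d m) = 0" if "d \<in> A" for d
      using c[OF that] \<open>m \<in> gr l\<close> \<open>l \<notin> _\<close> that unfolding matlis_dual_deg_iff by blast
    moreover have "residue_of (finsum Homs c A m) = (\<Sum>d\<in>A. residue_of (c d m))"
      by (rule residue_finsum_Homs) (use cH gr_carrier[OF that(2)] in blast)+
    ultimately show ?thesis unfolding \<phi> by simp
  qed
  then show "\<phi> \<in> carrier Homs \<and> bounded_functional (\<lambda>m. residue_of (\<phi> m))"
    using H residue_functional[OF H] A unfolding bounded_functional_def by blast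
next
  assume *: "\<phi> \<in> carrier Homs \<and> bounded_functional (\<lambda>m. residue_of (\<phi> m))"
  then have H: "\<phi> \<in> carrier Homs" by blast
  obtain S where S: "finite S" "\<And>l m. l \<notin> S \<Longrightarrow> m \<in> gr l \<Longrightarrow> residue_of (\<phi> m) = 0"
    using * by (auto simp: bounded_functional_def)
  let ?n = "- int CARD('n)"
  define A where "A = (\<lambda>s. ?n - s) ` S"
  \<comment> \<open>The part of the residue functional on degree -n-d, which belongs to the
    component of degree d by \<open>matlis_dual_deg_iff\<close>.\<close>
  define f where "f d m = residue_of (\<phi> (truncate {?n - d} m))" for d m
  have f: "bounded_functional (f d)" for d
    unfolding f_def by (rule bounded_functional_truncate[OF residue_functional[OF H]]) simp
  define c where "c d = lift_functional (f d)" for d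
  have cH: "c d \<in> carrier Homs" for d unfolding c_def by (rule lift_functional_Homs[OF f])
  have res: "residue_of (c d m) = f d m" if "m \<in> carrier M" for d m
    unfolding c_def by (rule residue_of_lift_functional[OF f that])
  have "c d \<in> matlis_dual_deg M gr d" for d
    unfolding matlis_dual_deg_iff using cH gr_carrier
    by (auto simp: res f_def truncate_gr Homs_zero[OF H] simp del: Hom_module_simps)
  moreover have FH: "finsum Homs c A \<in> carrier Homs" by (rule finsum_Homs_closed) (rule cH)
  have "\<phi> = finsum Homs c A"
  proof (rule Homs_eqI[OF H FH])
    fix m assume "m \<in> carrier M"
    then show "residue_of (\<phi> m) = residue_of (finsum Homs c A m)"
    proof (induction rule: graded_induct)
      case (gr l m)
      note m = gr_carrier[OF gr]
      have "residue_of (finsum Homs c A m) = (\<Sum>d\<in>A. f d m)"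
        using residue_finsum_Homs[OF cH m] res[OF m] by simp
      \<comment> \<open>On degree l only d = -n-l contributes. If this d is missing from
        \<open>A\<close>, then l is not in \<open>S\<close> and the residue is zero anyway.\<close>
      also have "\<dots> = (\<Sum>d\<in>A. if d = ?n - l then residue_of (\<phi> m) else 0)"
        by (intro sum.cong refl) (auto simp: f_def truncate_gr[OF gr] Homs_zero[OF H])
      also have "\<dots> = residue_of (\<phi> m)"
        using S(2)[OF _ gr] S(1) by (auto simp: A_def)
      finally show ?case by simp
    next
      case (add m m')
      then show ?case
        using HomsD(2)[OF H, of m m'] HomsD(2)[OF FH, of m m'] by simp
    qed
  qed
  moreover have "finite A" using S(1) by (simp add: A_def)
  ultimately show "\<phi> \<in> carrier (matlis_dual M gr)" unfolding matlis_dual_carrier_eq by blast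
qed

lemma matlis_dualD:
  assumes "\<phi> \<in> carrier (matlis_dual M gr)"
  shows "\<phi> \<in> carrier Homs" "bounded_functional (\<lambda>m. residue_of (\<phi> m))"
  using assms unfolding matlis_dual_carrier_iff by auto

lemma matlis_dual_eqI:
  assumes "\<phi> \<in> carrier (matlis_dual M gr)" "\<psi> \<in> carrier (matlis_dual M gr)"
    and "\<And>m. m \<in> carrier M \<Longrightarrow> residue_of (\<phi> m) = residue_of (\<psi> m)"
  shows "\<phi> = \<psi>"
  using assms matlis_dualD by (intro Homs_eqI)

lemma lift_functional_matlis_dual:
  assumes f: "bounded_functional f"
  shows "lift_functional f \<in> carrier (matlis_dual M gr)"
  unfolding matlis_dual_carrier_iff
  by (intro conjI lift_functional_Homs[OF f] bounded_functional_cong[OF f] residue_of_lift_functional[OF f])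

text \<open>Closure is checked on residue functionals; negation is multiplication by the constant -1
  and falls under \<open>bounded_functional_dsmult\<close>.\<close>

lemma module_matlis_dual: "Module.module poly_ring (matlis_dual M gr)"
proof -
  let ?C = "carrier (matlis_dual M gr)"
  interpret H: Module.module poly_ring Homs by (rule module_Homs)
  have b0: "bounded_functional (\<lambda>m. 0)" by (auto simp: bounded_functional_def functional_on_def)
  have zero: "\<zero>\<^bsub>Homs\<^esub> \<in> ?C"
    unfolding matlis_dual_carrier_iff by (intro conjI H.M.zero_closed bounded_functional_cong[OF b0]) simp
  have "submodule ?C poly_ring Homs"
  proof (rule H.submoduleI)
    show "?C \<subseteq> carrier Homs" using matlis_dualD(1) by blast
    show "\<zero>\<^bsub>Homs\<^esub> \<in> ?C" by (rule zero)
  next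
    fix \<phi> assume \<phi>: "\<phi> \<in> ?C"
    note H = matlis_dualD(1)[OF \<phi>]
    have "residue_of ((\<ominus>\<^bsub>Homs\<^esub> \<phi>) m) = residue_of (\<phi> (mult_op (const_poly (-1)) \<odot> m))" if m: "m \<in> carrier M" for m
    proof -
      have "(\<ominus>\<^bsub>Homs\<^esub> \<phi>) m + \<phi> m = 0"
        using fun_cong[OF H.M.l_neg[OF H], of m] m by simp
      then have "(\<ominus>\<^bsub>Homs\<^esub> \<phi>) m = - \<phi> m" by (simp add: eq_neg_iff_add_eq_0)
      then show ?thesis using HomsD(3)[OF H m] by (simp add: residue_of_const_smult)
    qed
    then show "\<ominus>\<^bsub>Homs\<^esub> \<phi> \<in> ?C"
      unfolding matlis_dual_carrier_iff
      by (intro conjI H.M.a_inv_closed[OF H]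
          bounded_functional_cong[OF bounded_functional_dsmult[OF mult_op_diff_op matlis_dualD(2)[OF \<phi>]]])
  next
    fix \<phi> \<psi> assume \<phi>: "\<phi> \<in> ?C" and \<psi>: "\<psi> \<in> ?C"
    show "\<phi> \<oplus>\<^bsub>Homs\<^esub> \<psi> \<in> ?C"
      unfolding matlis_dual_carrier_iff
    proof
      show "\<phi> \<oplus>\<^bsub>Homs\<^esub> \<psi> \<in> carrier Homs" by (rule H.M.a_closed[OF matlis_dualD(1)[OF \<phi>] matlis_dualD(1)[OF \<psi>]])
      show "bounded_functional (\<lambda>m. residue_of ((\<phi> \<oplus>\<^bsub>Homs\<^esub> \<psi>) m))"
        by (rule bounded_functional_cong[OF bounded_functional_plus[OF matlis_dualD(2)[OF \<phi>] matlis_dualD(2)[OF \<psi>]]]) simp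
    qed
  next
    fix r \<phi> assume \<phi>: "\<phi> \<in> ?C"
    show "r \<odot>\<^bsub>Homs\<^esub> \<phi> \<in> ?C"
      unfolding matlis_dual_carrier_iff
    proof
      show "r \<odot>\<^bsub>Homs\<^esub> \<phi> \<in> carrier Homs" by (rule H.smult_closed[OF _ matlis_dualD(1)[OF \<phi>]]) simp
      show "bounded_functional (\<lambda>m. residue_of ((r \<odot>\<^bsub>Homs\<^esub> \<phi>) m))"
        by (rule bounded_functional_cong[OF bounded_functional_dsmult[OF mult_op_diff_op[of r] matlis_dualD(2)[OF \<phi>]]])
          (simp add: HomsD(3)[OF matlis_dualD(1)[OF \<phi>]])
    qed
  qed
  from submodule.submodule_is_module[OF this module_Homs]
  show ?thesis by (simp add: matlis_dual_def graded_Hom_def)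
qed

section \<open>The action of differential operators on the dual\<close>

definition dual_act :: "(('n, 'k) mpoly \<Rightarrow> ('n, 'k) mpoly) \<Rightarrow> ('m \<Rightarrow> ('n, 'k) inv_poly) \<Rightarrow> 'm \<Rightarrow> ('n, 'k) inv_poly" where
  "dual_act P \<phi> = lift_functional (\<lambda>m. residue_of (\<phi> (transpose_op P \<odot> m)))"

abbreviation DM :: "('n, 'k, 'm \<Rightarrow> ('n, 'k) inv_poly) dmodule" where
  "DM \<equiv> with_smult (matlis_dual M gr) dual_act"

context
  fixes P :: "('n, 'k) mpoly \<Rightarrow> ('n, 'k) mpoly" and \<phi>
  assumes P: "P \<in> carrier diff_op_ring" and \<phi>: "\<phi> \<in> carrier (matlis_dual M gr)"
begin

lemma bounded_functional_transpose: "bounded_functional (\<lambda>m. residue_of (\<phi> (transpose_op P \<odot> m)))"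
  by (rule bounded_functional_dsmult[OF transpose_op_closed[OF P] matlis_dualD(2)[OF \<phi>]])

lemma dual_act_closed: "dual_act P \<phi> \<in> carrier (matlis_dual M gr)"
  unfolding dual_act_def by (rule lift_functional_matlis_dual[OF bounded_functional_transpose])

lemma residue_dual_act:
  "m \<in> carrier M \<Longrightarrow> residue_of (dual_act P \<phi> m) = residue_of (\<phi> (transpose_op P \<odot> m))"
  unfolding dual_act_def by (rule residue_of_lift_functional[OF bounded_functional_transpose])

end

lemma matlis_dual_add_closed:
  "\<phi> \<in> carrier (matlis_dual M gr) \<Longrightarrow> \<psi> \<in> carrier (matlis_dual M gr) \<Longrightarrow> \<phi> \<oplus>\<^bsub>Homs\<^esub> \<psi> \<in> carrier (matlis_dual M gr)"
  using abelian_groupE(1)[OF Module.module.axioms(2)[OF module_matlis_dual], of \<phi> \<psi>] by simp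

text \<open>Each axiom is tested on residues and becomes a statement about transposes acting on
  \<open>M\<close>. Precomposition reverses the order of operators and transposition reverses it
  again, so the action is a left action.\<close>

lemma left_module_DM: "left_module diff_op_ring DM"
proof (intro left_module.intro left_module_axioms.intro ring_diff_op_ring)
  show "abelian_group DM"
    by (rule abelian_group_cong[OF Module.module.axioms(2)[OF module_matlis_dual]]) simp_all
next
  fix P :: "('n, 'k) mpoly \<Rightarrow> ('n, 'k) mpoly" and \<phi>
  assume "P \<in> carrier diff_op_ring" "\<phi> \<in> carrier DM"
  then show "P \<odot>\<^bsub>DM\<^esub> \<phi> \<in> carrier DM" by (simp add: dual_act_closed)
next
  fix P Q :: "('n, 'k) mpoly \<Rightarrow> ('n, 'k) mpoly" and \<phi>
  assume PQ: "P \<in> carrier diff_op_ring" "Q \<in> carrier diff_op_ring" and "\<phi> \<in> carrier DM"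
  then have \<phi>: "\<phi> \<in> carrier (matlis_dual M gr)" by simp
  have "dual_act (\<lambda>p. P p + Q p) \<phi> = dual_act P \<phi> \<oplus>\<^bsub>Homs\<^esub> dual_act Q \<phi>"
  proof (rule matlis_dual_eqI)
    fix m assume m: "m \<in> carrier M"
    show "residue_of (dual_act (\<lambda>p. P p + Q p) \<phi> m) = residue_of ((dual_act P \<phi> \<oplus>\<^bsub>Homs\<^esub> dual_act Q \<phi>) m)"
      using m PQ \<phi> by (simp add: residue_dual_act transpose_op_simps add_dsmult HomsD(2)[OF matlis_dualD(1)[OF \<phi>]])
  qed (use PQ \<phi> in \<open>simp_all add: dual_act_closed matlis_dual_add_closed del: Hom_module_simps\<close>)
  then show "(P \<oplus>\<^bsub>diff_op_ring\<^esub> Q) \<odot>\<^bsub>DM\<^esub> \<phi> = P \<odot>\<^bsub>DM\<^esub> \<phi> \<oplus>\<^bsub>DM\<^esub> Q \<odot>\<^bsub>DM\<^esub> \<phi>" by simp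
  have "dual_act (P \<circ> Q) \<phi> = dual_act P (dual_act Q \<phi>)"
  proof (rule matlis_dual_eqI)
    fix m assume m: "m \<in> carrier M"
    show "residue_of (dual_act (P \<circ> Q) \<phi> m) = residue_of (dual_act P (dual_act Q \<phi>) m)"
      using m PQ \<phi> by (simp add: residue_dual_act dual_act_closed transpose_op_simps comp_dsmult del: comp_apply)
  qed (use PQ \<phi> in \<open>simp_all add: dual_act_closed\<close>)
  then show "(P \<otimes>\<^bsub>diff_op_ring\<^esub> Q) \<odot>\<^bsub>DM\<^esub> \<phi> = P \<odot>\<^bsub>DM\<^esub> (Q \<odot>\<^bsub>DM\<^esub> \<phi>)" by simp
next
  fix P :: "('n, 'k) mpoly \<Rightarrow> ('n, 'k) mpoly" and \<phi> \<psi>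
  assume P: "P \<in> carrier diff_op_ring" and "\<phi> \<in> carrier DM" "\<psi> \<in> carrier DM"
  then have \<phi>: "\<phi> \<in> carrier (matlis_dual M gr)" and \<psi>: "\<psi> \<in> carrier (matlis_dual M gr)" by simp_all
  have "dual_act P (\<phi> \<oplus>\<^bsub>Homs\<^esub> \<psi>) = dual_act P \<phi> \<oplus>\<^bsub>Homs\<^esub> dual_act P \<psi>"
  proof (rule matlis_dual_eqI)
    fix m assume m: "m \<in> carrier M"
    have "residue_of (dual_act P (\<phi> \<oplus>\<^bsub>Homs\<^esub> \<psi>) m) = residue_of ((\<phi> \<oplus>\<^bsub>Homs\<^esub> \<psi>) (transpose_op P \<odot>\<^bsub>M\<^esub> m))"
      by (rule residue_dual_act[OF P matlis_dual_add_closed[OF \<phi> \<psi>] m])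
    then show "residue_of (dual_act P (\<phi> \<oplus>\<^bsub>Homs\<^esub> \<psi>) m) = residue_of ((dual_act P \<phi> \<oplus>\<^bsub>Homs\<^esub> dual_act P \<psi>) m)"
      using m P \<phi> \<psi> by (simp add: residue_dual_act)
  qed (use P \<phi> \<psi> in \<open>simp_all add: dual_act_closed matlis_dual_add_closed del: Hom_module_simps\<close>)
  then show "P \<odot>\<^bsub>DM\<^esub> (\<phi> \<oplus>\<^bsub>DM\<^esub> \<psi>) = P \<odot>\<^bsub>DM\<^esub> \<phi> \<oplus>\<^bsub>DM\<^esub> P \<odot>\<^bsub>DM\<^esub> \<psi>" by simp
next
  fix \<phi> assume "\<phi> \<in> carrier DM"
  then have \<phi>: "\<phi> \<in> carrier (matlis_dual M gr)" by simp
  have "dual_act (mult_op 1) \<phi> = \<phi>"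
    by (rule matlis_dual_eqI) (use \<phi> in \<open>simp_all add: dual_act_closed residue_dual_act transpose_op_simps one_dsmult\<close>)
  then show "\<one>\<^bsub>diff_op_ring\<^esub> \<odot>\<^bsub>DM\<^esub> \<phi> = \<phi>" by (simp add: id_eq_mult_op)
qed

sublocale DM: left_dmodule DM
  by (rule left_dmodule.intro[OF left_module_DM])

lemma dual_act_mult_op:
  assumes \<phi>: "\<phi> \<in> carrier (matlis_dual M gr)"
  shows "dual_act (mult_op r) \<phi> = r \<odot>\<^bsub>matlis_dual M gr\<^esub> \<phi>"
proof (rule matlis_dual_eqI)
  show "r \<odot>\<^bsub>matlis_dual M gr\<^esub> \<phi> \<in> carrier (matlis_dual M gr)"
    using Module.module.smult_closed[OF module_matlis_dual _ \<phi>, of r] by simp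
qed (use \<phi> in \<open>simp_all add: dual_act_closed residue_dual_act transpose_op_simps HomsD(3)[OF matlis_dualD(1)[OF \<phi>]]\<close>)

lemma residue_dual_act_partial:
  assumes \<phi>: "\<phi> \<in> carrier (matlis_dual M gr)" and m: "m \<in> carrier M"
  shows "residue_of (dual_act (partial_op j) \<phi> m) = - residue_of (\<phi> (partial_op j \<odot>\<^bsub>M\<^esub> m))"
proof -
  have "(mult_op (- 1) \<circ> partial_op j) \<odot>\<^bsub>M\<^esub> m = mult_op (const_poly (-1)) \<odot>\<^bsub>M\<^esub> (partial_op j \<odot>\<^bsub>M\<^esub> m)"
    using m by (simp add: comp_dsmult const_poly_def single_uminus del: comp_apply)
  then show ?thesis
    using m bounded_functional_const[OF matlis_dualD(2)[OF \<phi>], of "partial_op j \<odot>\<^bsub>M\<^esub> m" "-1"]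
    by (simp add: residue_dual_act[OF partial_op_diff_op \<phi>] transpose_op_simps)
qed

text \<open>The coefficient at -1-a of the left-hand side is minus the residue of \<phi> at the
  derivative of x^a m. The Leibniz rule splits this derivative in two: x^a times the derivative of m
  gives the second term of the formula, and a_j x^(a - e_j) m gives -a_j times a coefficient of
  \<phi>(m), which is the coefficient of the derivative taken in E.\<close>

lemma dual_act_partial_op:
  assumes \<phi>: "\<phi> \<in> carrier (matlis_dual M gr)" and m: "m \<in> carrier M"
  shows "dual_act (partial_op j) \<phi> m = local_coh_partial j (\<phi> m) - \<phi> (partial_op j \<odot>\<^bsub>M\<^esub> m)"
proof (rule local_coh_eqI)
  note H = matlis_dualD(1)[OF \<phi>]
  have H': "dual_act (partial_op j) \<phi> \<in> carrier Homs"
    using matlis_dualD(1)[OF dual_act_closed[OF partial_op_diff_op \<phi>]] .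
  show "dual_act (partial_op j) \<phi> m \<in> carrier local_coh" by (rule HomsD(1)[OF H' m])
  have "local_coh_partial j (\<phi> m) \<in> carrier local_coh" "\<phi> (partial_op j \<odot>\<^bsub>M\<^esub> m) \<in> carrier local_coh"
    using HomsD(1)[OF H] m local_coh_partial_carrier by (blast intro: dsmult_closed partial_op_diff_op)+
  then show "local_coh_partial j (\<phi> m) - \<phi> (partial_op j \<odot>\<^bsub>M\<^esub> m) \<in> carrier local_coh"
    using keys_diff[of "local_coh_partial j (\<phi> m)" "\<phi> (partial_op j \<odot>\<^bsub>M\<^esub> m)"] by auto
  fix a :: "'n \<Rightarrow>\<^sub>0 nat"
  let ?x = "mult_op (single a 1) \<odot>\<^bsub>M\<^esub> m" and ?b = "\<lambda>i. - 1 - int_exp a i"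
  have xm: "?x \<in> carrier M" using m by simp
  have split: "partial_op j \<odot>\<^bsub>M\<^esub> ?x = mult_op (single a 1) \<odot>\<^bsub>M\<^esub> (partial_op j \<odot>\<^bsub>M\<^esub> m) \<oplus>\<^bsub>M\<^esub>
    mult_op (single (a - single j 1) (of_nat (lookup a j))) \<odot>\<^bsub>M\<^esub> m"
    by (rule partial_mult_dsmult[OF m])
  have "lookup (dual_act (partial_op j) \<phi> m) ?b = - residue_of (\<phi> (partial_op j \<odot>\<^bsub>M\<^esub> ?x))"
    using Homs_lookup[OF H' m] residue_dual_act_partial[OF \<phi> xm] by simp
  also have "\<phi> (partial_op j \<odot>\<^bsub>M\<^esub> ?x) = \<phi> (mult_op (single a 1) \<odot>\<^bsub>M\<^esub> (partial_op j \<odot>\<^bsub>M\<^esub> m)) +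
      single (a - single j 1) (of_nat (lookup a j)) \<odot>\<^bsub>local_coh\<^esub> \<phi> m"
    unfolding split using m by (simp add: HomsD(2)[OF H] HomsD(3)[OF H])
  also have "- residue_of \<dots> = - lookup (\<phi> (partial_op j \<odot>\<^bsub>M\<^esub> m)) ?b -
      of_nat (lookup a j) * lookup (\<phi> m) (\<lambda>i. - 1 - int_exp (a - single j 1) i)"
    using m Homs_lookup[OF H, of "partial_op j \<odot>\<^bsub>M\<^esub> m" a] by (simp add: residue_of_single_smult)
  \<comment> \<open>For \<open>lookup a j = 0\<close> the truncated exponent on the left is not the
    wanted one, but both sides are then zero.\<close>
  also have "of_nat (lookup a j) * lookup (\<phi> m) (\<lambda>i. - 1 - int_exp (a - single j 1) i) =
      of_nat (lookup a j) * lookup (\<phi> m) (?b(j := ?b j + 1))"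
  proof (cases "lookup a j = 0")
    case False
    then have "(\<lambda>i. - 1 - int_exp (a - single j 1) i) = ?b(j := ?b j + 1)"
      by (auto simp: fun_eq_iff lookup_minus lookup_single when_def)
    then show ?thesis by simp
  qed simp
  finally show "lookup (dual_act (partial_op j) \<phi> m) ?b =
      lookup (local_coh_partial j (\<phi> m) - \<phi> (partial_op j \<odot>\<^bsub>M\<^esub> m)) ?b"
    by (simp add: lookup_minus lookup_local_coh_partial)
qed

lemma residue_a_inv_DM:
  assumes \<phi>: "\<phi> \<in> carrier (matlis_dual M gr)" and m: "m \<in> carrier M"
  shows "residue_of ((\<ominus>\<^bsub>DM\<^esub> \<phi>) m) = - residue_of (\<phi> m)"
proof -
  have "(\<ominus>\<^bsub>DM\<^esub> \<phi> \<oplus>\<^bsub>DM\<^esub> \<phi>) m = \<zero>\<^bsub>DM\<^esub> m" using DM.A.l_neg[of \<phi>] \<phi> by simp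
  then have "(\<ominus>\<^bsub>DM\<^esub> \<phi>) m + \<phi> m = 0" using m by simp
  then have "(\<ominus>\<^bsub>DM\<^esub> \<phi>) m = - \<phi> m" by (simp add: eq_neg_iff_add_eq_0)
  then show ?thesis by simp
qed

lemma matlis_dual_deg_subset: "matlis_dual_deg M gr d \<subseteq> carrier (matlis_dual M gr)"
proof
  fix \<phi> assume \<phi>: "\<phi> \<in> matlis_dual_deg M gr d"
  then have H: "\<phi> \<in> carrier Homs" unfolding matlis_dual_deg_iff by blast
  have "\<exists>S. finite S \<and> (\<forall>l. l \<notin> S \<longrightarrow> (\<forall>m\<in>gr l. residue_of (\<phi> m) = 0))"
    using \<phi> unfolding matlis_dual_deg_iff by (intro exI[of _ "{- int CARD('n) - d}"]) auto
  then show "\<phi> \<in> carrier (matlis_dual M gr)"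
    unfolding matlis_dual_carrier_iff bounded_functional_def using H residue_functional[OF H] by blast
qed

lemma internal_direct_sum_DM:
  "internal_direct_sum (underlying_poly_module DM) (matlis_dual_deg M gr)"
  unfolding internal_direct_sum_def
proof (intro conjI allI ballI)
  let ?UD = "underlying_poly_module DM"
  interpret UD: abelian_group ?UD
    using DM.module_underlying by (simp add: Module.module_def)
  note zero_closed = UD.zero_closed[unfolded underlying_poly_module_simps with_smult_simps]
  {
    fix d
    show "additive_subgroup (matlis_dual_deg M gr d) ?UD"
    proof (intro additive_subgroupI group.subgroupI[OF UD.a_group], goal_cases)
      case 1
      then show ?case using matlis_dual_deg_subset by simp
    next
      case 2
      have "\<zero>\<^bsub>matlis_dual M gr\<^esub> \<in> matlis_dual_deg M gr d"
        using matlis_dualD(1)[OF zero_closed] gr_carrier unfolding matlis_dual_deg_iff by auto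
      then show ?case by blast
    next
      case (3 \<phi>)
      then have \<phi>: "\<phi> \<in> carrier (matlis_dual M gr)" using matlis_dual_deg_subset by blast
      have "\<ominus>\<^bsub>DM\<^esub> \<phi> \<in> carrier Homs" using DM.A.a_inv_closed[of \<phi>] \<phi> matlis_dualD(1) by simp
      then have "\<ominus>\<^bsub>DM\<^esub> \<phi> \<in> matlis_dual_deg M gr d"
        using 3 residue_a_inv_DM[OF \<phi>] gr_carrier unfolding matlis_dual_deg_iff by auto
      then show ?case using a_inv_cong_record[of ?UD DM \<phi>] by (simp add: a_inv_def)
    next
      case (4 \<phi> \<psi>)
      then have "\<phi> \<oplus>\<^bsub>Homs\<^esub> \<psi> \<in> carrier Homs"
        using matlis_dual_deg_subset matlis_dual_add_closed matlis_dualD(1) by blast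
      then have "\<phi> \<oplus>\<^bsub>Homs\<^esub> \<psi> \<in> matlis_dual_deg M gr d"
        using 4 gr_carrier unfolding matlis_dual_deg_iff by auto
      then show ?case by simp
    qed
  }
  fix \<phi> assume "\<phi> \<in> carrier ?UD"
  then have \<phi>: "\<phi> \<in> carrier (matlis_dual M gr)" by simp
  have fs: "finsum ?UD c A = finsum Homs c A" if "\<And>d. d \<in> A \<Longrightarrow> c d \<in> matlis_dual_deg M gr d" for c and A :: "int set"
    by (rule finsum_sub_record)
      (use abelian_group_Homs UD.abelian_monoid_axioms matlis_dualD(1) matlis_dual_deg_subset that in
        \<open>auto simp: abelian_group_def simp del: Hom_module_simps\<close>)
  have z: "\<zero>\<^bsub>?UD\<^esub> = \<zero>\<^bsub>Homs\<^esub>" by simp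
  let ?K = "\<lambda>c. (\<forall>l. c l \<in> matlis_dual_deg M gr l) \<and> finite {l. c l \<noteq> \<zero>\<^bsub>?UD\<^esub>} \<and>
     \<phi> = (\<Oplus>\<^bsub>?UD\<^esub>l\<in>{l. c l \<noteq> \<zero>\<^bsub>?UD\<^esub>}. c l)"
  \<comment> \<open>A component of degree d has residues only on degree -n-d, and there no other
    component contributes. So it is determined by \<phi>, which gives uniqueness.\<close>
  have val: "residue_of (c d m) = (if l = - int CARD('n) - d then residue_of (\<phi> m) else 0)"
    if c: "?K c" and m: "m \<in> gr l" for c d l m
  proof -
    let ?S = "{l. c l \<noteq> \<zero>\<^bsub>?UD\<^esub>}" and ?d = "- int CARD('n) - l"
    have cd: "c d \<in> carrier Homs" "\<And>l. l \<noteq> - int CARD('n) - d \<Longrightarrow> m \<in> gr l \<Longrightarrow> residue_of (c d m) = 0" for d m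
      using c unfolding matlis_dual_deg_iff by blast+
    have "residue_of (\<phi> m) = (\<Sum>d\<in>?S. residue_of (c d m))"
      using c fs[of ?S c] residue_finsum_Homs[of ?S c m] cd gr_carrier[OF m] by simp
    also have "\<dots> = (\<Sum>d\<in>?S. if d = ?d then residue_of (c ?d m) else 0)"
      using cd(2)[OF _ m] by (intro sum.cong refl) auto
    also have "\<dots> = residue_of (c ?d m)"
      using c gr_carrier[OF m] by (auto simp: sum.delta)
    finally show ?thesis using cd(2)[OF _ m, of d] by auto
  qed
  show "\<exists>!c. ?K c"
  proof (rule ex_ex1I)
    obtain A c where A: "finite A" and c: "\<And>d. d \<in> A \<Longrightarrow> c d \<in> matlis_dual_deg M gr d"
      and \<phi>eq: "\<phi> = finsum Homs c A" using \<phi> unfolding matlis_dual_carrier_eq by blast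
    \<comment> \<open>A family on \<open>A\<close> is extended by zero to one indexed by all
      integers, as the direct sum requires.\<close>
    define c' where "c' d = (if d \<in> A then c d else \<zero>\<^bsub>?UD\<^esub>)" for d
    have sub: "{l. c' l \<noteq> \<zero>\<^bsub>?UD\<^esub>} \<subseteq> A" by (auto simp: c'_def)
    have zd: "\<zero>\<^bsub>?UD\<^esub> \<in> matlis_dual_deg M gr d" for d
      using matlis_dualD(1)[OF zero_closed] gr_carrier unfolding matlis_dual_deg_iff by auto
    have c'd: "c' d \<in> matlis_dual_deg M gr d" for d
      unfolding c'_def using c zd by auto
    interpret H: abelian_group Homs by (rule abelian_group_Homs)
    have c'H: "c' d \<in> carrier Homs" for d using c'd[of d] unfolding matlis_dual_deg_iff by blast
    have "finsum Homs c' {l. c' l \<noteq> \<zero>\<^bsub>?UD\<^esub>} = finsum Homs c' A"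
      by (rule H.add.finprod_mono_neutral_cong_left) (use A sub c'H z in \<open>auto simp del: Hom_module_simps\<close>)
    also have "\<dots> = finsum Homs c A"
      by (rule H.finsum_cong') (use c in \<open>auto simp: c'_def matlis_dual_deg_iff simp del: Hom_module_simps\<close>)
    finally have "\<phi> = (\<Oplus>\<^bsub>?UD\<^esub>l\<in>{l. c' l \<noteq> \<zero>\<^bsub>?UD\<^esub>}. c' l)"
      unfolding \<phi>eq using fs[of "{l. c' l \<noteq> \<zero>\<^bsub>?UD\<^esub>}" c'] c'd by simp
    then show "\<exists>c. ?K c" using c'd finite_subset[OF sub A] by blast
  next
    fix c c' assume K: "?K c" "?K c'"
    show "c = c'"
    proof
      fix d
      have cd: "c d \<in> carrier Homs" "c' d \<in> carrier Homs" using K unfolding matlis_dual_deg_iff by blast+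
      show "c d = c' d"
      proof (rule Homs_eqI[OF cd])
        fix m assume "m \<in> carrier M"
        then show "residue_of (c d m) = residue_of (c' d m)"
        proof (induction rule: graded_induct)
          case (gr l m)
          show ?case unfolding val[OF K(1) gr] val[OF K(2) gr] ..
        next
          case (add m m')
          then show ?case using HomsD(2)[OF cd(1)] HomsD(2)[OF cd(2)] by simp
        qed
      qed
    qed
  qed
qed

lemma graded_dmodule_DM: "graded_dmodule DM (matlis_dual_deg M gr)"
  unfolding graded_dmodule_def graded_poly_module_def
proof (intro conjI left_module_DM DM.module_underlying internal_direct_sum_DM allI ballI)
  fix e d \<phi> and r :: "('n, 'k) mpoly"
  assume r: "r \<in> homogeneous_polys e" and \<phi>: "\<phi> \<in> matlis_dual_deg M gr d"
  note \<phi>' = subsetD[OF matlis_dual_deg_subset \<phi>]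
  have "residue_of (dual_act (mult_op r) \<phi> m) = 0" if l: "l \<noteq> - int CARD('n) - (d + e)" and m: "m \<in> gr l" for l m
  proof -
    \<comment> \<open>Multiplication by \<open>r\<close> takes degree l to l + e, which is the
      degree seen by \<phi> only if l = -n-(d+e).\<close>
    have "l + e \<noteq> - int CARD('n) - d" using l by simp
    then have "residue_of (\<phi> (mult_op r \<odot>\<^bsub>M\<^esub> m)) = 0"
      using \<phi> gr_homogeneous[OF r m] unfolding matlis_dual_deg_iff by blast
    then show ?thesis using residue_dual_act[OF mult_op_diff_op \<phi>' gr_carrier[OF m], of r] by (simp add: transpose_op_simps)
  qed
  then show "r \<odot>\<^bsub>underlying_poly_module DM\<^esub> \<phi> \<in> matlis_dual_deg M gr (d + e)"
    using matlis_dualD(1)[OF dual_act_closed[OF mult_op_diff_op \<phi>']] unfolding matlis_dual_deg_iff by simp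
next
  fix j d \<phi> assume \<phi>: "\<phi> \<in> matlis_dual_deg M gr d"
  note \<phi>' = subsetD[OF matlis_dual_deg_subset \<phi>]
  have "residue_of (dual_act (partial_op j) \<phi> m) = 0" if l: "l \<noteq> - int CARD('n) - (d - 1)" and m: "m \<in> gr l" for l m
  proof -
    have "l - 1 \<noteq> - int CARD('n) - d" using l by simp
    then have "residue_of (\<phi> (partial_op j \<odot>\<^bsub>M\<^esub> m)) = 0"
      using \<phi> gr_partial[OF m] unfolding matlis_dual_deg_iff by blast
    then show ?thesis using residue_dual_act_partial[OF \<phi>' gr_carrier[OF m], of j] by simp
  qed
  then show "partial_op j \<odot>\<^bsub>DM\<^esub> \<phi> \<in> matlis_dual_deg M gr (d - 1)"
    using matlis_dualD(1)[OF dual_act_closed[OF partial_op_diff_op \<phi>']] unfolding matlis_dual_deg_iff by simp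
qed

lemma matlis_dual_action_dual_act: "matlis_dual_action M gr dual_act"
  unfolding matlis_dual_action_def
  using graded_dmodule_DM dual_act_mult_op dual_act_partial_op by blast

text \<open>The action is prescribed on the generators, and the module axioms propagate it to sums
  and composites.\<close>

lemma matlis_dual_action_unique:
  assumes act': "matlis_dual_action M gr act'"
    and P: "P \<in> carrier diff_op_ring" and \<phi>: "\<phi> \<in> carrier (matlis_dual M gr)"
  shows "act' P \<phi> = dual_act P \<phi>"
proof -
  let ?D = "with_smult (matlis_dual M gr) act'"
  interpret D: left_dmodule ?D
    using act' by (intro left_dmodule.intro) (simp add: matlis_dual_action_def graded_dmodule_def)
  show ?thesis using P \<phi>
  proof (induction arbitrary: \<phi> rule: diff_op_induct)
    case (mult r)
    then show ?case using act' dual_act_mult_op by (simp add: matlis_dual_action_def)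
  next
    case (partial j)
    have "act' (partial_op j) \<phi> \<in> carrier (matlis_dual M gr)"
      using D.dsmult_closed[of "partial_op j" \<phi>] partial by simp
    \<comment> \<open>The formula for the derivative only speaks of \<open>m\<close> in the carrier;
      elsewhere both maps agree because elements of the dual are extensional.\<close>
    from HomsD(4)[OF matlis_dualD(1)[OF this]]
      HomsD(4)[OF matlis_dualD(1)[OF dual_act_closed[OF partial_op_diff_op partial]]]
    show ?case
    proof (rule extensionalityI)
      fix m assume m: "m \<in> carrier M"
      show "act' (partial_op j) \<phi> m = dual_act (partial_op j) \<phi> m"
        using act' m partial dual_act_partial_op[OF partial m] by (simp add: matlis_dual_action_def)
    qed
  next
    case (add P Q)
    then show ?case using D.add_dsmult[of P Q \<phi>] DM.add_dsmult[of P Q \<phi>] by simp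
  next
    case (comp P Q)
    have "act' (P \<circ> Q) \<phi> = act' P (act' Q \<phi>)" using D.comp_dsmult[of P Q \<phi>] comp by simp
    moreover have "dual_act (P \<circ> Q) \<phi> = dual_act P (dual_act Q \<phi>)" using DM.comp_dsmult[of P Q \<phi>] comp by simp
    ultimately show ?case using comp dual_act_closed[of Q \<phi>] by (simp add: comp_def)
  qed
qed

end

section \<open>De Rham complexes\<close>

lemma forms_carrier: "carrier (forms i M) = {J. card J = i} \<rightarrow>\<^sub>E carrier M"
  by (simp add: forms_def)

lemma forms_apply [simp]:
  "card J = i \<Longrightarrow> \<zero>\<^bsub>forms i M\<^esub> J = \<zero>\<^bsub>M\<^esub>"
  "card J = i \<Longrightarrow> (\<omega> \<oplus>\<^bsub>forms i M\<^esub> \<eta>) J = \<omega> J \<oplus>\<^bsub>M\<^esub> \<eta> J"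
  "card J = i \<Longrightarrow> (c \<odot>\<^bsub>forms i M\<^esub> \<omega>) J = mult_op (const_poly c) \<odot>\<^bsub>M\<^esub> \<omega> J"
  by (simp_all add: forms_def)

lemma forms_closed [simp]: "\<omega> \<in> carrier (forms i M) \<Longrightarrow> card J = i \<Longrightarrow> \<omega> J \<in> carrier M"
  by (auto simp: forms_carrier)

lemma forms_eqI:
  assumes "\<omega> \<in> carrier (forms i M)" "\<eta> \<in> carrier (forms i M)" "\<And>J. card J = i \<Longrightarrow> \<omega> J = \<eta> J"
  shows "\<omega> = \<eta>"
  using assms unfolding forms_carrier by (intro PiE_ext) auto

definition form_at :: "nat \<Rightarrow> ('n::{finite,linorder}, 'k::field, 'm) dmodule \<Rightarrow> 'n set \<Rightarrow> 'm \<Rightarrow> 'n set \<Rightarrow> 'm" where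
  "form_at i M J m = (\<lambda>K\<in>{K. card K = i}. if K = J then m else \<zero>\<^bsub>M\<^esub>)"

lemma form_at_apply [simp]: "card K = i \<Longrightarrow> form_at i M J m K = (if K = J then m else \<zero>\<^bsub>M\<^esub>)"
  by (simp add: form_at_def)

text \<open>The sign in \<open>de_rham_diff\<close>, as a scalar: after a functional is applied, it
  becomes a factor that can be moved through sums.\<close>

definition koszul_sign :: "'n::{finite,linorder} \<Rightarrow> 'n set \<Rightarrow> 'k::comm_ring_1" where
  "koszul_sign s J = (- 1) ^ card {j \<in> J. j < s}"

lemma koszul_sign_insert [simp]: "koszul_sign s (insert s J) = koszul_sign s J"
  by (simp add: koszul_sign_def conj_disj_distribR cong: conj_cong)

lemma koszul_sign_square: "koszul_sign s J * koszul_sign s J = (1 :: 'k::comm_ring_1)"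
  by (simp add: koszul_sign_def flip: power_add power2_eq_square power_mult)

text \<open>Removing \<open>s\<close> flips the sign of \<open>t\<close> only if \<open>s\<close>
  comes before \<open>t\<close>. For two distinct elements this happens in exactly one of the two
  orders, which is the source of the cancellation in \<open>diff_diff\<close>.\<close>

lemma koszul_sign_Diff:
  assumes "s \<in> J"
  shows "koszul_sign t (J - {s}) = (if s < t then - koszul_sign t J else koszul_sign t J :: 'k::comm_ring_1)"
proof (cases "s < t")
  case True
  then have "{j \<in> J. j < t} = insert s {j \<in> J - {s}. j < t}" using assms by auto
  then have "card {j \<in> J. j < t} = Suc (card {j \<in> J - {s}. j < t})" by simp
  then show ?thesis using True by (simp add: koszul_sign_def)
next
  case False
  then have "{j \<in> J. j < t} = {j \<in> J - {s}. j < t}" by auto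
  then show ?thesis using False by (simp add: koszul_sign_def)
qed

lemma sum_antisymmetric:
  fixes b :: "'a \<Rightarrow> 'a \<Rightarrow> 'k::field_char_0"
  assumes "\<And>s t. s \<in> A \<Longrightarrow> t \<in> A \<Longrightarrow> b s t = - b t s"
  shows "(\<Sum>s\<in>A. \<Sum>t\<in>A. b s t) = 0"
proof -
  have "(\<Sum>s\<in>A. \<Sum>t\<in>A. b s t) = (\<Sum>s\<in>A. \<Sum>t\<in>A. - b t s)"
    by (intro sum.cong refl assms)
  also have "\<dots> = - (\<Sum>s\<in>A. \<Sum>t\<in>A. b t s)" by (simp add: sum_negf)
  also have "(\<Sum>s\<in>A. \<Sum>t\<in>A. b t s) = (\<Sum>s\<in>A. \<Sum>t\<in>A. b s t)" by (rule sum.swap)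
  finally show ?thesis by simp
qed

locale de_rham = left_dmodule M
  for M :: "('n::{finite,linorder}, 'k::field_char_0, 'm) dmodule" (structure)
begin

lemma functional_a_inv:
  assumes f: "functional_on (carrier M) (kspace M) f" and x: "x \<in> carrier M"
  shows "f (\<ominus> x) = - f x"
proof -
  have "f (\<ominus> x) + f x = f (\<ominus> x \<oplus> x)" using functional_onD(1)[OF f, of "\<ominus> x" x] x by simp
  also have "\<dots> = 0" using functional_on_zero[OF module_kspace f] x by (simp add: A.l_neg)
  finally show ?thesis by (simp add: eq_neg_iff_add_eq_0)
qed

text \<open>Signed sums in the record \<open>M\<close> are thus compared through their values, which
  are ordinary sums in the field.\<close>

lemma functionals_eqI:
  assumes x: "x \<in> carrier M" "y \<in> carrier M"
    and eq: "\<And>f. functional_on (carrier M) (kspace M) f \<Longrightarrow> f x = f y"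
  shows "x = y"
proof -
  have "x \<oplus> \<ominus> y = \<zero>\<^bsub>kspace M\<^esub>"
  proof (rule functional_separates[OF module_kspace])
    fix f assume "functional_on (carrier (kspace M)) (kspace M) f"
    then have f: "functional_on (carrier M) (kspace M) f" by simp
    show "f (x \<oplus> \<ominus> y) = 0"
      using functional_onD(1)[OF f, of x "\<ominus> y"] functional_a_inv[OF f x(2)] eq[OF f] x by simp
  qed (use x in simp)
  then show ?thesis using x by (metis A.minus_equality A.minus_minus A.a_inv_closed kspace_simps(3))
qed

lemma module_forms: "Module.module base_field (forms i M)"
proof -
  have add: "\<omega> \<oplus>\<^bsub>forms i M\<^esub> \<eta> \<in> carrier (forms i M)"
    if "\<omega> \<in> carrier (forms i M)" "\<eta> \<in> carrier (forms i M)" for \<omega> \<eta>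
    using that by (auto simp: forms_def)
  have zero: "\<zero>\<^bsub>forms i M\<^esub> \<in> carrier (forms i M)" by (auto simp: forms_def)
  have sc: "c \<odot>\<^bsub>forms i M\<^esub> \<omega> \<in> carrier (forms i M)" if "\<omega> \<in> carrier (forms i M)" for c \<omega>
    using that by (auto simp: forms_def)
  show ?thesis
  proof (intro moduleI comm_ring_1_class.cring_from_type_algebra)
    show "abelian_group (forms i M)"
    proof (rule abelian_groupI)
      fix \<omega> assume \<omega>: "\<omega> \<in> carrier (forms i M)"
      have "(-1) \<odot>\<^bsub>forms i M\<^esub> \<omega> \<oplus>\<^bsub>forms i M\<^esub> \<omega> = \<zero>\<^bsub>forms i M\<^esub>"
      proof (rule forms_eqI[OF add[OF sc[OF \<omega>] \<omega>] zero])
        fix J :: "'n set" assume J: "card J = i"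
        have "\<omega> J \<in> carrier (kspace M)" using \<omega> J by simp
        from module_base_field_a_inv[OF module_kspace this]
        have "mult_op (const_poly (-1)) \<odot> \<omega> J = \<ominus> \<omega> J"
          using a_inv_cong_record[of "kspace M" M "\<omega> J"] by simp
        then show "((-1) \<odot>\<^bsub>forms i M\<^esub> \<omega> \<oplus>\<^bsub>forms i M\<^esub> \<omega>) J = \<zero>\<^bsub>forms i M\<^esub> J"
          using \<omega> J by (simp add: A.l_neg)
      qed
      then show "\<exists>\<eta>\<in>carrier (forms i M). \<eta> \<oplus>\<^bsub>forms i M\<^esub> \<omega> = \<zero>\<^bsub>forms i M\<^esub>" using sc[OF \<omega>] by blast
    qed (auto intro!: add zero forms_eqI simp: A.a_ac)
  qed (auto intro!: add sc forms_eqI simp: const_poly_simps mult_add_dsmult mult_mult_dsmult dsmult_add one_dsmult)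
qed

lemma forms_add_closed [simp]:
  "\<omega> \<in> carrier (forms i M) \<Longrightarrow> \<eta> \<in> carrier (forms i M) \<Longrightarrow> \<omega> \<oplus>\<^bsub>forms i M\<^esub> \<eta> \<in> carrier (forms i M)"
  using abelian_groupE(1)[OF Module.module.axioms(2)[OF module_forms]] .

lemma forms_zero_closed [simp]: "\<zero>\<^bsub>forms i M\<^esub> \<in> carrier (forms i M)"
  using abelian_groupE(2)[OF Module.module.axioms(2)[OF module_forms]] .

lemma forms_smult_closed [simp]: "\<omega> \<in> carrier (forms i M) \<Longrightarrow> c \<odot>\<^bsub>forms i M\<^esub> \<omega> \<in> carrier (forms i M)"
  using Module.module.smult_closed[OF module_forms, of c] by simp

lemma form_at_closed: "m \<in> carrier M \<Longrightarrow> form_at i M J m \<in> carrier (forms i M)"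
  by (auto simp: forms_carrier form_at_def)

lemma diff_closed [simp]:
  assumes "\<omega> \<in> carrier (forms i M)"
  shows "de_rham_diff i M \<omega> \<in> carrier (forms (Suc i) M)"
proof -
  have "\<omega> (J - {s}) \<in> carrier M" if "card J = Suc i" "s \<in> J" for J s
    using assms that by (intro forms_closed) auto
  then show ?thesis unfolding de_rham_diff_def forms_carrier
    by (intro restrict_PiE_iff[THEN iffD2] ballI A.finsum_closed) auto
qed

lemma functional_diff:
  assumes f: "functional_on (carrier M) (kspace M) f" and \<omega>: "\<omega> \<in> carrier (forms i M)" and J: "card J = Suc i"
  shows "f (de_rham_diff i M \<omega> J) = (\<Sum>s\<in>J. koszul_sign s J * f (partial_op s \<odot> \<omega> (J - {s})))"
proof -
  let ?t = "\<lambda>s. if even (card {j \<in> J. j < s}) then partial_op s \<odot> \<omega> (J - {s})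
      else \<ominus> (partial_op s \<odot> \<omega> (J - {s}))"
  have c: "\<omega> (J - {s}) \<in> carrier M" if "s \<in> J" for s
    using \<omega> J that by (intro forms_closed) auto
  have "f (de_rham_diff i M \<omega> J) = f (finsum M ?t J)" using J by (simp add: de_rham_diff_def)
  also have "\<dots> = (\<Sum>s\<in>J. f (?t s))"
    by (rule finsum_additive[OF A.abelian_group_axioms]) (use functional_onD(1)[OF f] c in auto)
  also have "\<dots> = (\<Sum>s\<in>J. koszul_sign s J * f (partial_op s \<odot> \<omega> (J - {s})))"
    using c by (intro sum.cong refl) (auto simp: koszul_sign_def functional_a_inv[OF f])
  finally show ?thesis .
qed

lemma diff_add:
  assumes \<omega>: "\<omega> \<in> carrier (forms i M)" and \<eta>: "\<eta> \<in> carrier (forms i M)"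
  shows "de_rham_diff i M (\<omega> \<oplus>\<^bsub>forms i M\<^esub> \<eta>) = de_rham_diff i M \<omega> \<oplus>\<^bsub>forms (Suc i) M\<^esub> de_rham_diff i M \<eta>"
proof (rule forms_eqI[where M = M])
  fix J :: "'n set" assume J: "card J = Suc i"
  have c: "card (J - {s}) = i" if "s \<in> J" for s using J that by simp
  show "de_rham_diff i M (\<omega> \<oplus>\<^bsub>forms i M\<^esub> \<eta>) J = (de_rham_diff i M \<omega> \<oplus>\<^bsub>forms (Suc i) M\<^esub> de_rham_diff i M \<eta>) J"
  proof (rule functionals_eqI)
    fix f assume f: "functional_on (carrier M) (kspace M) f"
    have "f (de_rham_diff i M (\<omega> \<oplus>\<^bsub>forms i M\<^esub> \<eta>) J) =
      (\<Sum>s\<in>J. koszul_sign s J * f (partial_op s \<odot> \<omega> (J - {s})) + koszul_sign s J * f (partial_op s \<odot> \<eta> (J - {s})))"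
      unfolding functional_diff[OF f forms_add_closed[OF \<omega> \<eta>] J]
      using c \<omega> \<eta> functional_onD(1)[OF f] by (intro sum.cong refl) (simp add: dsmult_add algebra_simps)
    then show "f (de_rham_diff i M (\<omega> \<oplus>\<^bsub>forms i M\<^esub> \<eta>) J) = f ((de_rham_diff i M \<omega> \<oplus>\<^bsub>forms (Suc i) M\<^esub> de_rham_diff i M \<eta>) J)"
      using J \<omega> \<eta> functional_onD(1)[OF f forms_closed[OF diff_closed[OF \<omega>] J] forms_closed[OF diff_closed[OF \<eta>] J]]
      by (simp add: functional_diff[OF f] sum.distrib)
  qed (rule forms_closed[OF diff_closed[OF forms_add_closed[OF \<omega> \<eta>]] J]
      forms_closed[OF forms_add_closed[OF diff_closed[OF \<omega>] diff_closed[OF \<eta>]] J])+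
qed (use \<omega> \<eta> in simp_all)

lemma diff_smult:
  assumes \<omega>: "\<omega> \<in> carrier (forms i M)"
  shows "de_rham_diff i M (c \<odot>\<^bsub>forms i M\<^esub> \<omega>) = c \<odot>\<^bsub>forms (Suc i) M\<^esub> de_rham_diff i M \<omega>"
proof (rule forms_eqI[where M = M])
  fix J :: "'n set" assume J: "card J = Suc i"
  have cJ: "card (J - {s}) = i" if "s \<in> J" for s using J that by simp
  show "de_rham_diff i M (c \<odot>\<^bsub>forms i M\<^esub> \<omega>) J = (c \<odot>\<^bsub>forms (Suc i) M\<^esub> de_rham_diff i M \<omega>) J"
  proof (rule functionals_eqI)
    fix f assume f: "functional_on (carrier M) (kspace M) f"
    have "f (de_rham_diff i M (c \<odot>\<^bsub>forms i M\<^esub> \<omega>) J) =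
      (\<Sum>s\<in>J. c * (koszul_sign s J * f (partial_op s \<odot> \<omega> (J - {s}))))"
      unfolding functional_diff[OF f forms_smult_closed[OF \<omega>] J]
      using cJ \<omega> functional_onD(2)[OF f] by (intro sum.cong refl) (simp add: const_dsmult_commute)
    then show "f (de_rham_diff i M (c \<odot>\<^bsub>forms i M\<^esub> \<omega>) J) = f ((c \<odot>\<^bsub>forms (Suc i) M\<^esub> de_rham_diff i M \<omega>) J)"
      using J \<omega> functional_onD(2)[OF f forms_closed[OF diff_closed[OF \<omega>] J], of c]
      by (simp add: functional_diff[OF f] sum_distrib_left)
  qed (rule forms_closed[OF diff_closed[OF forms_smult_closed[OF \<omega>]] J]
      forms_closed[OF forms_smult_closed[OF diff_closed[OF \<omega>]] J])+
qed (use \<omega> in simp_all)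

lemma diff_diff:
  assumes \<omega>: "\<omega> \<in> carrier (forms i M)"
  shows "de_rham_diff (Suc i) M (de_rham_diff i M \<omega>) = \<zero>\<^bsub>forms (Suc (Suc i)) M\<^esub>"
proof (rule forms_eqI[where M = M])
  fix J :: "'n set" assume J: "card J = Suc (Suc i)"
  show "de_rham_diff (Suc i) M (de_rham_diff i M \<omega>) J = \<zero>\<^bsub>forms (Suc (Suc i)) M\<^esub> J"
  proof (rule functionals_eqI)
    fix f assume f: "functional_on (carrier M) (kspace M) f"
    define F where "F s t = f (partial_op s \<odot> (partial_op t \<odot> \<omega> (J - {s} - {t})))" for s t
    have F: "F s t = F t s" if "s \<in> J" "t \<in> J" "s \<noteq> t" for s t
    proof -
      have "card (J - {s} - {t}) = i" using J that by simp
      then have "\<omega> (J - {s} - {t}) \<in> carrier M" using \<omega> by simp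
      moreover have "partial_op s \<circ> partial_op t = partial_op t \<circ> (partial_op s :: ('n, 'k) mpoly \<Rightarrow> _)"
        by (simp add: fun_eq_iff partial_op_commute[of s t])
      moreover have "J - {s} - {t} = J - {t} - {s}" by auto
      ultimately show ?thesis by (simp add: F_def comp_dsmult del: comp_apply)
    qed
    \<comment> \<open>The diagonal is filled with zeros to sum over a square. Exchanging
      \<open>s\<close> and \<open>t\<close> preserves \<open>F\<close>, as derivatives commute, and
      changes exactly one of the two signs.\<close>
    let ?b = "\<lambda>s t. if s = t then 0 else koszul_sign s J * (koszul_sign t (J - {s}) * F s t)"
    have "f (de_rham_diff (Suc i) M (de_rham_diff i M \<omega>) J) =
       (\<Sum>s\<in>J. koszul_sign s J * f (partial_op s \<odot> de_rham_diff i M \<omega> (J - {s})))"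
      by (rule functional_diff[OF f diff_closed[OF \<omega>] J])
    also have "\<dots> = (\<Sum>s\<in>J. koszul_sign s J * (\<Sum>t\<in>J - {s}. koszul_sign t (J - {s}) * F s t))"
    proof (intro sum.cong refl)
      fix s assume s: "s \<in> J"
      then have "card (J - {s}) = Suc i" using J by simp
      from functional_diff[OF functional_comp_dsmult[OF partial_op_diff_op f] \<omega> this]
      show "koszul_sign s J * f (partial_op s \<odot> de_rham_diff i M \<omega> (J - {s})) =
        koszul_sign s J * (\<Sum>t\<in>J - {s}. koszul_sign t (J - {s}) * F s t)" by (simp add: F_def)
    qed
    also have "\<dots> = (\<Sum>s\<in>J. \<Sum>t\<in>J. ?b s t)"
      unfolding sum_distrib_left
      by (intro sum.cong refl sum.mono_neutral_cong_left) auto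
    also have "\<dots> = 0"
    proof (rule sum_antisymmetric)
      fix s t assume st: "s \<in> J" "t \<in> J"
      show "?b s t = - ?b t s"
      proof (cases s t rule: linorder_cases)
        case less
        then have "\<not> t < s" by simp
        with less show ?thesis using F[OF st] by (simp add: koszul_sign_Diff st)
      next
        case greater
        then have "\<not> s < t" by simp
        with greater show ?thesis using F[OF st] by (simp add: koszul_sign_Diff st)
      qed simp
    qed
    finally show "f (de_rham_diff (Suc i) M (de_rham_diff i M \<omega>) J) = f (\<zero>\<^bsub>forms (Suc (Suc i)) M\<^esub> J)"
      using functional_on_zero[OF module_kspace f] J by simp
  qed (use \<omega> J in \<open>auto intro!: forms_closed[where i = "Suc (Suc i)"]\<close>)
qed (use \<omega> in simp_all)

lemma diff_zero: "de_rham_diff i M \<zero>\<^bsub>forms i M\<^esub> = \<zero>\<^bsub>forms (Suc i) M\<^esub>"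
proof -
  have "0 \<odot>\<^bsub>forms i M\<^esub> \<zero>\<^bsub>forms i M\<^esub> = \<zero>\<^bsub>forms i M\<^esub>"
    using Module.module.smult_l_null[OF module_forms, of "\<zero>\<^bsub>forms i M\<^esub>"] by simp
  moreover have "0 \<odot>\<^bsub>forms (Suc i) M\<^esub> de_rham_diff i M \<zero>\<^bsub>forms i M\<^esub> = \<zero>\<^bsub>forms (Suc i) M\<^esub>"
    using Module.module.smult_l_null[OF module_forms, of "de_rham_diff i M \<zero>\<^bsub>forms i M\<^esub>" "Suc i"] by simp
  ultimately show ?thesis using diff_smult[of "\<zero>\<^bsub>forms i M\<^esub>" i 0] by simp
qed

lemma forms_zero_add: "\<zero>\<^bsub>forms i M\<^esub> \<oplus>\<^bsub>forms i M\<^esub> \<zero>\<^bsub>forms i M\<^esub> = \<zero>\<^bsub>forms i M\<^esub>"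
  by (rule forms_eqI[of _ i M]) auto

lemma forms_zero_smult: "c \<odot>\<^bsub>forms i M\<^esub> \<zero>\<^bsub>forms i M\<^esub> = \<zero>\<^bsub>forms i M\<^esub>"
  by (rule forms_eqI[of _ i M]) auto

lemma submodule_cocycles: "submodule (cocycles i M) base_field (forms i M)"
  unfolding submodule_base_field_iff[OF module_forms]
  by (auto simp: cocycles_def diff_add diff_smult diff_zero forms_zero_add forms_zero_smult)

lemma submodule_diff_image: "submodule (de_rham_diff i M ` carrier (forms i M)) base_field (forms (Suc i) M)"
  unfolding submodule_base_field_iff[OF module_forms]
proof (intro conjI ballI allI)
  show "\<zero>\<^bsub>forms (Suc i) M\<^esub> \<in> de_rham_diff i M ` carrier (forms i M)"
    using diff_zero[of i] forms_zero_closed[of i] by (metis image_eqI)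
qed (auto simp flip: diff_add diff_smult)

lemma submodule_coboundaries: "submodule (coboundaries i M) base_field (forms i M)"
proof (cases i)
  case 0
  have "submodule {\<zero>\<^bsub>forms 0 M\<^esub>} base_field (forms 0 M)"
    unfolding submodule_base_field_iff[OF module_forms] by (auto simp: forms_zero_add forms_zero_smult)
  then show ?thesis using 0 by (simp add: coboundaries_def)
next
  case (Suc h)
  then show ?thesis using submodule_diff_image by (simp add: coboundaries_def)
qed

lemma coboundaries_cocycles: "coboundaries i M \<subseteq> cocycles i M"
  by (cases i) (auto simp: coboundaries_def cocycles_def diff_zero diff_diff)

text \<open>No subset of the variables has n + 1 elements, so there is only one form of degree n +
  1. Used at both ends of the duality: for \<open>M\<close> if i = n and for the dual if i =
  0.\<close>

lemma cocycles_top: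
  assumes "\<omega> \<in> carrier (forms CARD('n) M)"
  shows "\<omega> \<in> cocycles CARD('n) M"
proof -
  have no: "card J \<noteq> Suc CARD('n)" for J :: "'n set" using card_mono[of UNIV J] by auto
  have "de_rham_diff CARD('n) M \<omega> = \<zero>\<^bsub>forms (Suc CARD('n)) M\<^esub>"
    by (rule forms_eqI[of _ "Suc CARD('n)" M]) (use assms no in auto)
  then show ?thesis using assms by (simp add: cocycles_def)
qed

abbreviation cocycle_module :: "nat \<Rightarrow> ('k, 'n set \<Rightarrow> 'm) module" where
  "cocycle_module i \<equiv> (forms i M)\<lparr>carrier := cocycles i M\<rparr>"

lemma module_cocycle_module: "Module.module base_field (cocycle_module i)"
  by (rule submodule.submodule_is_module[OF submodule_cocycles module_forms])

lemma submodule_coboundaries_cocycles: "submodule (coboundaries i M) base_field (cocycle_module i)"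
  using submodule_coboundaries[of i] coboundaries_cocycles[of i]
  unfolding submodule_base_field_iff[OF module_forms] submodule_base_field_iff[OF module_cocycle_module]
  by simp

lemma functional_forms_sum:
  assumes g: "functional_on (carrier (forms i M)) (forms i M) g" and \<omega>: "\<omega> \<in> carrier (forms i M)"
  shows "g \<omega> = (\<Sum>J | card J = i. g (form_at i M J (\<omega> J)))"
proof -
  \<comment> \<open>The form with only the coefficients of \<omega> at members of \<open>A\<close>;
    it is built up one index set at a time.\<close>
  define r where "r A = (\<lambda>K\<in>{K. card K = i}. if K \<in> A then \<omega> K else \<zero>)" for A
  have r: "r A \<in> carrier (forms i M)" for A using \<omega> by (auto simp: r_def forms_carrier)
  have "g (r A) = (\<Sum>J\<in>A. g (form_at i M J (\<omega> J)))" if "finite A" "A \<subseteq> {J. card J = i}" for A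
    using that
  proof (induction A rule: finite_induct)
    case empty
    have "r {} = \<zero>\<^bsub>forms i M\<^esub>" by (rule forms_eqI[OF r forms_zero_closed]) (simp add: r_def)
    then show ?case using functional_on_zero[OF module_forms g] by simp
  next
    case (insert J A)
    have J: "\<omega> J \<in> carrier M" using insert \<omega> by simp
    have "r (insert J A) = form_at i M J (\<omega> J) \<oplus>\<^bsub>forms i M\<^esub> r A"
      by (rule forms_eqI[OF r forms_add_closed[OF form_at_closed[OF J] r]])
        (use insert \<omega> in \<open>auto simp: r_def\<close>)
    then show ?case using insert functional_onD(1)[OF g form_at_closed[OF J] r] by simp
  qed
  from this[of "{J. card J = i}"] have "g (r {J. card J = i}) = (\<Sum>J | card J = i. g (form_at i M J (\<omega> J)))" by simp
  moreover have "r {J. card J = i} = \<omega>" by (rule forms_eqI[OF r \<omega>]) (simp add: r_def)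
  ultimately show ?thesis by simp
qed

end

section \<open>Duality\<close>

text \<open>With the sign of the shuffle of \<open>J\<close> past its complement (up to a factor depending on
  \<open>card J\<close> only), the pairing of forms is skew-adjoint for the de Rham differentials.\<close>

definition shuffle_sign :: "'n::{finite,linorder} set \<Rightarrow> 'k::comm_ring_1" where
  "shuffle_sign J = (\<Prod>j\<in>J. koszul_sign j UNIV)"

lemma koszul_sign_Compl: "koszul_sign s J * koszul_sign s (- J) = (koszul_sign s UNIV :: 'k::comm_ring_1)"
proof -
  have "{j. j < s} = {j \<in> J. j < s} \<union> {j \<in> - J. j < s}" by auto
  then have "card {j. j < s} = card {j \<in> J. j < s} + card {j \<in> - J. j < s}"
    by (simp add: card_Un_disjoint disjoint_iff)
  then show ?thesis by (simp add: koszul_sign_def power_add)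
qed

lemma shuffle_sign_square: "shuffle_sign J * shuffle_sign J = (1 :: 'k::comm_ring_1)"
  by (simp add: shuffle_sign_def koszul_sign_square flip: prod.distrib)

text \<open>Adjoining \<open>s\<close> multiplies the shuffle sign by the sign of \<open>s\<close>
  in the set of all variables. This factors into its signs in \<open>J\<close> and in the
  complement, and the one in \<open>J\<close> cancels against the Koszul sign on the left.\<close>

lemma shuffle_sign_insert:
  assumes "s \<notin> J"
  shows "shuffle_sign (insert s J) * koszul_sign s (insert s J) = (shuffle_sign J * koszul_sign s (- J) :: 'k::comm_ring_1)"
proof -
  have "shuffle_sign (insert s J) * koszul_sign s (insert s J) =
      shuffle_sign J * (koszul_sign s J * koszul_sign s J) * (koszul_sign s (- J) :: 'k)"
    using assms by (simp add: shuffle_sign_def ac_simps flip: koszul_sign_Compl[of s J])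
  then show ?thesis by (simp add: koszul_sign_square)
qed

lemma card_Compl_eq: "card (- J) = CARD('n) - card (J :: 'n::finite set)"
  by (simp add: Compl_eq_Diff_UNIV card_Diff_subset)

section \<open>The pairing between forms on the dual and forms on M\<close>

locale graded_de_rham = graded_dmod M gr
  for M :: "('n::{finite,linorder}, 'k::field_char_0, 'm) dmodule" (structure) and gr
begin

sublocale de_rham M by (rule de_rham.intro[OF left_dmodule_axioms])
sublocale DM: de_rham DM by (rule de_rham.intro[OF DM.left_dmodule_axioms])

abbreviation Dforms :: "nat \<Rightarrow> ('k, 'n set \<Rightarrow> 'm \<Rightarrow> ('n, 'k) inv_poly) module" where
  "Dforms i \<equiv> forms i DM"

lemma Dforms_closed:
  assumes "\<psi> \<in> carrier (Dforms i)" "card J = i"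
  shows "\<psi> J \<in> carrier (matlis_dual M gr)"
  using forms_closed[OF assms] by simp

text \<open>Up to signs this is the residue of the coefficient of the top form in a wedge product:
  dx_J needs the complementary index set, so i-forms on \<open>M\<close> pair with forms of degree n
  - i on the dual.\<close>

definition form_pairing :: "nat \<Rightarrow> ('n set \<Rightarrow> 'm \<Rightarrow> ('n, 'k) inv_poly) \<Rightarrow> ('n set \<Rightarrow> 'm) \<Rightarrow> 'k" where
  "form_pairing i \<psi> \<omega> = (\<Sum>J | card J = i. shuffle_sign J * residue_of (\<psi> (- J) (\<omega> J)))"

text \<open>The residue of the value at a fixed \<open>m\<close>, now as a functional of the map. It
  makes \<open>DM.functional_diff\<close> applicable to the differential of the dual.\<close>

lemma residue_functional_DM:
  assumes m: "m \<in> carrier M"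
  shows "functional_on (carrier DM) (kspace DM) (\<lambda>\<phi>. residue_of (\<phi> m))"
  unfolding functional_on_def
proof (intro conjI ballI allI)
  fix \<phi> \<psi> assume "\<phi> \<in> carrier DM" "\<psi> \<in> carrier DM"
  then show "residue_of ((\<phi> \<oplus>\<^bsub>kspace DM\<^esub> \<psi>) m) = residue_of (\<phi> m) + residue_of (\<psi> m)" using m by simp
next
  fix c \<phi> assume "\<phi> \<in> carrier DM"
  then have \<phi>: "\<phi> \<in> carrier (matlis_dual M gr)" by simp
  show "residue_of ((c \<odot>\<^bsub>kspace DM\<^esub> \<phi>) m) = c * residue_of (\<phi> m)"
    using m dual_act_mult_op[OF \<phi>, of "const_poly c"] by (simp add: residue_of_const_smult)
qed

lemma card_Compl_form: "card J = i \<Longrightarrow> card (- J) = CARD('n) - i" for J :: "'n set"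
  by (simp add: card_Compl_eq)

lemma form_pairing_add:
  assumes "p \<in> carrier (Dforms (CARD('n) - i))" "q \<in> carrier (Dforms (CARD('n) - i))" "\<omega> \<in> carrier (forms i M)"
  shows "form_pairing i (p \<oplus>\<^bsub>Dforms (CARD('n) - i)\<^esub> q) \<omega> = form_pairing i p \<omega> + form_pairing i q \<omega>"
  unfolding form_pairing_def sum.distrib[symmetric]
proof (intro sum.cong refl)
  fix J :: "'n set" assume "J \<in> {J. card J = i}"
  then have J: "card J = i" by simp
  note J' = card_Compl_form[OF J]
  have "residue_of ((p \<oplus>\<^bsub>Dforms (CARD('n) - i)\<^esub> q) (- J) (\<omega> J)) = residue_of (p (- J) (\<omega> J)) + residue_of (q (- J) (\<omega> J))"
    using functional_onD(1)[OF residue_functional_DM[OF forms_closed[OF assms(3) J]] forms_closed[OF assms(1) J'] forms_closed[OF assms(2) J']]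
    by (simp only: forms_apply(2)[OF J'] kspace_simps)
  then show "shuffle_sign J * residue_of ((p \<oplus>\<^bsub>Dforms (CARD('n) - i)\<^esub> q) (- J) (\<omega> J)) =
     shuffle_sign J * residue_of (p (- J) (\<omega> J)) + shuffle_sign J * residue_of (q (- J) (\<omega> J))"
    by (simp only: distrib_left)
qed

lemma form_pairing_smult:
  assumes "p \<in> carrier (Dforms (CARD('n) - i))" "\<omega> \<in> carrier (forms i M)"
  shows "form_pairing i (c \<odot>\<^bsub>Dforms (CARD('n) - i)\<^esub> p) \<omega> = c * form_pairing i p \<omega>"
  unfolding form_pairing_def sum_distrib_left
proof (intro sum.cong refl)
  fix J :: "'n set" assume "J \<in> {J. card J = i}"
  then have J: "card J = i" by simp
  note J' = card_Compl_form[OF J]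
  have "residue_of ((c \<odot>\<^bsub>Dforms (CARD('n) - i)\<^esub> p) (- J) (\<omega> J)) = c * residue_of (p (- J) (\<omega> J))"
    using functional_onD(2)[OF residue_functional_DM[OF forms_closed[OF assms(2) J]] forms_closed[OF assms(1) J']]
    by (simp only: forms_apply(3)[OF J'] kspace_simps)
  then show "shuffle_sign J * residue_of ((c \<odot>\<^bsub>Dforms (CARD('n) - i)\<^esub> p) (- J) (\<omega> J)) =
     c * (shuffle_sign J * residue_of (p (- J) (\<omega> J)))"
    by (simp only: mult.left_commute)
qed

lemma form_pairing_functional:
  assumes p: "p \<in> carrier (Dforms (CARD('n) - i))"
  shows "functional_on (carrier (forms i M)) (forms i M) (form_pairing i p)"
  unfolding functional_on_def
proof (intro conjI ballI allI)
  have bf: "bounded_functional (\<lambda>m. residue_of (p (- J) m))" if "card J = i" for J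
    by (rule matlis_dualD(2)[OF Dforms_closed[OF p card_Compl_form[OF that]]])
  fix \<omega> \<eta> assume \<omega>: "\<omega> \<in> carrier (forms i M)" and \<eta>: "\<eta> \<in> carrier (forms i M)"
  show "form_pairing i p (\<omega> \<oplus>\<^bsub>forms i M\<^esub> \<eta>) = form_pairing i p \<omega> + form_pairing i p \<eta>"
    unfolding form_pairing_def sum.distrib[symmetric]
    by (intro sum.cong refl) (use \<omega> \<eta> in \<open>simp add: bounded_functional_add[OF bf] distrib_left\<close>)
next
  have bf: "bounded_functional (\<lambda>m. residue_of (p (- J) m))" if "card J = i" for J
    by (rule matlis_dualD(2)[OF Dforms_closed[OF p card_Compl_form[OF that]]])
  fix c \<omega> assume \<omega>: "\<omega> \<in> carrier (forms i M)"
  show "form_pairing i p (c \<odot>\<^bsub>forms i M\<^esub> \<omega>) = c * form_pairing i p \<omega>"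
    unfolding form_pairing_def sum_distrib_left
    by (intro sum.cong refl) (use \<omega> in \<open>simp add: bounded_functional_const[OF bf] mult.left_commute\<close>)
qed

lemma form_pairing_form_at:
  assumes p: "p \<in> carrier (Dforms (CARD('n) - i))" and J: "card J = i" and m: "m \<in> carrier M"
  shows "form_pairing i p (form_at i M J m) = shuffle_sign J * residue_of (p (- J) m)"
proof -
  have "form_pairing i p (form_at i M J m) = (\<Sum>K | card K = i. if K = J then shuffle_sign J * residue_of (p (- J) m) else 0)"
    unfolding form_pairing_def
  proof (intro sum.cong refl)
    fix K :: "'n set" assume "K \<in> {K. card K = i}"
    then have K: "card K = i" by simp
    show "shuffle_sign K * residue_of (p (- K) (form_at i M J m K)) =
       (if K = J then shuffle_sign J * residue_of (p (- J) m) else 0)"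
      using K Homs_zero[OF matlis_dualD(1)[OF Dforms_closed[OF p card_Compl_form[OF K]]]] by simp
  qed
  then show ?thesis using J by (simp add: sum.delta)
qed

text \<open>Pairing with the form m dx_J, for J the complement of K, isolates the residue of p(K) at
  m up to a sign whose square is 1.\<close>

lemma form_pairing_eqI:
  assumes i: "i \<le> CARD('n)" and p: "p \<in> carrier (Dforms (CARD('n) - i))" and q: "q \<in> carrier (Dforms (CARD('n) - i))"
    and eq: "\<And>\<omega>. \<omega> \<in> carrier (forms i M) \<Longrightarrow> form_pairing i p \<omega> = form_pairing i q \<omega>"
  shows "p = q"
proof (rule forms_eqI[OF p q])
  fix K :: "'n set" assume K: "card K = CARD('n) - i"
  then have J: "card (- K) = i" using i by (simp add: card_Compl_eq)
  show "p K = q K"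
  proof (rule matlis_dual_eqI[OF Dforms_closed[OF p K] Dforms_closed[OF q K]])
    fix m assume m: "m \<in> carrier M"
    have "shuffle_sign (- K) * residue_of (p K m) = shuffle_sign (- K) * residue_of (q K m)"
      using eq[OF form_at_closed[OF m, of i "- K"]] form_pairing_form_at[OF p J m] form_pairing_form_at[OF q J m] by simp
    then have "shuffle_sign (- K) * shuffle_sign (- K) * residue_of (p K m) =
       shuffle_sign (- K) * shuffle_sign (- K) * residue_of (q K m)" by (simp only: mult.assoc)
    then show "residue_of (p K m) = residue_of (q K m)" by (simp add: shuffle_sign_square)
  qed
qed

text \<open>Both sides are sums over an index set together with one further variable. The minus sign
  comes from the derivatives acting on functionals, and all other signs match by
  \<open>shuffle_sign_insert\<close>.\<close>

lemma form_pairing_diff: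
  assumes i: "Suc i \<le> CARD('n)" and \<psi>: "\<psi> \<in> carrier (Dforms (CARD('n) - Suc i))" and \<omega>: "\<omega> \<in> carrier (forms i M)"
  shows "form_pairing i (de_rham_diff (CARD('n) - Suc i) DM \<psi>) \<omega> = - form_pairing (Suc i) \<psi> (de_rham_diff i M \<omega>)"
proof -
  let ?R = "\<lambda>J s. residue_of (\<psi> (- insert s J) (partial_op s \<odot> \<omega> J))"
  have "form_pairing i (de_rham_diff (CARD('n) - Suc i) DM \<psi>) \<omega> =
    (\<Sum>J | card J = i. \<Sum>s\<in>- J. - (shuffle_sign J * koszul_sign s (- J) * ?R J s))"
    unfolding form_pairing_def
  proof (intro sum.cong refl)
    fix J :: "'n set" assume "J \<in> {J. card J = i}"
    then have J: "card J = i" by simp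
    have J': "card (- J) = Suc (CARD('n) - Suc i)" using card_Compl_form[OF J] i by simp
    have \<omega>J: "\<omega> J \<in> carrier M" using \<omega> J by simp
    have "residue_of (de_rham_diff (CARD('n) - Suc i) DM \<psi> (- J) (\<omega> J)) =
       (\<Sum>s\<in>- J. koszul_sign s (- J) * residue_of ((partial_op s \<odot>\<^bsub>DM\<^esub> \<psi> (- J - {s})) (\<omega> J)))"
      by (rule DM.functional_diff[OF residue_functional_DM[OF \<omega>J] \<psi> J'])
    also have "\<dots> = (\<Sum>s\<in>- J. koszul_sign s (- J) * - ?R J s)"
    proof (intro sum.cong refl)
      fix s assume s: "s \<in> - J"
      have eq: "- J - {s} = - insert s J" by auto
      have "card (- insert s J) = CARD('n) - Suc i" using s J by (simp add: card_Compl_eq)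
      from residue_dual_act_partial[OF Dforms_closed[OF \<psi> this] \<omega>J, of s]
      show "koszul_sign s (- J) * residue_of ((partial_op s \<odot>\<^bsub>DM\<^esub> \<psi> (- J - {s})) (\<omega> J)) =
         koszul_sign s (- J) * - ?R J s" unfolding eq by simp
    qed
    finally show "shuffle_sign J * residue_of (de_rham_diff (CARD('n) - Suc i) DM \<psi> (- J) (\<omega> J)) =
      (\<Sum>s\<in>- J. - (shuffle_sign J * koszul_sign s (- J) * ?R J s))"
      by (simp add: sum_distrib_left mult.assoc)
  qed
  also have "\<dots> = - (\<Sum>(J, s)\<in>(SIGMA J:{J. card J = i}. - J). shuffle_sign J * koszul_sign s (- J) * ?R J s)"
    by (simp add: sum.Sigma sum_negf)
  \<comment> \<open>The pairs (J, s) with s outside J correspond to the pairs (K, s) with s in K by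
    adjoining s to J.\<close>
  also have "(\<Sum>(J, s)\<in>(SIGMA J:{J. card J = i}. - J). shuffle_sign J * koszul_sign s (- J) * ?R J s) =
    (\<Sum>(K, s)\<in>(SIGMA K:{K. card K = Suc i}. K). shuffle_sign K * koszul_sign s K * ?R (K - {s}) s)"
    by (rule sum.reindex_bij_witness[where i = "\<lambda>(K, s). (K - {s}, s)" and j = "\<lambda>(J, s). (insert s J, s)"])
      (auto simp: insert_absorb shuffle_sign_insert simp del: koszul_sign_insert)
  also have "\<dots> = (\<Sum>K | card K = Suc i. \<Sum>s\<in>K. shuffle_sign K * koszul_sign s K * ?R (K - {s}) s)"
    by (simp add: sum.Sigma)
  also have "\<dots> = form_pairing (Suc i) \<psi> (de_rham_diff i M \<omega>)"
    unfolding form_pairing_def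
  proof (intro sum.cong refl)
    fix K :: "'n set" assume "K \<in> {K. card K = Suc i}"
    then have K: "card K = Suc i" by simp
    have "residue_of (\<psi> (- K) (de_rham_diff i M \<omega> K)) =
      (\<Sum>s\<in>K. koszul_sign s K * residue_of (\<psi> (- K) (partial_op s \<odot> \<omega> (K - {s}))))"
      by (rule functional_diff[OF residue_functional[OF matlis_dualD(1)[OF Dforms_closed[OF \<psi> card_Compl_form[OF K]]]] \<omega> K])
    also have "\<dots> = (\<Sum>s\<in>K. koszul_sign s K * ?R (K - {s}) s)"
      by (intro sum.cong refl) (simp add: insert_absorb)
    finally show "(\<Sum>s\<in>K. shuffle_sign K * koszul_sign s K * ?R (K - {s}) s) =
       shuffle_sign K * residue_of (\<psi> (- K) (de_rham_diff i M \<omega> K))"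
      by (simp add: sum_distrib_left mult.assoc)
  qed
  finally show ?thesis .
qed

text \<open>The de Rham complex is the direct sum of the subcomplexes of forms whose coefficients in
  cohomological degree \<open>i\<close> have degree \<open>t - i\<close>; this is the projection to the subcomplexes with
  \<open>t \<in> T\<close>.\<close>

definition truncate_form :: "nat \<Rightarrow> int set \<Rightarrow> ('n set \<Rightarrow> 'm) \<Rightarrow> 'n set \<Rightarrow> 'm" where
  "truncate_form i T \<omega> = (\<lambda>J\<in>{J. card J = i}. truncate {l. l + int i \<in> T} (\<omega> J))"

lemma truncate_form_apply [simp]: "card J = i \<Longrightarrow> truncate_form i T \<omega> J = truncate {l. l + int i \<in> T} (\<omega> J)"
  by (simp add: truncate_form_def)

lemma truncate_form_closed [simp]: "\<omega> \<in> carrier (forms i M) \<Longrightarrow> truncate_form i T \<omega> \<in> carrier (forms i M)"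
  by (auto simp: truncate_form_def forms_carrier)

lemma truncate_form_add:
  assumes "\<omega> \<in> carrier (forms i M)" "\<eta> \<in> carrier (forms i M)"
  shows "truncate_form i T (\<omega> \<oplus>\<^bsub>forms i M\<^esub> \<eta>) = truncate_form i T \<omega> \<oplus>\<^bsub>forms i M\<^esub> truncate_form i T \<eta>"
  by (rule forms_eqI[where M = M and i = i]) (use assms in \<open>simp_all add: truncate_add\<close>)

lemma truncate_form_smult:
  assumes "\<omega> \<in> carrier (forms i M)"
  shows "truncate_form i T (c \<odot>\<^bsub>forms i M\<^esub> \<omega>) = c \<odot>\<^bsub>forms i M\<^esub> truncate_form i T \<omega>"
  by (rule forms_eqI[where M = M and i = i]) (use assms in \<open>simp_all add: truncate_const\<close>)

lemma truncate_zero: "truncate T \<zero> = \<zero>"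
  using truncate_gr[OF gr_zero] by simp

lemma truncate_form_zero: "truncate_form i T \<zero>\<^bsub>forms i M\<^esub> = \<zero>\<^bsub>forms i M\<^esub>"
  by (rule forms_eqI[where M = M and i = i]) (simp_all add: truncate_zero)

lemma functional_truncate:
  assumes f: "functional_on (carrier M) (kspace M) f"
  shows "functional_on (carrier M) (kspace M) (\<lambda>m. f (truncate T m))"
  using functional_onD[OF f] unfolding functional_on_def
  by (auto simp: truncate_add truncate_const)

lemma diff_truncate_form:
  assumes \<omega>: "\<omega> \<in> carrier (forms i M)"
  shows "de_rham_diff i M (truncate_form i T \<omega>) = truncate_form (Suc i) T (de_rham_diff i M \<omega>)"
proof (rule forms_eqI[where M = M and i = "Suc i"])
  fix J :: "'n set" assume J: "card J = Suc i"
  have c: "card (J - {s}) = i" if "s \<in> J" for s using J that by simp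
  show "de_rham_diff i M (truncate_form i T \<omega>) J = truncate_form (Suc i) T (de_rham_diff i M \<omega>) J"
  proof (rule functionals_eqI)
    fix f assume f: "functional_on (carrier M) (kspace M) f"
    have "f (de_rham_diff i M (truncate_form i T \<omega>) J) =
      (\<Sum>s\<in>J. koszul_sign s J * f (partial_op s \<odot> truncate_form i T \<omega> (J - {s})))"
      by (rule functional_diff[OF f truncate_form_closed[OF \<omega>] J])
    also have "\<dots> = (\<Sum>s\<in>J. koszul_sign s J * f (truncate {l. l + int (Suc i) \<in> T} (partial_op s \<odot> \<omega> (J - {s}))))"
      using c \<omega> by (intro sum.cong refl) (simp add: truncate_partial ac_simps)
    also have "\<dots> = f (truncate {l. l + int (Suc i) \<in> T} (de_rham_diff i M \<omega> J))"
      by (rule functional_diff[OF functional_truncate[OF f] \<omega> J, symmetric])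
    finally show "f (de_rham_diff i M (truncate_form i T \<omega>) J) = f (truncate_form (Suc i) T (de_rham_diff i M \<omega>) J)"
      using J by simp
  qed (rule forms_closed[OF diff_closed[OF truncate_form_closed[OF \<omega>]] J]
      forms_closed[OF truncate_form_closed[OF diff_closed[OF \<omega>]] J])+
qed (use \<omega> in simp_all)

lemma truncate_form_eventually:
  assumes \<omega>: "\<omega> \<in> carrier (forms i M)"
  obtains T where "finite T" "\<And>T'. T \<subseteq> T' \<Longrightarrow> truncate_form i T' \<omega> = \<omega>"
proof
  let ?T = "\<Union>J\<in>{J. card J = i}. (\<lambda>l. l + int i) ` {l. comps (\<omega> J) l \<noteq> \<zero>}"
  show "finite ?T" using comps_finite \<omega> by auto
  fix T' assume T': "?T \<subseteq> T'"
  show "truncate_form i T' \<omega> = \<omega>"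
  proof (rule forms_eqI[OF truncate_form_closed[OF \<omega>] \<omega>])
    fix J :: "'n set" assume J: "card J = i"
    have "{l. comps (\<omega> J) l \<noteq> \<zero>} \<subseteq> {l. l + int i \<in> T'}" using T' J by blast
    then show "truncate_form i T' \<omega> J = \<omega> J" using truncate_superset[of "\<omega> J"] \<omega> J by simp
  qed
qed

text \<open>There are finitely many coefficients, each a bounded functional, so the pairing with
  \<open>p\<close> sees only finitely many total degrees.\<close>

lemma form_pairing_truncate:
  assumes p: "p \<in> carrier (Dforms (CARD('n) - i))"
  obtains T where "finite T" "\<And>\<omega>. \<omega> \<in> carrier (forms i M) \<Longrightarrow> form_pairing i p (truncate_form i T \<omega>) = form_pairing i p \<omega>"
proof -
  have "\<exists>S. finite S \<and> (\<forall>l. l \<notin> S \<longrightarrow> (\<forall>m\<in>gr l. residue_of (p (- J) m) = 0))" if "card J = i" for J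
    using matlis_dualD(2)[OF Dforms_closed[OF p card_Compl_form[OF that]]] unfolding bounded_functional_def by blast
  then obtain S where S: "\<And>J. card J = i \<Longrightarrow> finite (S J)"
    "\<And>J l m. card J = i \<Longrightarrow> l \<notin> S J \<Longrightarrow> m \<in> gr l \<Longrightarrow> residue_of (p (- J) m) = 0" by metis
  define T where "T = (\<Union>J\<in>{J. card J = i}. (\<lambda>l. l + int i) ` S J)"
  show ?thesis
  proof
    show "finite T" using S(1) by (auto simp: T_def)
    fix \<omega> assume \<omega>: "\<omega> \<in> carrier (forms i M)"
    have "residue_of (p (- J) (truncate {l. l + int i \<in> T} m)) = residue_of (p (- J) m)"
      if J: "card J = i" and m: "m \<in> carrier M" for J m
      using m
    proof (induction rule: graded_induct)
      case (gr l m)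
      show ?case
      proof (cases "l + int i \<in> T")
        case False
        then have "l \<notin> S J" using J by (auto simp: T_def)
        then have "residue_of (p (- J) m) = 0" using S(2)[OF J _ gr] by blast
        then show ?thesis
          using False Homs_zero[OF matlis_dualD(1)[OF Dforms_closed[OF p card_Compl_form[OF J]]]] by (simp add: truncate_gr[OF gr])
      qed (simp add: truncate_gr[OF gr])
    next
      case (add m m')
      then show ?case
        using HomsD(2)[OF matlis_dualD(1)[OF Dforms_closed[OF p card_Compl_form[OF J]]]] by (simp add: truncate_add)
    qed
    then show "form_pairing i p (truncate_form i T \<omega>) = form_pairing i p \<omega>"
      unfolding form_pairing_def using \<omega> by (intro sum.cong refl) simp
  qed
qed

text \<open>Restricted to forms with a single coefficient and to finitely many degrees,
  \<open>g\<close> becomes a bounded functional on \<open>M\<close>; its lift is a coefficient of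
  \<open>p\<close>.\<close>

lemma form_pairing_represents:
  assumes i: "i \<le> CARD('n)" and g: "functional_on (carrier (forms i M)) (forms i M) g" and T: "finite T"
  obtains p where "p \<in> carrier (Dforms (CARD('n) - i))"
    "\<And>\<omega>. \<omega> \<in> carrier (forms i M) \<Longrightarrow> form_pairing i p \<omega> = g (truncate_form i T \<omega>)"
proof -
  let ?T = "{l. l + int i \<in> T}"
  have "?T = (\<lambda>t. t - int i) ` T" by (auto simp: image_iff) (metis add_diff_cancel_right')
  then have finT: "finite ?T" using T by simp
  define f where "f J m = g (form_at i M J m)" for J m
  have at_add: "form_at i M J (m \<oplus> m') = form_at i M J m \<oplus>\<^bsub>forms i M\<^esub> form_at i M J m'"
    if "m \<in> carrier M" "m' \<in> carrier M" for J m m'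
    by (rule forms_eqI[where M = M and i = i]) (use that form_at_closed in simp_all)
  have at_smult: "form_at i M J (mult_op (const_poly c) \<odot> m) = c \<odot>\<^bsub>forms i M\<^esub> form_at i M J m"
    if "m \<in> carrier M" for J m c
    by (rule forms_eqI[where M = M and i = i]) (use that form_at_closed in simp_all)
  have f: "functional_on (carrier M) (kspace M) (f J)" for J
    unfolding functional_on_def f_def
    by (simp add: at_add at_smult functional_onD(1)[OF g form_at_closed form_at_closed] functional_onD(2)[OF g form_at_closed])
  \<comment> \<open>The sign cancels the one in \<open>form_pairing\<close>, as its square is
    1.\<close>
  define h where "h J m = shuffle_sign J * f J (truncate ?T m)" for J m
  have h: "bounded_functional (h J)" for J
  proof -
    have "functional_on (carrier M) (kspace M) (\<lambda>m. shuffle_sign J * f J m)"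
      using functional_onD[OF f[of J]] unfolding functional_on_def by (auto simp: algebra_simps)
    moreover have "h J = (\<lambda>m. shuffle_sign J * f J (truncate ?T m))" by (simp add: h_def fun_eq_iff)
    ultimately show ?thesis using bounded_functional_truncate[OF _ finT] by simp
  qed
  define p where "p = (\<lambda>K\<in>{K. card K = CARD('n) - i}. lift_functional (h (- K)))"
  have p: "p \<in> carrier (Dforms (CARD('n) - i))"
    unfolding forms_carrier p_def using lift_functional_matlis_dual[OF h] by auto
  show ?thesis
  proof (rule that[OF p])
    fix \<omega> assume \<omega>: "\<omega> \<in> carrier (forms i M)"
    have "form_pairing i p \<omega> = (\<Sum>J | card J = i. g (form_at i M J (truncate_form i T \<omega> J)))"
      unfolding form_pairing_def
    proof (intro sum.cong refl)
      fix J :: "'n set" assume "J \<in> {J. card J = i}"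
      then have J: "card J = i" by simp
      have "shuffle_sign J * residue_of (p (- J) (\<omega> J)) = shuffle_sign J * h J (\<omega> J)"
        using card_Compl_form[OF J] residue_of_lift_functional[OF h, of "\<omega> J" J] \<omega> J by (simp add: p_def)
      also have "\<dots> = (shuffle_sign J * shuffle_sign J) * f J (truncate ?T (\<omega> J))"
        by (simp only: h_def mult.assoc)
      finally show "shuffle_sign J * residue_of (p (- J) (\<omega> J)) = g (form_at i M J (truncate_form i T \<omega> J))"
        using J by (simp add: shuffle_sign_square f_def)
    qed
    then show "form_pairing i p \<omega> = g (truncate_form i T \<omega>)"
      using functional_forms_sum[OF g truncate_form_closed[OF \<omega>]] by simp
  qed
qed

lemma truncate_form_coboundary:
  assumes "\<beta> \<in> coboundaries i M"
  shows "truncate_form i T \<beta> \<in> coboundaries i M"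
proof (cases i)
  case 0
  then show ?thesis using assms truncate_form_zero[of 0] by (simp add: coboundaries_def)
next
  case (Suc h)
  then show ?thesis using assms diff_truncate_form[of _ h T] by (auto simp: coboundaries_def simp flip: diff_truncate_form)
qed

lemma truncate_form_cocycle:
  assumes "\<omega> \<in> cocycles i M"
  shows "truncate_form i T \<omega> \<in> cocycles i M"
  using assms by (simp add: cocycles_def diff_truncate_form truncate_form_zero)

text \<open>If the cohomology is finitely generated, it is concentrated in finitely many degrees.\<close>

lemma finitely_generated_truncate:
  assumes fg: "finitely_generated base_field (de_rham_cohomology i M)"
  obtains T where "finite T"
    "\<And>z. z \<in> cocycles i M \<Longrightarrow> \<exists>\<beta>\<in>coboundaries i M. z = \<beta> \<oplus>\<^bsub>forms i M\<^esub> truncate_form i T z"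
proof -
  let ?V = "cocycle_module i" and ?B = "coboundaries i M"
  let ?Q = "quotient_module ?V ?B"
  note mod = module_cocycle_module[of i] and sub = submodule_coboundaries_cocycles[of i]
  interpret Q: Module.module base_field ?Q by (rule quotient_module_is_module[OF mod sub])
  interpret F: abelian_group "forms i M" using module_forms by (simp add: Module.module_def)
  have car: "carrier ?Q = (\<lambda>x. ?B +>\<^bsub>?V\<^esub> x) ` cocycles i M" by (simp add: rcosets_eq)
  have ZF: "z \<in> carrier (forms i M)" if "z \<in> cocycles i M" for z using that by (simp add: cocycles_def)
  have BZ: "b \<in> cocycles i M" if "b \<in> ?B" for b using coboundaries_cocycles that by blast
  have Badd: "b \<oplus>\<^bsub>forms i M\<^esub> b' \<in> ?B" "c \<odot>\<^bsub>forms i M\<^esub> b \<in> ?B" if "b \<in> ?B" "b' \<in> ?B" for b b' c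
    using submodule_coboundaries[of i] that unfolding submodule_base_field_iff[OF module_forms] by auto
  have Zadd: "b \<oplus>\<^bsub>forms i M\<^esub> b' \<in> cocycles i M" "c \<odot>\<^bsub>forms i M\<^esub> b \<in> cocycles i M"
    if "b \<in> cocycles i M" "b' \<in> cocycles i M" for b b' c
    using submodule_cocycles[of i] that unfolding submodule_base_field_iff[OF module_forms] by auto
  obtain A where A: "finite A" "A \<subseteq> carrier ?Q" and gen: "\<And>x. x \<in> carrier ?Q \<Longrightarrow>
      \<exists>c\<in>A \<rightarrow> carrier base_field. x = (\<Oplus>\<^bsub>?Q\<^esub>b\<in>A. c b \<odot>\<^bsub>?Q\<^esub> b)"
    using fg unfolding finitely_generated_def de_rham_cohomology_def by blast
  have "\<exists>z. z \<in> cocycles i M \<and> b = ?B +>\<^bsub>?V\<^esub> z" if "b \<in> A" for b using A(2) car that by blast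
  then obtain z where z: "\<And>b. b \<in> A \<Longrightarrow> z b \<in> cocycles i M" "\<And>b. b \<in> A \<Longrightarrow> b = ?B +>\<^bsub>?V\<^esub> z b" by metis
  have "\<exists>T. finite T \<and> (\<forall>T'. T \<subseteq> T' \<longrightarrow> truncate_form i T' (z b) = z b)" if "b \<in> A" for b
    using truncate_form_eventually[OF ZF[OF z(1)[OF that]]] by metis
  then obtain S where S: "\<And>b. b \<in> A \<Longrightarrow> finite (S b)"
    "\<And>b T'. b \<in> A \<Longrightarrow> S b \<subseteq> T' \<Longrightarrow> truncate_form i T' (z b) = z b" by metis
  define T where "T = (\<Union>b\<in>A. S b)"
  have T: "truncate_form i T (z b) = z b" if "b \<in> A" for b using S(2)[OF that, of T] that by (auto simp: T_def)
  have zero: "\<zero>\<^bsub>forms i M\<^esub> \<in> ?B" using submodule_coboundaries[of i] unfolding submodule_base_field_iff[OF module_forms] by auto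
  \<comment> \<open>The cocycles with the desired property form a subspace. It contains the
    representatives of the generators, which \<open>T\<close> was chosen not to truncate, and all
    coboundaries.\<close>
  define G where "G x \<longleftrightarrow> x \<in> cocycles i M \<and> (\<exists>\<beta>\<in>?B. x = \<beta> \<oplus>\<^bsub>forms i M\<^esub> truncate_form i T x)" for x
  have G_add: "G (x \<oplus>\<^bsub>forms i M\<^esub> y)" if xy: "G x" "G y" for x y
  proof -
    obtain \<beta> \<gamma> where \<beta>: "\<beta> \<in> ?B" "x = \<beta> \<oplus>\<^bsub>forms i M\<^esub> truncate_form i T x"
      and \<gamma>: "\<gamma> \<in> ?B" "y = \<gamma> \<oplus>\<^bsub>forms i M\<^esub> truncate_form i T y" using xy by (auto simp: G_def)
    have x: "x \<in> cocycles i M" and y: "y \<in> cocycles i M" using xy by (auto simp: G_def)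
    have "x \<oplus>\<^bsub>forms i M\<^esub> y = (\<beta> \<oplus>\<^bsub>forms i M\<^esub> truncate_form i T x) \<oplus>\<^bsub>forms i M\<^esub> (\<gamma> \<oplus>\<^bsub>forms i M\<^esub> truncate_form i T y)"
      using \<beta>(2) \<gamma>(2) by simp
    also have "\<dots> = (\<beta> \<oplus>\<^bsub>forms i M\<^esub> \<gamma>) \<oplus>\<^bsub>forms i M\<^esub> truncate_form i T (x \<oplus>\<^bsub>forms i M\<^esub> y)"
      using ZF[OF x] ZF[OF y] ZF[OF BZ[OF \<beta>(1)]] ZF[OF BZ[OF \<gamma>(1)]] by (simp add: truncate_form_add F.a_ac)
    finally show ?thesis using Badd(1)[OF \<beta>(1) \<gamma>(1)] Zadd(1)[OF x y] unfolding G_def by blast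
  qed
  have G_smult: "G (c \<odot>\<^bsub>forms i M\<^esub> x)" if x: "G x" for c x
  proof -
    obtain \<beta> where \<beta>: "\<beta> \<in> ?B" "x = \<beta> \<oplus>\<^bsub>forms i M\<^esub> truncate_form i T x" using x by (auto simp: G_def)
    have xZ: "x \<in> cocycles i M" using x by (auto simp: G_def)
    have "c \<odot>\<^bsub>forms i M\<^esub> x = c \<odot>\<^bsub>forms i M\<^esub> (\<beta> \<oplus>\<^bsub>forms i M\<^esub> truncate_form i T x)" using \<beta>(2) by simp
    also have "\<dots> = c \<odot>\<^bsub>forms i M\<^esub> \<beta> \<oplus>\<^bsub>forms i M\<^esub> truncate_form i T (c \<odot>\<^bsub>forms i M\<^esub> x)"
      using ZF[OF xZ] ZF[OF BZ[OF \<beta>(1)]] Module.module.smult_r_distr[OF module_forms, of c \<beta> i "truncate_form i T x"]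
      by (simp add: truncate_form_smult)
    finally show ?thesis using Badd(2)[OF \<beta>(1) \<beta>(1), of c] Zadd(2)[OF xZ xZ, of c] unfolding G_def by blast
  qed
  have G_z: "G (z b)" if "b \<in> A" for b
    unfolding G_def using z(1)[OF that] T[OF that] zero ZF[OF z(1)[OF that]] by (intro conjI bexI[of _ "\<zero>\<^bsub>forms i M\<^esub>"]) auto
  have G_B: "G \<beta>" if \<beta>: "\<beta> \<in> ?B" for \<beta>
  proof -
    note t = truncate_form_coboundary[OF \<beta>, of T]
    \<comment> \<open>A coboundary minus its truncation is again a coboundary, since truncation
      commutes with the differential.\<close>
    have "\<beta> = (\<beta> \<oplus>\<^bsub>forms i M\<^esub> (-1) \<odot>\<^bsub>forms i M\<^esub> truncate_form i T \<beta>) \<oplus>\<^bsub>forms i M\<^esub> truncate_form i T \<beta>"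
      using ZF[OF BZ[OF \<beta>]] ZF[OF BZ[OF t]] module_base_field_a_inv[OF module_forms ZF[OF BZ[OF t]], symmetric]
      by (simp add: F.a_assoc F.l_neg)
    moreover have "\<beta> \<oplus>\<^bsub>forms i M\<^esub> (-1) \<odot>\<^bsub>forms i M\<^esub> truncate_form i T \<beta> \<in> ?B"
      using Badd(1)[OF \<beta> Badd(2)[OF t t]] .
    ultimately show ?thesis using BZ[OF \<beta>] unfolding G_def by blast
  qed
  have G_sum: "\<exists>x. G x \<and> (\<Oplus>\<^bsub>?Q\<^esub>b\<in>A'. c b \<odot>\<^bsub>?Q\<^esub> b) = ?B +>\<^bsub>?V\<^esub> x" if "finite A'" "A' \<subseteq> A" for c A'
    using that
  proof (induction A' rule: finite_induct)
    case empty
    have "\<zero>\<^bsub>?Q\<^esub> = ?B +>\<^bsub>?V\<^esub> \<zero>\<^bsub>forms i M\<^esub>"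
      using coset_eq_self_iff[OF mod sub, of "\<zero>\<^bsub>forms i M\<^esub>"] zero BZ[OF zero] by simp
    then show ?case using G_B[OF zero] by auto
  next
    case (insert b A')
    then obtain x where x: "G x" "(\<Oplus>\<^bsub>?Q\<^esub>b\<in>A'. c b \<odot>\<^bsub>?Q\<^esub> b) = ?B +>\<^bsub>?V\<^esub> x" by auto
    have b: "b \<in> A" "A' \<subseteq> A" using insert by auto
    have cl: "c a \<odot>\<^bsub>?Q\<^esub> a \<in> carrier ?Q" if "a \<in> A" for a
      by (rule Q.smult_closed) (use A(2) that in auto)
    have "(\<Oplus>\<^bsub>?Q\<^esub>b\<in>insert b A'. c b \<odot>\<^bsub>?Q\<^esub> b) = c b \<odot>\<^bsub>?Q\<^esub> b \<oplus>\<^bsub>?Q\<^esub> (?B +>\<^bsub>?V\<^esub> x)"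
      unfolding x(2)[symmetric] by (rule Q.M.finsum_insert) (use insert cl b in auto)
    also have "c b \<odot>\<^bsub>?Q\<^esub> b = ?B +>\<^bsub>?V\<^esub> (c b \<odot>\<^bsub>forms i M\<^esub> z b)"
    proof -
      have "z b \<in> carrier ?V" using z(1)[OF b(1)] by simp
      from quotient_smult[OF mod sub this, of "c b"] show ?thesis
        unfolding z(2)[OF b(1), symmetric] by (simp del: quotient_module_simps)
    qed
    also have "(?B +>\<^bsub>?V\<^esub> (c b \<odot>\<^bsub>forms i M\<^esub> z b)) \<oplus>\<^bsub>?Q\<^esub> (?B +>\<^bsub>?V\<^esub> x) = ?B +>\<^bsub>?V\<^esub> ((c b \<odot>\<^bsub>forms i M\<^esub> z b) \<oplus>\<^bsub>forms i M\<^esub> x)"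
      using quotient_add[OF mod sub, of "c b \<odot>\<^bsub>forms i M\<^esub> z b" x] G_smult[OF G_z[OF b(1)], of "c b"] x(1)
      by (simp add: G_def del: quotient_module_simps)
    finally show ?case using G_add[OF G_smult[OF G_z[OF b(1)], of "c b"] x(1)] by blast
  qed
  show ?thesis
  proof (rule that)
    show "finite T" using A(1) S(1) by (auto simp: T_def)
    fix y assume y: "y \<in> cocycles i M"
    then have "?B +>\<^bsub>?V\<^esub> y \<in> carrier ?Q" using car by blast
    from gen[OF this] obtain c where "?B +>\<^bsub>?V\<^esub> y = (\<Oplus>\<^bsub>?Q\<^esub>b\<in>A. c b \<odot>\<^bsub>?Q\<^esub> b)" by blast
    with G_sum[OF A(1) subset_refl, of c] obtain x where x: "G x" "?B +>\<^bsub>?V\<^esub> x = ?B +>\<^bsub>?V\<^esub> y" by metis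
    then obtain \<beta> where \<beta>: "\<beta> \<in> ?B" "y = \<beta> \<oplus>\<^bsub>forms i M\<^esub> x"
      using coset_eq_iff[OF mod sub, of x y] y by (auto simp: G_def)
    have "G y" unfolding \<beta>(2) by (rule G_add[OF G_B[OF \<beta>(1)] x(1)])
    then show "\<exists>\<beta>\<in>?B. y = \<beta> \<oplus>\<^bsub>forms i M\<^esub> truncate_form i T y" by (simp add: G_def)
  qed
qed

text \<open>The pairing on cocycles is fed into \<open>dual_quotient_isomorphic\<close>. The left
  kernel is found by extending a functional from the coboundaries, and surjectivity by extending one
  from the cocycles.\<close>

theorem de_rham_duality:
  assumes i: "i \<le> CARD('n)" and fg: "finitely_generated base_field (de_rham_cohomology i M)"
  shows "module_isomorphic base_field (dual_module base_field (de_rham_cohomology i M))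
    (de_rham_cohomology (CARD('n) - i) DM)"
proof -
  let ?n = "CARD('n)" and ?V = "cocycle_module i" and ?W = "DM.cocycle_module (CARD('n) - i)"
  let ?d = "de_rham_diff i M"
  note fp_zero = functional_on_zero[OF module_forms form_pairing_functional forms_zero_closed]
  have pz: "form_pairing j \<zero>\<^bsub>Dforms (?n - j)\<^esub> \<omega> = 0" if "\<omega> \<in> carrier (forms j M)" for j \<omega>
    using form_pairing_smult[OF DM.forms_zero_closed[of "?n - j"] that, of 0]
      DM.forms_zero_smult[where c = 0 and i = "?n - j"] by simp
  have adj: "form_pairing i (de_rham_diff (?n - Suc i) DM \<psi>) \<omega> = - form_pairing (Suc i) \<psi> (?d \<omega>)"
    if "Suc i \<le> ?n" "\<psi> \<in> carrier (Dforms (?n - Suc i))" "\<omega> \<in> carrier (forms i M)" for \<psi> \<omega>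
    by (rule form_pairing_diff[OF that])
  have cyc: "p \<in> carrier (Dforms (?n - i))" if "p \<in> cocycles (?n - i) DM" for p using that by (simp add: cocycles_def)
  show ?thesis
    unfolding de_rham_cohomology_def
  proof (rule dual_quotient_isomorphic[where pair = "form_pairing i"])
    show "Module.module base_field ?V" by (rule module_cocycle_module)
    show "submodule (coboundaries i M) base_field ?V" by (rule submodule_coboundaries_cocycles)
    show "Module.module base_field ?W" by (rule DM.module_cocycle_module)
    show "submodule (coboundaries (?n - i) DM) base_field ?W" by (rule DM.submodule_coboundaries_cocycles)
  next
    fix p q x assume "p \<in> carrier ?W" "q \<in> carrier ?W" "x \<in> carrier ?V"
    then show "form_pairing i (p \<oplus>\<^bsub>?W\<^esub> q) x = form_pairing i p x + form_pairing i q x"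
      using form_pairing_add[of p i q x] by (simp add: cocycles_def)
  next
    fix c p x assume "p \<in> carrier ?W" "x \<in> carrier ?V"
    then show "form_pairing i (c \<odot>\<^bsub>?W\<^esub> p) x = c * form_pairing i p x"
      using form_pairing_smult[of p i x c] by (simp add: cocycles_def)
  next
    fix p assume "p \<in> carrier ?W"
    then have "p \<in> carrier (Dforms (?n - i))" using cyc by simp
    from functional_on_mono[OF form_pairing_functional[OF this], of "cocycles i M"]
    show "functional_on (carrier ?V) ?V (form_pairing i p)"
      by (simp add: functional_on_def cocycles_def subset_iff)
  next
    fix p b assume "p \<in> carrier ?W" and b: "b \<in> coboundaries i M"
    then have p: "p \<in> cocycles (?n - i) DM" by simp
    show "form_pairing i p b = 0"
    proof (cases i)
      case 0
      then show ?thesis using b fp_zero[OF cyc[OF p]] by (simp add: coboundaries_def)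
    next
      case (Suc h)
      then obtain \<eta> where \<eta>: "\<eta> \<in> carrier (forms h M)" "b = de_rham_diff h M \<eta>" using b by (auto simp: coboundaries_def)
      have h: "Suc h \<le> ?n" "Suc (?n - Suc h) = ?n - h" using i Suc by auto
      \<comment> \<open>As b is the differential of \<eta>, its pairing with \<open>p\<close> is, up
        to sign, the pairing of \<eta> with the differential of \<open>p\<close>, which is
        zero.\<close>
      have "form_pairing h (de_rham_diff (?n - Suc h) DM p) \<eta> = - form_pairing (Suc h) p b"
        unfolding \<eta>(2) by (rule form_pairing_diff[OF h(1) _ \<eta>(1)]) (use cyc[OF p] Suc in simp)
      moreover have "de_rham_diff (?n - Suc h) DM p = \<zero>\<^bsub>Dforms (?n - h)\<^esub>" using p Suc h(2) by (simp add: cocycles_def)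
      ultimately show ?thesis using pz[OF \<eta>(1)] Suc by simp
    qed
  next
    fix p assume "p \<in> carrier ?W" and 0: "\<And>x. x \<in> carrier ?V \<Longrightarrow> form_pairing i p x = 0"
    then have p: "p \<in> carrier (Dforms (?n - i))" using cyc by simp
    have 0: "form_pairing i p x = 0" if "x \<in> cocycles i M" for x using 0[of x] that by simp
    show "p \<in> coboundaries (?n - i) DM"
    proof (cases "i = ?n")
      case True
      \<comment> \<open>In top degree every form is a cocycle, so \<open>p\<close> pairs to zero
        with everything; and zero is the only coboundary of degree 0 on the dual.\<close>
      have "p = \<zero>\<^bsub>Dforms (?n - i)\<^esub>"
      proof (rule form_pairing_eqI[OF i p DM.forms_zero_closed])
        fix \<omega> assume \<omega>: "\<omega> \<in> carrier (forms i M)"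
        then have "\<omega> \<in> cocycles i M" using cocycles_top[of \<omega>] True by simp
        then show "form_pairing i p \<omega> = form_pairing i \<zero>\<^bsub>Dforms (?n - i)\<^esub> \<omega>" using 0 pz[OF \<omega>] by simp
      qed
      then show ?thesis using True by (simp add: coboundaries_def)
    next
      case False
      then have Si: "Suc i \<le> ?n" and nSi: "?n - i = Suc (?n - Suc i)" using i by auto
      note F = form_pairing_functional[OF p]
      \<comment> \<open>Since \<open>p\<close> kills the cocycles, pairing with it factors through
        the differential. This gives a functional on the coboundaries of degree i + 1, whose
        extension to all forms of that degree will supply a primitive of \<open>p\<close>.\<close>
      have well: "form_pairing i p \<omega> = form_pairing i p \<eta>"
        if \<omega>: "\<omega> \<in> carrier (forms i M)" and \<eta>: "\<eta> \<in> carrier (forms i M)" and eq: "?d \<omega> = ?d \<eta>" for \<omega> \<eta>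
      proof -
        let ?x = "\<omega> \<oplus>\<^bsub>forms i M\<^esub> (-1) \<odot>\<^bsub>forms i M\<^esub> \<eta>"
        have "?d \<eta> \<oplus>\<^bsub>forms (Suc i) M\<^esub> (-1) \<odot>\<^bsub>forms (Suc i) M\<^esub> ?d \<eta> = \<zero>\<^bsub>forms (Suc i) M\<^esub>"
          using module_base_field_a_inv[OF module_forms diff_closed[OF \<eta>], symmetric]
            abelian_group.r_neg[OF Module.module.axioms(2)[OF module_forms] diff_closed[OF \<eta>]] by simp
        then have "?x \<in> cocycles i M" using \<omega> \<eta> eq by (simp add: cocycles_def diff_add diff_smult)
        from 0[OF this] show ?thesis
          using functional_onD(1)[OF F \<omega> forms_smult_closed[OF \<eta>, of "-1"]] functional_onD(2)[OF F \<eta>, of "-1"] by simp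
      qed
      define g where "g y = form_pairing i p (SOME \<omega>. \<omega> \<in> carrier (forms i M) \<and> ?d \<omega> = y)" for y
      have g: "g (?d \<omega>) = form_pairing i p \<omega>" if \<omega>: "\<omega> \<in> carrier (forms i M)" for \<omega>
      proof -
        let ?\<eta> = "SOME \<eta>. \<eta> \<in> carrier (forms i M) \<and> ?d \<eta> = ?d \<omega>"
        have "?\<eta> \<in> carrier (forms i M) \<and> ?d ?\<eta> = ?d \<omega>" by (rule someI[of _ \<omega>]) (use \<omega> in simp)
        then show ?thesis unfolding g_def using well[of ?\<eta> \<omega>] \<omega> by blast
      qed
      have "functional_on (?d ` carrier (forms i M)) (forms (Suc i) M) g"
        unfolding functional_on_def
        by (auto simp: g functional_onD(1)[OF F] functional_onD(2)[OF F] simp flip: diff_add diff_smult)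
      from functional_extension[OF module_forms submodule_diff_image this] obtain h
        where h: "functional_on (carrier (forms (Suc i) M)) (forms (Suc i) M) h"
          and hg: "\<And>w. w \<in> ?d ` carrier (forms i M) \<Longrightarrow> h w = g w" by blast
      \<comment> \<open>Truncation in these degrees makes the extension representable without
        changing the pairing with \<open>p\<close>.\<close>
      obtain T where T: "finite T" "\<And>\<omega>. \<omega> \<in> carrier (forms i M) \<Longrightarrow> form_pairing i p (truncate_form i T \<omega>) = form_pairing i p \<omega>"
        using form_pairing_truncate[OF p] by blast
      obtain \<eta> where \<eta>: "\<eta> \<in> carrier (Dforms (?n - Suc i))"
        and \<eta>h: "\<And>\<omega>. \<omega> \<in> carrier (forms (Suc i) M) \<Longrightarrow> form_pairing (Suc i) \<eta> \<omega> = h (truncate_form (Suc i) T \<omega>)"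
        using form_pairing_represents[OF Si h T(1)] by blast
      \<comment> \<open>The sign compensates the minus sign of the adjunction.\<close>
      let ?\<eta> = "(-1) \<odot>\<^bsub>Dforms (?n - Suc i)\<^esub> \<eta>"
      have \<eta>': "?\<eta> \<in> carrier (Dforms (?n - Suc i))" using DM.forms_smult_closed[OF \<eta>] .
      have d\<eta>: "de_rham_diff (?n - Suc i) DM ?\<eta> \<in> carrier (Dforms (?n - i))" unfolding nSi by (rule DM.diff_closed[OF \<eta>'])
      have "p = de_rham_diff (?n - Suc i) DM ?\<eta>"
      proof (rule form_pairing_eqI[OF i p d\<eta>])
        fix \<omega> assume \<omega>: "\<omega> \<in> carrier (forms i M)"
        have "form_pairing i (de_rham_diff (?n - Suc i) DM ?\<eta>) \<omega> = - form_pairing (Suc i) ?\<eta> (?d \<omega>)"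
          by (rule adj[OF Si \<eta>' \<omega>])
        also have "\<dots> = form_pairing (Suc i) \<eta> (?d \<omega>)"
          using form_pairing_smult[OF \<eta> diff_closed[OF \<omega>], of "-1"] by simp
        also have "\<dots> = h (?d (truncate_form i T \<omega>))"
          by (simp only: \<eta>h[OF diff_closed[OF \<omega>]] diff_truncate_form[OF \<omega>])
        also have "\<dots> = form_pairing i p \<omega>"
          using hg[of "?d (truncate_form i T \<omega>)"] g[OF truncate_form_closed[OF \<omega>]] T(2)[OF \<omega>] \<omega> by simp
        finally show "form_pairing i p \<omega> = form_pairing i (de_rham_diff (?n - Suc i) DM ?\<eta>) \<omega>" by simp
      qed
      then show ?thesis using \<eta>' unfolding nSi coboundaries_def by simp
    qed
  next
    fix p x assume p: "p \<in> coboundaries (?n - i) DM" and "x \<in> carrier ?V"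
    then have x: "x \<in> carrier (forms i M)" "?d x = \<zero>\<^bsub>forms (Suc i) M\<^esub>" by (simp_all add: cocycles_def)
    show "form_pairing i p x = 0"
    proof (cases "i = ?n")
      case True
      then show ?thesis using p pz[OF x(1)] by (simp add: coboundaries_def)
    next
      case False
      then have Si: "Suc i \<le> ?n" and nSi: "?n - i = Suc (?n - Suc i)" using i by auto
      then obtain \<psi> where \<psi>: "\<psi> \<in> carrier (Dforms (?n - Suc i))" "p = de_rham_diff (?n - Suc i) DM \<psi>"
        using p unfolding nSi coboundaries_def by auto
      show ?thesis unfolding \<psi>(2) adj[OF Si \<psi>(1) x(1)] x(2) using fp_zero[OF \<psi>(1)] by simp
    qed
  next
    fix g assume g: "functional_on (carrier ?V) ?V g" and g0: "\<And>b. b \<in> coboundaries i M \<Longrightarrow> g b = 0"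
    have gZ: "functional_on (cocycles i M) (forms i M) g" using g by (simp add: functional_on_def)
    obtain T where T: "finite T"
      "\<And>z. z \<in> cocycles i M \<Longrightarrow> \<exists>\<beta>\<in>coboundaries i M. z = \<beta> \<oplus>\<^bsub>forms i M\<^esub> truncate_form i T z"
      using finitely_generated_truncate[OF fg] by blast
    obtain h where h: "functional_on (carrier (forms i M)) (forms i M) h" and hg: "\<And>w. w \<in> cocycles i M \<Longrightarrow> h w = g w"
      using functional_extension[OF module_forms submodule_cocycles gZ] by blast
    obtain p where p: "p \<in> carrier (Dforms (?n - i))"
      and ph: "\<And>\<omega>. \<omega> \<in> carrier (forms i M) \<Longrightarrow> form_pairing i p \<omega> = h (truncate_form i T \<omega>)"
      using form_pairing_represents[OF i h T(1)] by blast
    \<comment> \<open>The functional represented by \<open>p\<close> vanishes on coboundaries,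
      because truncation maps them to coboundaries and \<open>h\<close> vanishes there; by
      adjunction the differential of \<open>p\<close> is zero.\<close>
    have "p \<in> cocycles (?n - i) DM"
    proof (cases i)
      case 0
      then show ?thesis using DM.cocycles_top[of p] p by simp
    next
      case (Suc k)
      then have Sk: "Suc k \<le> ?n" and nSk: "?n - k = Suc (?n - Suc k)" using i by auto
      have p': "p \<in> carrier (Dforms (?n - Suc k))" using p Suc by simp
      have dp: "de_rham_diff (?n - Suc k) DM p \<in> carrier (Dforms (?n - k))" unfolding nSk by (rule DM.diff_closed[OF p'])
      have "de_rham_diff (?n - Suc k) DM p = \<zero>\<^bsub>Dforms (?n - k)\<^esub>"
      proof (rule form_pairing_eqI[OF _ dp DM.forms_zero_closed])
        show "k \<le> ?n" using Sk by simp
        fix \<omega> assume \<omega>: "\<omega> \<in> carrier (forms k M)"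
        have b: "de_rham_diff k M (truncate_form k T \<omega>) \<in> coboundaries i M" using \<omega> Suc by (simp add: coboundaries_def)
        have "form_pairing (Suc k) p (de_rham_diff k M \<omega>) = h (truncate_form (Suc k) T (de_rham_diff k M \<omega>))"
          using ph[of "de_rham_diff k M \<omega>"] diff_closed[OF \<omega>] Suc by simp
        also have "\<dots> = h (de_rham_diff k M (truncate_form k T \<omega>))" by (simp only: diff_truncate_form[OF \<omega>])
        also have "\<dots> = 0" using hg[OF subsetD[OF coboundaries_cocycles b]] g0[OF b] by simp
        finally show "form_pairing k (de_rham_diff (?n - Suc k) DM p) \<omega> = form_pairing k \<zero>\<^bsub>Dforms (?n - k)\<^esub> \<omega>"
          using form_pairing_diff[OF Sk p' \<omega>] pz[OF \<omega>] by simp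
      qed
      then show ?thesis using p Suc nSk by (simp add: cocycles_def)
    qed
    \<comment> \<open>Truncation changes a cocycle by a coboundary only, and \<open>g\<close> does
      not see coboundaries.\<close>
    moreover have "form_pairing i p x = g x" if x: "x \<in> cocycles i M" for x
    proof -
      obtain \<beta> where \<beta>: "\<beta> \<in> coboundaries i M" "x = \<beta> \<oplus>\<^bsub>forms i M\<^esub> truncate_form i T x" using T(2)[OF x] by blast
      have t: "truncate_form i T x \<in> cocycles i M" by (rule truncate_form_cocycle[OF x])
      have "g x = g \<beta> + g (truncate_form i T x)"
        using functional_onD(1)[OF gZ subsetD[OF coboundaries_cocycles \<beta>(1)] t] \<beta>(2) by simp
      then show ?thesis using ph[of x] hg[OF t] g0[OF \<beta>(1)] x by (simp add: cocycles_def)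
    qed
    ultimately show "\<exists>p\<in>carrier ?W. \<forall>x\<in>carrier ?V. form_pairing i p x = g x" by auto
  qed
qed

end

theorem theorem1:
  fixes M :: "('n::{finite,linorder}, 'k::field_char_0, 'm) dmodule"
    and gr :: "int \<Rightarrow> 'm set"
  assumes "graded_dmodule M gr"
  shows "\<exists>act. matlis_dual_action M gr act \<and>
    (\<forall>act'. matlis_dual_action M gr act' \<longrightarrow>
      (\<forall>P\<in>carrier diff_op_ring. \<forall>\<phi>\<in>carrier (matlis_dual M gr). act' P \<phi> = act P \<phi>)) \<and>
    (\<forall>i\<le>CARD('n).
      finitely_generated base_field (de_rham_cohomology i M) \<longrightarrow>
      module_isomorphic base_field
        (dual_module base_field (de_rham_cohomology i M))
        (de_rham_cohomology (CARD('n) - i) (with_smult (matlis_dual M gr) act)))"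
proof -
  interpret graded_de_rham M gr
    using assms by (intro graded_de_rham.intro graded_dmod.intro)
  show ?thesis
    using matlis_dual_action_dual_act matlis_dual_action_unique de_rham_duality by blast
qed

end
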